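(* Let $\mathcal N,\mathcal M\in\mathrm{CPTP}(A\to B)$ be two quantum channels. (1) If $$\lim_{\alpha\to1^+}\widetilde d_\alpha^{\,\mathrm{reg}}(\mathcal N\|\mathcal M)=d^{\mathrm{reg}}(\mathcal N\|\mathcal M),$$ then $\mathcal N,\mathcal M$ exhibit the exponentially strong converse property. (2) Conversely, if the exponentially strong converse property holds for the channels $\mathcal I\otimes\mathcal N$ and $\mathcal I\otimes\mathcal M$, with the identity channel $\mathcal I\in\mathrm{CPTP}(A\to A)$, then $$\lim_{\alpha\to1^+}\widetilde d_\alpha^{\,\mathrm{reg}}(\mathcal I\otimes\mathcal N\|\mathcal I\otimes\mathcal M)=d^{\mathrm{reg}}(\mathcal I\otimes\mathcal N\|\mathcal I\otimes\mathcal M).$$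
   Context: All Hilbert spaces are finite-dimensional; $\mathfrak{D}(A)$ is the set of density operators on $A$, $\mathrm{CPTP}(A\to B)$ the set of quantum channels, $\log$ is base two. $D(\rho\|\sigma)=\operatorname{Tr}[\rho(\log\rho-\log\sigma)]$ if $\operatorname{supp}\rho\subseteq\operatorname{supp}\sigma$, else $+\infty$. For $\alpha>1$, $\widetilde D_\alpha(\rho\|\sigma)=\frac1{\alpha-1}\log\operatorname{Tr}\big[(\sigma^{\frac{1-\alpha}{2\alpha}}\rho\,\sigma^{\frac{1-\alpha}{2\alpha}})^\alpha\big]$ if $\operatorname{supp}\rho\subseteq\operatorname{supp}\sigma$, else $+\infty$. Unstabilized channel divergences: $d(\mathcal N\|\mathcal M)=\sup_{\rho\in\mathfrak{D}(A)}D(\mathcal N(\rho)\|\mathcal M(\rho))$, $\widetilde d_\alpha(\mathcal N\|\mathcal M)=\sup_{\rho\in\mathfrak{D}(A)}\widetilde D_\alpha(\mathcal N(\rho)\|\mathcal M(\rho))$. Regularizations: $d^{\mathrm{reg}}(\mathcal N\|\mathcal M)=\sup_n\frac1n d(\mathcal N^{\otimes n}\|\mathcal M^{\otimes n})$, and $\widetilde d_\alpha^{\,\mathrm{reg}}$ likewise. For channels $\mathcal N,\mathcal M\in\mathrm{CPTP}(A\to B)$, a coherent strategy without quantum memory using $n$ channel uses is a pair $(\psi_n,\Pi_n)$ with $\psi_n\in\mathfrak{D}(A^n)$ and $0\le\Pi_n\le I$ on $B^n$; its Type-I and Type-II errors are $\alpha_n=\operatorname{Tr}[(I-\Pi_n)\mathcal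 N^{\otimes n}(\psi_n)]$ and $\beta_n=\operatorname{Tr}[\Pi_n\mathcal M^{\otimes n}(\psi_n)]$. Exponentially strong converse property (for $\mathcal N,\mathcal M$): for any sequence of such strategies ($n\in\mathbb N$) whose Type-II errors satisfy $\liminf_{n\to\infty}-\frac1n\log\beta_n>d^{\mathrm{reg}}(\mathcal N\|\mathcal M)$, there exist a constant $c>0$ and a subsequence of Type-I errors $\alpha_{n_k}$ such that $1-\alpha_{n_k}\le2^{-cn_k}$ for all sufficiently large $n_k$. *)

theory Defs
  imports
    "Jordan_Normal_Form.Schur_Decomposition"
    "Jordan_Normal_Form.Matrix_Kernel"
    "HOL-Library.Extended_Real"
begin

text \<open>
  A system of dimension \<open>d\<close> is the Hilbert space of complex vectors of length \<open>d\<close>; its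
  operators are the matrices in \<open>carrier_mat d d\<close>. A superoperator from dimension \<open>dA\<close> to
  dimension \<open>dB\<close> is a function on matrices of which only the values on \<open>carrier_mat dA dA\<close>
  matter. The tensor product of systems of dimensions \<open>d\<close> and \<open>e\<close> has dimension \<open>d * e\<close>, the
  pair \<open>(i, k)\<close> of basis indices being encoded as \<open>i * e + k\<close>.
\<close>

definition mat_trace :: "complex mat \<Rightarrow> complex" where
  "mat_trace X = (\<Sum>i<dim_row X. X $$ (i, i))"

text \<open>The order on \<open>complex\<close> is such that \<open>0 \<le> z\<close> says that \<open>z\<close> is real and nonnegative; over
  the complex numbers this condition on all vectors entails that \<open>X\<close> is Hermitian.\<close>

definition psd :: "nat \<Rightarrow> complex mat \<Rightarrow> bool" where
  "psd d X \<longleftrightarrow> X \<in> carrier_mat d d \<and> (\<forall>v \<in> carrier_vec d. 0 \<le> (X *\<^sub>v v) \<bullet>c v)"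

definition density_ops :: "nat \<Rightarrow> complex mat set" where
  "density_ops d = {\<rho>. psd d \<rho> \<and> mat_trace \<rho> = 1}"

definition supp :: "complex mat \<Rightarrow> complex vec set" where
  "supp X = {v \<in> carrier_vec (dim_row X). \<forall>w \<in> mat_kernel X. v \<bullet>c w = 0}"

text \<open>Functional calculus for Hermitian matrices: if \<open>X = U diag(x) U\<^sup>*\<close> with \<open>U\<close> unitary, then
  \<open>herm_fun f X = U diag(f x) U\<^sup>*\<close>, which does not depend on the chosen diagonalization.\<close>

definition herm_fun :: "(real \<Rightarrow> real) \<Rightarrow> complex mat \<Rightarrow> complex mat" where
  "herm_fun f X = (THE Y. \<exists>U x. let d = dim_row X in
     U \<in> carrier_mat d d \<and> mat_adjoint U * U = 1\<^sub>m d \<and>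
     X = U * mat_diag d (\<lambda>i. complex_of_real (x i)) * mat_adjoint U \<and>
     Y = U * mat_diag d (\<lambda>i. complex_of_real (f (x i))) * mat_adjoint U)"

definition kron :: "complex mat \<Rightarrow> complex mat \<Rightarrow> complex mat" where
  "kron X Y = mat (dim_row X * dim_row Y) (dim_col X * dim_col Y)
     (\<lambda>(i, j). X $$ (i div dim_row Y, j div dim_col Y) * Y $$ (i mod dim_row Y, j mod dim_col Y))"

definition mat_unit :: "nat \<Rightarrow> nat \<Rightarrow> nat \<Rightarrow> complex mat" where
  "mat_unit d i j = mat d d (\<lambda>(k, l). if k = i \<and> l = j then 1 else 0)"

text \<open>The tensor product of a superoperator \<open>F\<close> from dimension \<open>a\<close> to \<open>a'\<close> and a superoperator
  \<open>G\<close> from dimension \<open>b\<close> to \<open>b'\<close>: the linear extension of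
  \<open>E\<^sub>i\<^sub>j \<otimes> E\<^sub>k\<^sub>l \<mapsto> F(E\<^sub>i\<^sub>j) \<otimes> G(E\<^sub>k\<^sub>l)\<close> from matrix units.\<close>

definition tensor_map ::
  "nat \<Rightarrow> nat \<Rightarrow> nat \<Rightarrow> nat \<Rightarrow> (complex mat \<Rightarrow> complex mat) \<Rightarrow> (complex mat \<Rightarrow> complex mat) \<Rightarrow>
    complex mat \<Rightarrow> complex mat" where
  "tensor_map a a' b b' F G X = mat (a' * b') (a' * b')
     (\<lambda>(r, s). \<Sum>i<a. \<Sum>j<a. \<Sum>k<b. \<Sum>l<b.
        X $$ (i * b + k, j * b + l) * kron (F (mat_unit a i j)) (G (mat_unit b k l)) $$ (r, s))"

fun tensor_pow ::
  "nat \<Rightarrow> nat \<Rightarrow> (complex mat \<Rightarrow> complex mat) \<Rightarrow> nat \<Rightarrow> complex mat \<Rightarrow> complex mat" where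
  "tensor_pow dA dB N 0 = (\<lambda>X. X)"
| "tensor_pow dA dB N (Suc n) = tensor_map (dA ^ n) (dB ^ n) dA dB (tensor_pow dA dB N n) N"

definition channel :: "nat \<Rightarrow> nat \<Rightarrow> (complex mat \<Rightarrow> complex mat) \<Rightarrow> bool" where
  "channel dA dB N \<longleftrightarrow>
     (\<forall>X \<in> carrier_mat dA dA. N X \<in> carrier_mat dB dB) \<and>
     (\<forall>X \<in> carrier_mat dA dA. \<forall>Y \<in> carrier_mat dA dA. N (X + Y) = N X + N Y) \<and>
     (\<forall>c. \<forall>X \<in> carrier_mat dA dA. N (c \<cdot>\<^sub>m X) = c \<cdot>\<^sub>m N X) \<and>
     (\<forall>X \<in> carrier_mat dA dA. mat_trace (N X) = mat_trace X) \<and>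
     (\<forall>k X. psd (k * dA) X \<longrightarrow> psd (k * dB) (tensor_map k k dA dB (\<lambda>Y. Y) N X))"

text \<open>The library has \<open>log 2 0 = 0\<close> and \<open>0 powr a = 0\<close>, so logarithms and negative powers of
  positive semidefinite matrices are taken on the support.\<close>

definition rel_entropy :: "complex mat \<Rightarrow> complex mat \<Rightarrow> ereal" where
  "rel_entropy \<rho> \<sigma> =
     (if supp \<rho> \<subseteq> supp \<sigma>
      then ereal (Re (mat_trace (\<rho> * (herm_fun (log 2) \<rho> - herm_fun (log 2) \<sigma>))))
      else \<infinity>)"

definition sandwiched :: "real \<Rightarrow> complex mat \<Rightarrow> complex mat \<Rightarrow> ereal" where
  "sandwiched \<alpha> \<rho> \<sigma> =
     (if supp \<rho> \<subseteq> supp \<sigma>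
      then let S = herm_fun (\<lambda>x. x powr ((1 - \<alpha>) / (2 * \<alpha>))) \<sigma>
           in ereal (1 / (\<alpha> - 1) * log 2 (Re (mat_trace (herm_fun (\<lambda>x. x powr \<alpha>) (S * \<rho> * S)))))
      else \<infinity>)"

definition chan_div ::
  "(complex mat \<Rightarrow> complex mat \<Rightarrow> ereal) \<Rightarrow> nat \<Rightarrow>
    (complex mat \<Rightarrow> complex mat) \<Rightarrow> (complex mat \<Rightarrow> complex mat) \<Rightarrow> ereal" where
  "chan_div D dA N M = (SUP \<rho> \<in> density_ops dA. D (N \<rho>) (M \<rho>))"

definition chan_div_reg ::
  "(complex mat \<Rightarrow> complex mat \<Rightarrow> ereal) \<Rightarrow> nat \<Rightarrow> nat \<Rightarrow>
    (complex mat \<Rightarrow> complex mat) \<Rightarrow> (complex mat \<Rightarrow> complex mat) \<Rightarrow> ereal" where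
  "chan_div_reg D dA dB N M =
     (SUP n \<in> {1..}. ereal (1 / real n) *
        chan_div D (dA ^ n) (tensor_pow dA dB N n) (tensor_pow dA dB M n))"

abbreviation d_reg ::
  "nat \<Rightarrow> nat \<Rightarrow> (complex mat \<Rightarrow> complex mat) \<Rightarrow> (complex mat \<Rightarrow> complex mat) \<Rightarrow> ereal" where
  "d_reg \<equiv> chan_div_reg rel_entropy"

abbreviation sandwiched_d_reg ::
  "real \<Rightarrow> nat \<Rightarrow> nat \<Rightarrow> (complex mat \<Rightarrow> complex mat) \<Rightarrow> (complex mat \<Rightarrow> complex mat) \<Rightarrow> ereal" where
  "sandwiched_d_reg \<alpha> \<equiv> chan_div_reg (sandwiched \<alpha>)"

text \<open>A strategy using \<open>n\<close> channel uses consists of an input state \<open>\<psi>\<close> and a test \<open>T\<close>.\<close>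

definition strategy :: "nat \<Rightarrow> nat \<Rightarrow> nat \<Rightarrow> complex mat \<Rightarrow> complex mat \<Rightarrow> bool" where
  "strategy dA dB n \<psi> T \<longleftrightarrow>
     \<psi> \<in> density_ops (dA ^ n) \<and> psd (dB ^ n) T \<and> psd (dB ^ n) (1\<^sub>m (dB ^ n) - T)"

definition type_I_error ::
  "nat \<Rightarrow> nat \<Rightarrow> (complex mat \<Rightarrow> complex mat) \<Rightarrow> nat \<Rightarrow> complex mat \<Rightarrow> complex mat \<Rightarrow> real" where
  "type_I_error dA dB N n \<psi> T = Re (mat_trace ((1\<^sub>m (dB ^ n) - T) * tensor_pow dA dB N n \<psi>))"

definition type_II_error ::
  "nat \<Rightarrow> nat \<Rightarrow> (complex mat \<Rightarrow> complex mat) \<Rightarrow> nat \<Rightarrow> complex mat \<Rightarrow> complex mat \<Rightarrow> real" where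
  "type_II_error dA dB M n \<psi> T = Re (mat_trace (T * tensor_pow dA dB M n \<psi>))"

text \<open>The library's \<open>log 2 0 = 0\<close> would be wrong for a vanishing error, whose exponent is \<open>\<infinity>\<close>.\<close>

definition neg_log2 :: "real \<Rightarrow> ereal" where
  "neg_log2 x = (if x > 0 then ereal (- log 2 x) else \<infinity>)"

definition exp_strong_converse ::
  "nat \<Rightarrow> nat \<Rightarrow> (complex mat \<Rightarrow> complex mat) \<Rightarrow> (complex mat \<Rightarrow> complex mat) \<Rightarrow> bool" where
  "exp_strong_converse dA dB N M \<longleftrightarrow>
     (\<forall>\<psi> T. (\<forall>n\<ge>1. strategy dA dB n (\<psi> n) (T n)) \<longrightarrow>
        liminf (\<lambda>n. ereal (1 / real n) * neg_log2 (type_II_error dA dB M n (\<psi> n) (T n)))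
          > d_reg dA dB N M \<longrightarrow>
        (\<exists>c>0. \<exists>k :: nat \<Rightarrow> nat. strict_mono k \<and>
           (\<forall>\<^sub>F i in sequentially.
              1 - type_I_error dA dB N (k i) (\<psi> (k i)) (T (k i)) \<le> 2 powr (- c * real (k i)))))"

end

theory Submission
  imports Defs "HOL-Analysis.Convex" "HOL-Real_Asymp.Real_Asymp" "Jordan_Normal_Form.Spectral_Radius"
begin

text \<open>
  For (1), the bound \<open>Tr(T \<rho>)\<^sup>\<alpha> \<le> Q\<^sub>\<alpha>(\<rho>, \<sigma>) Tr(T \<sigma>)\<^sup>\<alpha>\<^sup>-\<^sup>1\<close> for the sandwiched quantity \<open>Q\<^sub>\<alpha>\<close> and a test \<open>T\<close>
  makes the success probability exponentially small as soon as the Type-II exponent exceeds the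
  regularized sandwiched divergence for some \<open>\<alpha> > 1\<close>.

  For (2), \<open>D \<le> D\<^sub>\<alpha>\<close> gives one inequality. If the limit exceeded \<open>d\<^sup>r\<^sup>e\<^sup>g\<close>, then for \<open>\<alpha>\<close> arbitrarily close
  to 1 some input state would have a sandwiched divergence per use above a fixed \<open>L > d\<^sup>r\<^sup>e\<^sup>g\<close>. On many
  copies of this state, a spectral projection of the output on a spectral subspace of the
  alternative is a test with Type-II error at most \<open>2\<^sup>-\<^sup>c\<close> and success probability at least \<open>2\<^sup>-\<^sup>\<epsilon>\<^sup>c\<close>,
  where \<open>\<epsilon>\<close> is of the order of \<open>\<alpha> - 1\<close>. Repeating it just often enough for a Type-II exponent above
  \<open>d\<^sup>r\<^sup>e\<^sup>g\<close> gives a success probability decaying at an arbitrarily small rate, which contradicts the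
  strong converse property.
\<close>

section \<open>Complex matrices\<close>

text \<open>Non-commutativity is handled by choosing one eigenbasis per inequality and comparing
  diagonal entries in it: there the Hoelder and Jensen inequalities for finite sums apply, and
  Jensen also relates diagonals to eigenvalues. In (2), a large sandwiched quantity may be caused by
  rare events with an enormous likelihood ratio. The exponent c of the test is therefore bounded
  below but not above, and its success probability can only be measured against c, not against the
  number of channel uses. This is harmless because repetitions are counted in units of c: a larger c
  means fewer repetitions. The order of quantifiers is the second obstacle. The rate granted by the
  strong converse property depends on the sequence of strategies, so having a different sequence for
  every small decay rate contradicts nothing; a single sequence has to beat all rates.\<close>

declare index_mult_mat(1) [simp del]

abbreviation adj :: "complex mat \<Rightarrow> complex mat" where
  "adj \<equiv> mat_adjoint"

lemma dim_adj [simp]: "dim_row (adj A) = dim_col A" "dim_col (adj A) = dim_row A"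
  by (simp_all add: mat_adjoint_def)

lemma adj_carrier [simp]: "A \<in> carrier_mat m n \<Longrightarrow> adj A \<in> carrier_mat n m"
  using carrier_matI[of "adj A" n m] by auto

lemma index_adj [simp]:
  "i < dim_col A \<Longrightarrow> j < dim_row A \<Longrightarrow> adj A $$ (i, j) = cnj (A $$ (j, i))"
  by (simp add: mat_adjoint_def mat_of_rows_index)

lemma adj_adj [simp]: "adj (adj A) = A"
  by (rule eq_matI) auto

lemma index_mult:
  "i < dim_row A \<Longrightarrow> j < dim_col B \<Longrightarrow> dim_col A = dim_row B \<Longrightarrow>
    (A * B) $$ (i, j) = (\<Sum>k<dim_row B. A $$ (i, k) * B $$ (k, j))"
  by (simp add: index_mult_mat(1) scalar_prod_def lessThan_atLeast0)

lemma adj_mult: "dim_col A = dim_row B \<Longrightarrow> adj (A * B) = adj B * adj A"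
  by (rule eq_matI) (auto simp: index_mult mult.commute)

lemma mult_assoc_dim:
  fixes A B C :: "complex mat"
  shows "dim_col A = dim_row B \<Longrightarrow> dim_col B = dim_row C \<Longrightarrow> A * B * C = A * (B * C)"
  by (rule assoc_mult_mat[of A "dim_row A" "dim_row B" B "dim_row C" C "dim_col C"]) auto

lemma mat_trace_mult_comm:
  assumes "dim_row A = dim_col B" "dim_col A = dim_row B"
  shows "mat_trace (A * B) = mat_trace (B * A)"
  unfolding mat_trace_def using assms
  by (simp add: index_mult mult.commute) (rule sum.swap)

lemma mat_trace_diff:
  "A \<in> carrier_mat n n \<Longrightarrow> B \<in> carrier_mat n n \<Longrightarrow> mat_trace (A - B) = mat_trace A - mat_trace B"
  by (auto simp: mat_trace_def sum_subtractf)

lemma unitary_right: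
  "U \<in> carrier_mat d d \<Longrightarrow> adj U * U = 1\<^sub>m d \<Longrightarrow> U * adj U = 1\<^sub>m d"
  by (rule mat_mult_left_right_inverse[of "adj U" d U]) auto

lemma unitary_cancel:
  assumes "U \<in> carrier_mat d d" "adj U * U = 1\<^sub>m d" "dim_row A = d"
  shows "adj U * (U * A) = A" "U * (adj U * A) = A"
proof -
  have A: "A \<in> carrier_mat d (dim_col A)" using assms(3) by (metis carrier_matI)
  note U = carrier_matD[OF assms(1)]
  have "adj U * (U * A) = adj U * U * A" by (rule mult_assoc_dim[symmetric]) (simp_all add: U assms(3))
  then show "adj U * (U * A) = A" using A assms(2) by simp
  have "U * (adj U * A) = U * adj U * A" by (rule mult_assoc_dim[symmetric]) (simp_all add: U assms(3))
  then show "U * (adj U * A) = A" using A unitary_right[OF assms(1,2)] by simp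
qed

section \<open>Spectral decompositions\<close>

abbreviation rdiag :: "nat \<Rightarrow> (nat \<Rightarrow> real) \<Rightarrow> complex mat" where
  "rdiag d x \<equiv> mat_diag d (\<lambda>i. complex_of_real (x i))"

definition diagd :: "nat \<Rightarrow> complex mat \<Rightarrow> complex mat \<Rightarrow> (nat \<Rightarrow> real) \<Rightarrow> bool" where
  "diagd d X U x \<longleftrightarrow> U \<in> carrier_mat d d \<and> adj U * U = 1\<^sub>m d \<and> X = U * rdiag d x * adj U"

lemma dim_mat_diag [simp]: "dim_row (mat_diag d f) = d" "dim_col (mat_diag d f) = d"
  by (simp_all add: mat_diag_def)

lemma index_rdiag:
  "i < d \<Longrightarrow> j < d \<Longrightarrow> rdiag d x $$ (i, j) = (if i = j then complex_of_real (x i) else 0)"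
  by (simp add: mat_diag_def)

lemma adj_rdiag [simp]: "adj (rdiag d x) = rdiag d x"
  by (rule eq_matI) (auto simp: index_rdiag)

lemma diagdD:
  assumes "diagd d X U x"
  shows "U \<in> carrier_mat d d" "adj U * U = 1\<^sub>m d" "U * adj U = 1\<^sub>m d"
    "X = U * (rdiag d x * adj U)" "X \<in> carrier_mat d d" "dim_row U = d" "dim_col U = d"
    "dim_row X = d" "dim_col X = d"
  using assms unitary_right by (auto simp: diagd_def mult_assoc_dim)

lemmas diagd_simps = diagdD(1-3,5-7)

lemma unitary_diag_index:
  assumes "A \<in> carrier_mat n d" "B \<in> carrier_mat n d" "i < n" "j < n"
  shows "(A * (rdiag d x * adj B)) $$ (i, j) = (\<Sum>k<d. x k * A $$ (i, k) * cnj (B $$ (j, k)))"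
  using assms
  by (subst mat_diag_mult_left[of "adj B" d n])
     (auto simp: index_mult mult_ac intro!: sum.cong)

lemma diagd_index:
  assumes "diagd d X U x" "i < d" "j < d"
  shows "X $$ (i, j) = (\<Sum>k<d. x k * U $$ (i, k) * cnj (U $$ (j, k)))"
  by (subst diagdD(4)[OF assms(1)], rule unitary_diag_index[where n = d])
     (simp_all add: diagdD(1)[OF assms(1)] assms(2,3))

lemma diagd_adj: "diagd d X U x \<Longrightarrow> adj X = X"
  using diagdD[of d X U x] by (metis adj_adj adj_mult adj_rdiag dim_adj dim_mat_diag index_mult_mat(2,3) mult_assoc_dim)

lemma diagd_conj:
  assumes "diagd d X U x" shows "adj U * (X * U) = rdiag d x" "X * U = U * rdiag d x"
proof -
  note [simp] = diagd_simps[OF assms]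
  have "X * U = U * (rdiag d x * (adj U * U))"
    by (subst diagdD(4)[OF assms]) (simp add: mult_assoc_dim)
  then show "X * U = U * rdiag d x"
    by (simp add: right_mult_one_mat[of _ d d])
  then show "adj U * (X * U) = rdiag d x"
    using unitary_cancel[of U d] by simp
qed

text \<open>Entrywise the relation reads \<open>W_ij x_j = y_i W_ij\<close>. \<open>W\<close> may be
  singular, which \<open>trpow_swap\<close> relies on.\<close>

lemma diag_intertwine:
  assumes "W \<in> carrier_mat d d" "W * rdiag d x = rdiag d y * W" "i < d" "j < d"
    and "W $$ (i, j) \<noteq> 0"
  shows "x j = y i"
proof -
  have "(W * rdiag d x) $$ (i, j) = (rdiag d y * W) $$ (i, j)" using assms by simp
  then have "W $$ (i, j) * of_real (x j) = of_real (y i) * W $$ (i, j)"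
    unfolding mat_diag_mult_left[OF assms(1)] mat_diag_mult_right[OF assms(1)]
    using assms(3,4) by simp
  then show ?thesis using assms(5) by (simp add: mult.commute)
qed

lemma diag_intertwine_fun:
  assumes "W \<in> carrier_mat d d" "W * rdiag d x = rdiag d y * W"
  shows "W * rdiag d (\<lambda>i. f (x i)) = rdiag d (\<lambda>i. f (y i)) * W"
proof (rule eq_matI)
  fix i j assume *: "i < dim_row (rdiag d (\<lambda>i. f (y i)) * W)" "j < dim_col (rdiag d (\<lambda>i. f (y i)) * W)"
  have "W $$ (i, j) = 0 \<or> x j = y i" using diag_intertwine[OF assms] * assms by auto
  then show "(W * rdiag d (\<lambda>i. f (x i))) $$ (i, j) = (rdiag d (\<lambda>i. f (y i)) * W) $$ (i, j)"
    unfolding mat_diag_mult_left[OF assms(1)] mat_diag_mult_right[OF assms(1)]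
    using * assms(1) by auto
qed (use assms(1) in auto)

text \<open>Makes the definite description in \<open>herm_fun\<close> legitimate:
  \<open>adj V * U\<close> intertwines the two diagonal matrices, hence also their images under
  \<open>f\<close>.\<close>

lemma diagd_fun_unique:
  assumes "diagd d X U x" "diagd d X V y"
  shows "U * (rdiag d (\<lambda>i. f (x i)) * adj U) = V * (rdiag d (\<lambda>i. f (y i)) * adj V)"
proof -
  note [simp] = diagd_simps[OF assms(1)] diagd_simps[OF assms(2)]
  let ?W = "adj V * U"
  have "?W * rdiag d x = adj V * (X * U)"
    by (simp only: diagd_conj(2)[OF assms(1)]) (simp add: mult_assoc_dim)
  also have "\<dots> = rdiag d y * ?W"
    by (subst diagdD(4)[OF assms(2)])
       (simp add: mult_assoc_dim unitary_cancel[of V d])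
  finally have "?W * rdiag d x = rdiag d y * ?W" .
  then have "?W * rdiag d (\<lambda>i. f (x i)) = rdiag d (\<lambda>i. f (y i)) * ?W"
    by (rule diag_intertwine_fun[rotated]) (intro carrier_matI, simp_all)
  then have "V * ((?W * rdiag d (\<lambda>i. f (x i))) * adj U) = V * ((rdiag d (\<lambda>i. f (y i)) * ?W) * adj U)"
    by simp
  then show ?thesis
    by (simp add: mult_assoc_dim unitary_cancel[of V d] right_mult_one_mat[of _ d d])
qed

lemma herm_fun_eq:
  assumes "diagd d X U x"
  shows "herm_fun f X = U * (rdiag d (\<lambda>i. f (x i)) * adj U)"
proof -
  note [simp] = diagd_simps[OF assms]
  have eq: "(U \<in> carrier_mat d d \<and> adj U * U = 1\<^sub>m d \<and> X = U * rdiag d x * adj U \<and>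
     Y = U * rdiag d (\<lambda>i. f (x i)) * adj U) \<longleftrightarrow>
     diagd d X U x \<and> Y = U * (rdiag d (\<lambda>i. f (x i)) * adj U)" for U x Y
    by (auto simp: diagd_def mult_assoc_dim)
  show ?thesis
    unfolding herm_fun_def Let_def
    by (simp only: eq diagdD(8)[OF assms]) (use diagd_fun_unique assms in blast)
qed

lemma diagd_herm_fun: "diagd d X U x \<Longrightarrow> diagd d (herm_fun f X) U (\<lambda>i. f (x i))"
  using herm_fun_eq[of d X U x f] by (auto simp: diagd_def mult_assoc_dim)

lemma diagd_trace:
  assumes "diagd d X U x" shows "mat_trace X = of_real (\<Sum>i<d. x i)"
proof -
  note [simp] = diagd_simps[OF assms]
  have "mat_trace X = mat_trace (rdiag d x * adj U * U)"
    by (subst diagdD(4)[OF assms], rule mat_trace_mult_comm) auto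
  also have "rdiag d x * adj U * U = rdiag d x"
    by (simp add: mult_assoc_dim right_mult_one_mat[of _ d d])
  finally show ?thesis by (simp add: mat_trace_def index_rdiag)
qed

section \<open>Positive semidefinite matrices and the spectral theorem\<close>

lemma mult_mat_vec_cscalar:
  assumes "X \<in> carrier_mat d d" "v \<in> carrier_vec d"
  shows "(X *\<^sub>v v) \<bullet>c v = (\<Sum>i<d. \<Sum>j<d. X $$ (i, j) * v $ j * cnj (v $ i))"
  using assms
  by (auto simp: scalar_prod_def lessThan_atLeast0 sum_distrib_right intro!: sum.cong)

lemma psd_iff_sum:
  "psd d X \<longleftrightarrow> X \<in> carrier_mat d d \<and>
     (\<forall>w. 0 \<le> (\<Sum>i<d. \<Sum>j<d. X $$ (i, j) * w j * cnj (w i)))"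
proof -
  let ?q = "\<lambda>w. \<Sum>i<d. \<Sum>j<d. X $$ (i, j) * w j * cnj (w i)"
  have "(\<forall>v\<in>carrier_vec d. 0 \<le> (\<Sum>i<d. \<Sum>j<d. X $$ (i, j) * v $ j * cnj (v $ i))) \<longleftrightarrow>
    (\<forall>w. 0 \<le> ?q w)"
  proof safe
    fix w assume *: "\<forall>v\<in>carrier_vec d. 0 \<le> (\<Sum>i<d. \<Sum>j<d. X $$ (i, j) * v $ j * cnj (v $ i))"
    have "(\<Sum>i<d. \<Sum>j<d. X $$ (i, j) * vec d w $ j * cnj (vec d w $ i)) =
      ?q w" by simp
    with *[rule_format, of "vec d w"] show "0 \<le> ?q w"
      by simp
  qed blast
  then show ?thesis by (auto simp: psd_def mult_mat_vec_cscalar)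
qed

lemma psd_carrier: "psd d X \<Longrightarrow> X \<in> carrier_mat d d"
  by (simp add: psd_def)

lemma psd_hermitian:
  assumes "psd d X" shows "adj X = X"
proof (rule eq_matI)
  note X = psd_carrier[OF assms]
  then show "dim_row (adj X) = dim_row X" "dim_col (adj X) = dim_col X" by auto
  fix i j assume ij: "i < dim_row X" "j < dim_col X"
  with X have ij: "i < d" "j < d" by auto
  have pos: "Im (\<Sum>k<d. \<Sum>l<d. X $$ (k, l) * w l * cnj (w k)) = 0" for w
    using assms by (auto simp: psd_iff_sum less_eq_complex_def)
  have form: "(\<Sum>k<d. \<Sum>l<d. X $$ (k, l) * w l * cnj (w k)) =
      X $$ (i,i) * a * cnj a + X $$ (i,j) * b * cnj a + X $$ (j,i) * a * cnj b + X $$ (j,j) * b * cnj b"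
    if "w = (\<lambda>k. (if k = i then a else 0) + (if k = j then b else 0))" for w a b
    using ij that by (simp add: algebra_simps sum.distrib if_distrib[of cnj]
        if_distrib[of "\<lambda>x. _ * x"] if_distrib[of "\<lambda>x. x * _"] cong: if_cong)
  have h: "Im (X $$ (i,i) * a * cnj a + X $$ (i,j) * b * cnj a +
      X $$ (j,i) * a * cnj b + X $$ (j,j) * b * cnj b) = 0" for a b
    using pos[of "\<lambda>k. (if k = i then a else 0) + (if k = j then b else 0)"]
    unfolding form[OF refl] .
  \<comment> \<open>Polarization: the form is real at the basis vectors e_i and e_j, at their sum,
    and at e_i plus the imaginary unit times e_j.\<close>
  show "adj X $$ (i, j) = X $$ (i, j)"
    using h[of 1 0] h[of 0 1] h[of 1 1] h[of 1 \<i>] X ij by (auto simp: complex_eq_iff)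
qed

lemma psd_diagonal_nonneg:
  assumes "psd d X" "i < d" shows "0 \<le> X $$ (i, i)"
proof -
  have "(\<Sum>k<d. \<Sum>l<d. X $$ (k, l) * (if l = i then 1 else 0) * cnj (if k = i then 1 else 0)) = X $$ (i, i)"
  proof -
    have "(\<Sum>l<d. X $$ (k, l) * (if l = i then 1 else 0) * cnj (if k = i then 1 else 0)) =
      (if k = i then X $$ (i, i) else 0)" for k
      using assms(2) by (cases "k = i") (simp_all add: if_distrib[of "\<lambda>x. _ * x"] cong: if_cong)
    then show ?thesis using assms(2) by simp
  qed
  with assms(1)[unfolded psd_iff_sum, THEN conjunct2, rule_format, of "\<lambda>k. if k = i then 1 else 0"]
  show ?thesis by simp
qed

lemma sum_swap4:
  "(\<Sum>i\<in>A. \<Sum>j\<in>B. \<Sum>k\<in>C. \<Sum>l\<in>D. f i j k l) = (\<Sum>k\<in>C. \<Sum>l\<in>D. \<Sum>i\<in>A. \<Sum>j\<in>B. f i j k l)"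
proof -
  have 1: "(\<Sum>j\<in>B. \<Sum>k\<in>C. \<Sum>l\<in>D. g j k l) = (\<Sum>k\<in>C. \<Sum>l\<in>D. \<Sum>j\<in>B. g j k l)" for B :: "'z set" and g
    by (subst sum.swap, rule sum.cong[OF refl], rule sum.swap)
  show ?thesis by (simp only: 1[of _ B] 1[of _ A])
qed

lemma psd_conj:
  assumes "psd d X" "M \<in> carrier_mat d e"
  shows "psd e (adj M * (X * M))"
  unfolding psd_iff_sum
proof safe
  note X = psd_carrier[OF assms(1)]
  show "adj M * (X * M) \<in> carrier_mat e e" using X assms(2) by (intro carrier_matI) simp_all
  fix w :: "nat \<Rightarrow> complex"
  let ?t = "\<lambda>i j k l. cnj (M $$ (k, i)) * X $$ (k, l) * M $$ (l, j) * w j * cnj (w i)"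
  define u where "u k = (\<Sum>j<e. M $$ (k, j) * w j)" for k
  have "(\<Sum>i<e. \<Sum>j<e. (adj M * (X * M)) $$ (i, j) * w j * cnj (w i)) =
    (\<Sum>i<e. \<Sum>j<e. \<Sum>k<d. \<Sum>l<d. ?t i j k l)"
  proof (intro sum.cong refl)
    fix i j assume ij: "i \<in> {..<e}" "j \<in> {..<e}"
    have "(adj M * (X * M)) $$ (i, j) = (\<Sum>k<d. cnj (M $$ (k, i)) * (\<Sum>l<d. X $$ (k, l) * M $$ (l, j)))"
      using X assms(2) ij by (simp add: index_mult)
    then show "(adj M * (X * M)) $$ (i, j) * w j * cnj (w i) =
        (\<Sum>k<d. \<Sum>l<d. ?t i j k l)"
      by (simp only: sum_distrib_left sum_distrib_right mult.assoc)
  qed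
  also have "\<dots> = (\<Sum>k<d. \<Sum>l<d. \<Sum>i<e. \<Sum>j<e. ?t i j k l)"
    by (rule sum_swap4)
  also have "\<dots> = (\<Sum>k<d. \<Sum>l<d. X $$ (k, l) * u l * cnj (u k))"
  proof (intro sum.cong refl)
    fix k l
    have "X $$ (k, l) * u l * cnj (u k) = X $$ (k, l) * (cnj (u k) * u l)" by simp
    also have "\<dots> = X $$ (k, l) * (\<Sum>i<e. \<Sum>j<e. cnj (M $$ (k, i) * w i) * (M $$ (l, j) * w j))"
      by (simp only: u_def cnj_sum sum_product)
    also have "\<dots> = (\<Sum>i<e. \<Sum>j<e. X $$ (k, l) * (cnj (M $$ (k, i) * w i) * (M $$ (l, j) * w j)))"
      by (simp only: sum_distrib_left)
    also have "\<dots> = (\<Sum>i<e. \<Sum>j<e. ?t i j k l)"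
      by (intro sum.cong refl) (simp add: mult_ac)
    finally show "(\<Sum>i<e. \<Sum>j<e. ?t i j k l) =
      X $$ (k, l) * u l * cnj (u k)" by (rule sym)
  qed
  also have "0 \<le> \<dots>" using assms(1) unfolding psd_iff_sum by blast
  finally show "0 \<le> (\<Sum>i<e. \<Sum>j<e. (adj M * (X * M)) $$ (i, j) * w j * cnj (w i))" .
qed

lemma diagd_psd:
  assumes "diagd d X U x" "\<And>i. i < d \<Longrightarrow> 0 \<le> x i"
  shows "psd d X"
proof -
  have "psd d (rdiag d x)"
    unfolding psd_iff_sum
  proof safe
    fix w :: "nat \<Rightarrow> complex"
    have "(\<Sum>i<d. \<Sum>j<d. rdiag d x $$ (i, j) * w j * cnj (w i)) = (\<Sum>i<d. \<Sum>j<d. if j = i then x i * (w i * cnj (w i)) else 0)"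
      by (intro sum.cong) (auto simp: index_rdiag)
    also have "\<dots> = of_real (\<Sum>i<d. x i * (cmod (w i))\<^sup>2)"
      by (simp add: complex_norm_square del: of_real_power)
    finally have eq: "(\<Sum>i<d. \<Sum>j<d. rdiag d x $$ (i, j) * w j * cnj (w i)) =
      of_real (\<Sum>i<d. x i * (cmod (w i))\<^sup>2)" .
    have "0 \<le> (\<Sum>i<d. x i * (cmod (w i))\<^sup>2)" using assms(2) by (intro sum_nonneg) auto
    then show "0 \<le> (\<Sum>i<d. \<Sum>j<d. rdiag d x $$ (i, j) * w j * cnj (w i))"
      unfolding eq by (simp add: less_eq_complex_def)
  qed simp
  from psd_conj[OF this, of "adj U" d] show ?thesis
    using diagdD[OF assms(1)] by simp
qed

text \<open>\<open>gram_schmidt\<close> makes the completed basis orthogonal but not normalized, so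
  every column is divided by its norm; \<open>c\<close> is the inverse norm of
  \<open>v\<close>.\<close>

lemma unitary_first_column:
  assumes v: "v \<in> carrier_vec n" and v0: "v \<noteq> 0\<^sub>v n"
  obtains U c where "U \<in> carrier_mat n n" "adj U * U = 1\<^sub>m n"
    "\<And>i. i < n \<Longrightarrow> U $$ (i, 0) = c * v $ i"
proof -
  interpret cof_vec_space n "TYPE(complex)" .
  define b where "b = basis_completion v"
  define ws where "ws = gram_schmidt n b"
  have n: "n \<noteq> 0" using v v0 by (auto intro!: eq_vecI)
  from basis_completion[OF v v0, folded b_def]
  have dist_b: "distinct b" and indep: "\<not> lin_dep (set b)" and b: "set b \<subseteq> carrier_vec n"
    and hdb: "hd b = v" and len_b: "length b = n" by auto
  from hdb len_b n obtain vs where bv: "b = v # vs" by (cases b) auto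
  from gram_schmidt_result[OF b dist_b indep refl, folded ws_def]
  have ws: "set ws \<subseteq> carrier_vec n" "corthogonal ws" "length ws = n" by (auto simp: len_b)
  from gram_schmidt_hd[OF v, of vs, folded bv] have hdws: "hd ws = v" unfolding ws_def .
  have wsc: "ws ! i \<in> carrier_vec n" if "i < n" for i using ws that by auto
  define s where "s i j = (\<Sum>k<n. ws ! i $ k * cnj (ws ! j $ k))" for i j
  have s: "s i j = ws ! i \<bullet>c ws ! j" if "i < n" "j < n" for i j
    using wsc[OF that(1)] wsc[OF that(2)] by (simp add: s_def scalar_prod_def lessThan_atLeast0)
  define r where "r i = (\<Sum>k<n. (cmod (ws ! i $ k))\<^sup>2)" for i
  have sii: "s i i = of_real (r i)" for i
    by (simp add: s_def r_def complex_norm_square del: of_real_power)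
  have r0: "0 \<le> r i" for i by (simp add: r_def sum_nonneg)
  have sij: "(s i j = 0) = (i \<noteq> j)" if "i < n" "j < n" for i j
    using corthogonalD[OF ws(2)] that ws(3) s by simp
  have rpos: "0 < r i" if "i < n" for i using r0[of i] sij[OF that that] sii[of i] by fastforce
  define U where "U = mat n n (\<lambda>(i, j). ws ! j $ i / of_real (sqrt (r j)))"
  have "adj U * U = 1\<^sub>m n"
  proof (rule eq_matI)
    fix i j assume "i < dim_row (1\<^sub>m n :: complex mat)" "j < dim_col (1\<^sub>m n :: complex mat)"
    then have ij: "i < n" "j < n" by auto
    have "(adj U * U) $$ (i, j) = s j i / (of_real (sqrt (r i)) * of_real (sqrt (r j)))"
      using ij by (simp add: index_mult U_def s_def sum_divide_distrib mult.commute)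
    also have "\<dots> = (if i = j then 1 else 0)"
    proof (cases "i = j")
      case True
      have "of_real (sqrt (r i)) * of_real (sqrt (r i)) = (of_real (r i) :: complex)"
        using r0[of i] by (simp flip: of_real_mult)
      then show ?thesis using True rpos[OF ij(1)] by (simp add: sii)
    qed (use sij[OF ij(2,1)] in auto)
    finally show "(adj U * U) $$ (i, j) = 1\<^sub>m n $$ (i, j)" using ij by simp
  qed (simp_all add: U_def)
  moreover have "ws ! 0 = v" using hdws ws(3) n by (metis hd_conv_nth list.size(3))
  then have "U $$ (i, 0) = 1 / of_real (sqrt (r 0)) * v $ i" if "i < n" for i
    using that n by (simp add: U_def)
  moreover have "U \<in> carrier_mat n n" by (simp add: U_def)
  ultimately show ?thesis using that by blast
qed

lemma diagdI:
  assumes "U \<in> carrier_mat d d" "adj U * U = 1\<^sub>m d" "X \<in> carrier_mat d d"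
    "\<And>i j. i < d \<Longrightarrow> j < d \<Longrightarrow> X $$ (i, j) = (\<Sum>k<d. x k * U $$ (i, k) * cnj (U $$ (j, k)))"
  shows "diagd d X U x"
proof -
  have "X = U * (rdiag d x * adj U)"
    by (rule eq_matI) (use assms unitary_diag_index[OF assms(1) assms(1)] in simp_all)
  then show ?thesis using assms by (simp add: diagd_def mult_assoc_dim)
qed

lemma diagd_conj_unitary:
  assumes "diagd d X W x" "U \<in> carrier_mat d d" "adj U * U = 1\<^sub>m d"
  shows "diagd d (U * (X * adj U)) (U * W) x"
proof -
  note [simp] = diagd_simps[OF assms(1)] assms(2,3) carrier_matD[OF assms(2)]
  have "U * W \<in> carrier_mat d d" by (intro carrier_matI) simp_all
  moreover have "adj (U * W) * (U * W) = 1\<^sub>m d"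
    by (simp add: adj_mult mult_assoc_dim unitary_cancel[OF assms(2,3)])
  moreover have "U * (X * adj U) = U * W * rdiag d x * adj (U * W)"
    by (subst diagdD(4)[OF assms(1)]) (simp add: adj_mult mult_assoc_dim)
  ultimately show ?thesis by (simp add: diagd_def)
qed

text \<open>An eigenvector splits off a one-dimensional block.\<close>

lemma hermitian_diagd:
  assumes "A \<in> carrier_mat n n" "adj A = A"
  shows "\<exists>U x. diagd n A U x"
  using assms
proof (induction n arbitrary: A)
  case 0
  have "diagd 0 A (1\<^sub>m 0) (\<lambda>_. 0)" by (rule diagdI) (use 0 in auto)
  then show ?case by blast
next
  case (Suc m)
  let ?n = "Suc m"
  note A = Suc.prems(1)
  have "spectrum A \<noteq> {}" by (rule spectrum_non_empty[OF A]) simp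
  then obtain e v where v: "eigenvector A v e" by (auto simp: spectrum_def eigenvalue_def)
  then have v': "v \<in> carrier_vec ?n" "v \<noteq> 0\<^sub>v ?n" "A *\<^sub>v v = e \<cdot>\<^sub>v v"
    using A by (auto simp: eigenvector_def)
  obtain U c where U: "U \<in> carrier_mat ?n ?n" "adj U * U = 1\<^sub>m ?n"
    "\<And>i. i < ?n \<Longrightarrow> U $$ (i, 0) = c * v $ i"
    using unitary_first_column[OF v'(1,2)] by blast
  note [simp] = carrier_matD[OF A] carrier_matD[OF U(1)]
  have av: "(\<Sum>l<?n. A $$ (k, l) * v $ l) = e * v $ k" if "k < ?n" for k
    using arg_cong[OF v'(3), of "\<lambda>u. u $ k"] that v'(1)
    by (simp add: scalar_prod_def lessThan_atLeast0 del: sum.lessThan_Suc sum.op_ivl_Suc)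
  have au: "(A * U) $$ (k, 0) = e * U $$ (k, 0)" if "k < ?n" for k
  proof -
    have "(A * U) $$ (k, 0) = (\<Sum>l<?n. c * (A $$ (k, l) * v $ l))"
      using that U(3) by (simp add: index_mult mult_ac del: sum.lessThan_Suc)
    also have "\<dots> = c * (e * v $ k)" using av[OF that] by (simp only: sum_distrib_left[symmetric])
    finally show ?thesis using U(3)[OF that] by simp
  qed
  define B where "B = adj U * (A * U)"
  have B: "B \<in> carrier_mat ?n ?n" unfolding B_def by (intro carrier_matI) simp_all
  have Bh: "adj B = B" using Suc.prems(2) by (simp add: B_def adj_mult mult_assoc_dim)
  have Bsym: "B $$ (i, j) = cnj (B $$ (j, i))" if "i < ?n" "j < ?n" for i j
    using index_adj[of i B j] Bh B that by simp
  have B0: "B $$ (i, 0) = (if i = 0 then e else 0)" if "i < ?n" for i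
  proof -
    have "B $$ (i, 0) = (\<Sum>k<?n. adj U $$ (i, k) * (A * U) $$ (k, 0))"
      unfolding B_def using that by (subst index_mult) simp_all
    also have "\<dots> = e * (\<Sum>k<?n. adj U $$ (i, k) * U $$ (k, 0))"
      unfolding sum_distrib_left by (intro sum.cong refl) (simp add: au)
    also have "(\<Sum>k<?n. adj U $$ (i, k) * U $$ (k, 0)) = (adj U * U) $$ (i, 0)"
      using that by (subst index_mult) simp_all
    finally show ?thesis using that by (simp add: U(2))
  qed
  \<comment> \<open>\<open>B\<close> is Hermitian, so its trivial first column yields a trivial
    first row; the same symmetry at index 0 makes the eigenvalue real.\<close>
  have B0': "B $$ (0, i) = (if i = 0 then e else 0)" if "i < ?n" for i
    using Bsym[of 0 i] Bsym[of 0 0] B0[OF that] B0[of 0] that by (auto split: if_splits)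
  have ereal: "complex_of_real (Re e) = e" using Bsym[of 0 0] B0[of 0] by (simp add: complex_eq_iff)
  define A3 where "A3 = mat m m (\<lambda>(i, j). B $$ (Suc i, Suc j))"
  have "adj A3 = A3"
  proof (rule eq_matI)
    fix i j assume "i < dim_row A3" "j < dim_col A3"
    then show "adj A3 $$ (i, j) = A3 $$ (i, j)"
      using Bsym[of "Suc i" "Suc j"] by (simp add: A3_def)
  qed (simp_all add: A3_def)
  with Suc.IH[of A3] obtain V y where V: "diagd m A3 V y" by (auto simp: A3_def)
  note [simp] = diagd_simps[OF V]
  define W where "W = mat ?n ?n (\<lambda>(i, j). if i = 0 then if j = 0 then 1 else 0
    else if j = 0 then 0 else V $$ (i - 1, j - 1))"
  define x where "x i = (case i of 0 \<Rightarrow> Re e | Suc k \<Rightarrow> y k)" for i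
  have VV: "(\<Sum>k<m. cnj (V $$ (k, i)) * V $$ (k, j)) = (if i = j then 1 else 0)" if "i < m" "j < m" for i j
  proof -
    have "(adj V * V) $$ (i, j) = (\<Sum>k<m. cnj (V $$ (k, i)) * V $$ (k, j))"
      using that by (subst index_mult) simp_all
    then show ?thesis using that by simp
  qed
  have "diagd ?n B W x"
  proof (rule diagdI)
    show "W \<in> carrier_mat ?n ?n" by (simp add: W_def)
    show "adj W * W = 1\<^sub>m ?n"
    proof (rule eq_matI)
      fix i j assume "i < dim_row (1\<^sub>m ?n :: complex mat)" "j < dim_col (1\<^sub>m ?n :: complex mat)"
      then have ij: "i < ?n" "j < ?n" by auto
      have "(adj W * W) $$ (i, j) = (\<Sum>k<?n. cnj (W $$ (k, i)) * W $$ (k, j))"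
        using ij by (subst index_mult) (simp_all add: W_def del: sum.lessThan_Suc)
      also have "\<dots> = (if i = j then 1 else 0)"
        unfolding sum.lessThan_Suc_shift
        using ij VV[of "i - 1" "j - 1"] by (cases i; cases j) (auto simp: W_def)
      finally show "(adj W * W) $$ (i, j) = 1\<^sub>m ?n $$ (i, j)" using ij by simp
    qed (simp_all add: W_def)
    fix i j assume ij: "i < ?n" "j < ?n"
    show "B $$ (i, j) = (\<Sum>k<?n. x k * W $$ (i, k) * cnj (W $$ (j, k)))"
      unfolding sum.lessThan_Suc_shift
      using ij B0[of i] B0'[of j] ereal diagd_index[OF V, of "i - 1" "j - 1"]
      by (cases i; cases j) (auto simp: W_def x_def A3_def)
  qed (rule B)
  from diagd_conj_unitary[OF this U(1,2)] have "diagd ?n (U * (B * adj U)) (U * W) x" .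
  also have "U * (B * adj U) = A * (U * adj U)"
    unfolding B_def by (simp add: mult_assoc_dim unitary_cancel[OF U(1,2)])
  also have "\<dots> = A" unfolding unitary_right[OF U(1,2)] by (rule right_mult_one_mat[OF A])
  finally show ?case by blast
qed

lemma psd_diagd:
  assumes "psd d X"
  obtains U x where "diagd d X U x" "\<And>i. i < d \<Longrightarrow> 0 \<le> x i"
proof -
  from hermitian_diagd[OF psd_carrier[OF assms] psd_hermitian[OF assms]]
  obtain U x where U: "diagd d X U x" by blast
  have "0 \<le> x i" if "i < d" for i
  proof -
    have "psd d (rdiag d x)" using psd_conj[OF assms diagdD(1)[OF U]] unfolding diagd_conj(1)[OF U] .
    from psd_diagonal_nonneg[OF this that] show ?thesis
      using that by (simp add: index_rdiag less_eq_complex_def)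
  qed
  with U show ?thesis by (rule that)
qed

lemma diagd_one:
  assumes "U \<in> carrier_mat d d" "adj U * U = 1\<^sub>m d" shows "diagd d (1\<^sub>m d) U (\<lambda>_. 1)"
  using assms unitary_right[OF assms] by (simp add: diagd_def right_mult_one_mat[OF assms(1)])

lemma adj_one [simp]: "adj (1\<^sub>m d) = 1\<^sub>m d"
  by (rule eq_matI) auto

lemma psd_one: "psd d (1\<^sub>m d)"
  by (rule diagd_psd[OF diagd_one[of "1\<^sub>m d"]]) simp_all

lemma psd_adj_mult: "Z \<in> carrier_mat d e \<Longrightarrow> psd e (adj Z * Z)"
  using psd_conj[OF psd_one, of Z d e] by simp

lemma herm_fun_carrier: "diagd d X U x \<Longrightarrow> herm_fun f X \<in> carrier_mat d d"
  using diagdD(5)[OF diagd_herm_fun] .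

lemma herm_fun_id: "diagd d X U x \<Longrightarrow> herm_fun (\<lambda>t. t) X = X"
  using herm_fun_eq[of d X U x "\<lambda>t. t"] diagdD(4)[of d X U x] by simp

lemma herm_fun_cong:
  assumes "diagd d X U x" "\<And>i. i < d \<Longrightarrow> f (x i) = g (x i)"
  shows "herm_fun f X = herm_fun g X"
proof -
  have "rdiag d (\<lambda>i. f (x i)) = rdiag d (\<lambda>i. g (x i))"
    by (rule eq_matI) (use assms(2) in \<open>simp_all add: index_rdiag\<close>)
  then show ?thesis by (simp add: herm_fun_eq[OF assms(1)])
qed

lemma diagd_mult:
  assumes "diagd d X U x" "diagd d Y U y"
  shows "diagd d (X * Y) U (\<lambda>i. x i * y i)"
proof -
  note [simp] = diagd_simps[OF assms(1)] diagd_simps[OF assms(2)]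
  have "X * Y = U * (rdiag d x * (rdiag d y * adj U))"
    by (subst diagdD(4)[OF assms(1)], subst diagdD(4)[OF assms(2)])
      (simp add: mult_assoc_dim unitary_cancel[of U d])
  also have "\<dots> = U * ((rdiag d x * rdiag d y) * adj U)"
    by (subst mult_assoc_dim) simp_all
  finally show ?thesis by (simp add: diagd_def mult_assoc_dim)
qed

lemma herm_fun_mult:
  assumes "diagd d X U x"
  shows "herm_fun f X * herm_fun g X = herm_fun (\<lambda>t. f t * g t) X"
  unfolding herm_fun_eq[OF assms, of "\<lambda>t. f t * g t"]
  by (rule diagdD(4)[OF diagd_mult[OF diagd_herm_fun[OF assms] diagd_herm_fun[OF assms]]])

lemma herm_fun_adj: "diagd d X U x \<Longrightarrow> adj (herm_fun f X) = herm_fun f X"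
  by (rule diagd_adj[OF diagd_herm_fun])

lemma psd_sqrt:
  assumes "psd d X"
  shows "herm_fun sqrt X * herm_fun sqrt X = X" "adj (herm_fun sqrt X) = herm_fun sqrt X"
    "herm_fun sqrt X \<in> carrier_mat d d"
proof -
  obtain U x where U: "diagd d X U x" "\<And>i. i < d \<Longrightarrow> 0 \<le> x i" using psd_diagd[OF assms] by blast
  have "herm_fun (\<lambda>t. sqrt t * sqrt t) X = herm_fun (\<lambda>t. t) X"
    by (rule herm_fun_cong[OF U(1)]) (simp add: U(2))
  then show "herm_fun sqrt X * herm_fun sqrt X = X"
    by (simp add: herm_fun_mult[OF U(1)] herm_fun_id[OF U(1)])
  show "adj (herm_fun sqrt X) = herm_fun sqrt X" "herm_fun sqrt X \<in> carrier_mat d d"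
    using herm_fun_adj[OF U(1)] herm_fun_carrier[OF U(1)] by auto
qed

text \<open>\<open>conj_weight U M k i\<close> is \<open>|\<langle>u\<^sub>k, m\<^sub>i\<rangle>|\<^sup>2\<close> for the columns of \<open>U\<close> and \<open>M\<close>.\<close>

definition conj_weight :: "complex mat \<Rightarrow> complex mat \<Rightarrow> nat \<Rightarrow> nat \<Rightarrow> real" where
  "conj_weight U M k i = (cmod ((adj U * M) $$ (k, i)))\<^sup>2"

lemma conj_weight_nonneg [simp]: "0 \<le> conj_weight U M k i"
  by (simp add: conj_weight_def)

text \<open>The bridge to classical inequalities: the diagonal of \<open>adj M * (X * M)\<close>
  consists of combinations of the eigenvalues of \<open>X\<close> with nonnegative weights, whose
  totals are the squared column norms of \<open>M\<close> by \<open>conj_weight_sum\<close>.\<close>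

lemma conj_diagonal:
  assumes "diagd d X U x" "M \<in> carrier_mat d e" "i < e"
  shows "(adj M * (X * M)) $$ (i, i) = of_real (\<Sum>k<d. x k * conj_weight U M k i)"
proof -
  note [simp] = diagd_simps[OF assms(1)] carrier_matD[OF assms(2)]
  let ?A = "adj M * U"
  have "adj M * (X * M) = ?A * (rdiag d x * adj ?A)"
    by (subst diagdD(4)[OF assms(1)]) (simp add: mult_assoc_dim adj_mult)
  moreover have "?A \<in> carrier_mat e d" by (intro carrier_matI) simp_all
  ultimately have "(adj M * (X * M)) $$ (i, i) = (\<Sum>k<d. x k * ?A $$ (i, k) * cnj (?A $$ (i, k)))"
    using unitary_diag_index[of ?A e d ?A i i x] assms(3) by (simp only:)
  also have "\<dots> = (\<Sum>k<d. of_real (x k * conj_weight U M k i))"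
  proof (intro sum.cong refl)
    fix k assume "k \<in> {..<d}"
    then have "(adj U * M) $$ (k, i) = cnj (?A $$ (i, k))"
      using index_adj[of k ?A i] assms(3) by (simp add: adj_mult)
    then show "x k * ?A $$ (i, k) * cnj (?A $$ (i, k)) = of_real (x k * conj_weight U M k i)"
      by (simp add: conj_weight_def complex_norm_square mult.assoc del: of_real_power)
  qed
  finally show ?thesis by simp
qed

lemma conj_weight_sum:
  assumes "U \<in> carrier_mat d d" "adj U * U = 1\<^sub>m d" "M \<in> carrier_mat d e" "i < e"
  shows "(\<Sum>k<d. conj_weight U M k i) = Re ((adj M * M) $$ (i, i))"
  using conj_diagonal[OF diagd_one[OF assms(1,2)] assms(3,4)] left_mult_one_mat[OF assms(3)]
  by simp

lemma mat_trace_Re_sum: "X \<in> carrier_mat d d \<Longrightarrow> Re (mat_trace X) = (\<Sum>i<d. Re (X $$ (i, i)))"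
  by (simp add: mat_trace_def)

lemma mat_trace_conj_unitary:
  assumes "V \<in> carrier_mat d d" "adj V * V = 1\<^sub>m d" "X \<in> carrier_mat d d"
  shows "mat_trace (adj V * (X * V)) = mat_trace X"
proof -
  note [simp] = carrier_matD[OF assms(1)] carrier_matD[OF assms(3)]
  have "mat_trace (adj V * (X * V)) = mat_trace (X * V * adj V)"
    by (rule mat_trace_mult_comm) simp_all
  also have "X * V * adj V = X"
    by (simp add: mult_assoc_dim unitary_right[OF assms(1,2)] right_mult_one_mat[OF assms(3)])
  finally show ?thesis .
qed

section \<open>Power traces and their convexity inequalities\<close>

definition trpow :: "real \<Rightarrow> complex mat \<Rightarrow> real" where
  "trpow p X = Re (mat_trace (herm_fun (\<lambda>x. x powr p) X))"

lemma trpow_eq: "diagd d X U x \<Longrightarrow> trpow p X = (\<Sum>i<d. x i powr p)"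
  by (simp add: trpow_def diagd_trace[OF diagd_herm_fun])

lemma trpow_nonneg: "psd d X \<Longrightarrow> 0 \<le> trpow p X"
  by (metis psd_diagd trpow_eq sum_nonneg powr_ge_zero)

text \<open>Young's inequality for x and t^(p-1) is the tangent inequality at t in disguise, and it
  covers x = 0 as well.\<close>

lemma powr_tangent:
  fixes x t p :: real
  assumes "1 \<le> p" "0 \<le> x" "0 < t"
  shows "t powr p + p * t powr (p - 1) * (x - t) \<le> x powr p"
proof (cases "p = 1")
  case False
  with assms have p: "1 < p" by simp
  have "x * t powr (p - 1) \<le> x powr p / p + (t powr (p - 1)) powr (p / (p - 1)) / (p / (p - 1))"
    by (rule Youngs_inequality) (use p assms in \<open>auto simp: field_simps\<close>)
  also have "(t powr (p - 1)) powr (p / (p - 1)) = t powr p" using p by (simp add: powr_powr)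
  finally have "p * (x * t powr (p - 1)) \<le> x powr p + (p - 1) * t powr p"
    using p by (simp add: field_simps)
  moreover have "t * t powr (p - 1) = t powr p"
    using assms by (simp add: powr_mult_base)
  then have "p * t powr (p - 1) * (x - t) = p * (x * t powr (p - 1)) - p * t powr p"
    by (metis (no_types, opaque_lifting) mult.assoc mult.commute right_diff_distrib)
  ultimately show ?thesis unfolding left_diff_distrib by simp
qed (use assms in simp)

text \<open>Weights of total below 1 are allowed because the missing weight can be thought of as
  sitting at 0, where the power vanishes. Such weights arise from matrices with columns of norm at
  most 1.\<close>

lemma powr_jensen:
  fixes w x :: "'a \<Rightarrow> real"
  assumes "1 \<le> p" "\<And>i. i \<in> S \<Longrightarrow> 0 \<le> w i" "\<And>i. i \<in> S \<Longrightarrow> 0 \<le> x i" "(\<Sum>i\<in>S. w i) \<le> 1"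
  shows "(\<Sum>i\<in>S. x i * w i) powr p \<le> (\<Sum>i\<in>S. x i powr p * w i)"
proof -
  define t where "t = (\<Sum>i\<in>S. x i * w i)"
  define W where "W = (\<Sum>i\<in>S. w i)"
  have t0: "0 \<le> t" unfolding t_def using assms by (intro sum_nonneg) simp
  show ?thesis
  proof (cases "t = 0")
    case True
    then show ?thesis using assms by (auto simp: t_def[symmetric] intro!: sum_nonneg)
  next
    case False
    with t0 have t: "0 < t" by simp
    have tp: "t powr (p - 1) * t = t powr p" using t by (simp add: powr_mult_base mult.commute)
    \<comment> \<open>The tangents at t average to t^p (W + p (1 - W)); the missing weight 1 - W
      only increases this, as p is at least 1.\<close>
    have "t powr p \<le> t powr p * (W + p * (1 - W))"
    proof -
      have "0 \<le> (p - 1) * (1 - W)" using assms by (simp add: W_def)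
      then have "1 \<le> W + p * (1 - W)" by (simp add: algebra_simps)
      from mult_left_mono[OF this, of "t powr p"] show ?thesis by simp
    qed
    also have "\<dots> = t powr p * W + p * t powr (p - 1) * (t - t * W)"
      unfolding tp[symmetric] by (simp add: algebra_simps)
    also have "\<dots> = (\<Sum>i\<in>S. (t powr p + p * t powr (p - 1) * (x i - t)) * w i)"
    proof -
      have "t - t * W = (\<Sum>i\<in>S. (x i - t) * w i)"
        by (simp add: t_def W_def sum_distrib_left sum_subtractf left_diff_distrib)
      then show ?thesis
        by (simp only: W_def sum_distrib_left sum.distrib distrib_right mult.assoc)
    qed
    also have "\<dots> \<le> (\<Sum>i\<in>S. x i powr p * w i)"
      using assms t by (intro sum_mono mult_right_mono powr_tangent) auto
    finally show ?thesis by (simp add: t_def)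
  qed
qed

lemma hoelder_sum:
  fixes x y :: "'a \<Rightarrow> real"
  assumes "finite S" "1 < p" "1 < q" "1 / p + 1 / q = 1"
    "\<And>i. i \<in> S \<Longrightarrow> 0 \<le> x i" "\<And>i. i \<in> S \<Longrightarrow> 0 \<le> y i"
  shows "(\<Sum>i\<in>S. x i * y i) \<le> (\<Sum>i\<in>S. x i powr p) powr (1 / p) * (\<Sum>i\<in>S. y i powr q) powr (1 / q)"
proof -
  let ?s = "(\<Sum>i\<in>S. x i * y i)"
  define a where "a = (\<Sum>i\<in>S. x i powr p)"
  define b where "b = (\<Sum>i\<in>S. y i powr q)"
  have ab: "0 \<le> a" "0 \<le> b" by (simp_all add: a_def b_def sum_nonneg)
  show ?thesis
  proof (cases "a = 0 \<or> b = 0")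
    case True
    then have "x i * y i = 0" if "i \<in> S" for i
      using that assms(1) by (auto simp: a_def b_def sum_nonneg_eq_0_iff)
    then have "?s = 0" by (rule sum.neutral[rule_format])
    then show ?thesis by simp
  next
    case False
    with ab have ab: "0 < a" "0 < b" by auto
    define A where "A = a powr (1 / p)"
    define B where "B = b powr (1 / q)"
    have AB: "0 < A" "0 < B" using ab by (simp_all add: A_def B_def)
    have Ap: "A powr p = a" "B powr q = b" using ab assms by (simp_all add: A_def B_def powr_powr)
    have "(\<Sum>i\<in>S. (x i / A) * (y i / B)) \<le> (\<Sum>i\<in>S. (x i / A) powr p / p + (y i / B) powr q / q)"
      using assms AB by (intro sum_mono Youngs_inequality) auto
    also have "\<dots> = (\<Sum>i\<in>S. x i powr p / a / p + y i powr q / b / q)"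
      using assms AB by (intro sum.cong refl) (simp add: powr_divide Ap)
    also have "\<dots> = a / a / p + b / b / q"
      by (simp only: sum.distrib sum_divide_distrib[symmetric] a_def[symmetric] b_def[symmetric])
    also have "\<dots> = 1" using ab assms by simp
    finally have "?s / (A * B) \<le> 1"
      by (simp add: sum_divide_distrib)
    then have "?s \<le> A * B"
      using mult_pos_pos[OF AB] by (simp only: divide_le_eq_1_pos)
    then show ?thesis by (simp only: A_def B_def a_def b_def)
  qed
qed

text \<open>Jensen entry by entry, through \<open>conj_diagonal\<close>. If the columns of
  \<open>M\<close> are chosen such that \<open>adj M * (X * M)\<close> is diagonal, the left side is
  the trace of its p-th power.\<close>

lemma jensen_trace:
  assumes X: "psd d X" and M: "M \<in> carrier_mat d e" and p: "1 \<le> p"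
    and le: "\<And>i. i < e \<Longrightarrow> Re ((adj M * M) $$ (i, i)) \<le> 1"
  shows "(\<Sum>i<e. Re ((adj M * (X * M)) $$ (i, i)) powr p) \<le>
    Re (mat_trace (adj M * (herm_fun (\<lambda>x. x powr p) X * M)))"
proof -
  let ?H = "(herm_fun (\<lambda>x. x powr p) X * M)"
  obtain U x where U: "diagd d X U x" "\<And>i. i < d \<Longrightarrow> 0 \<le> x i" using psd_diagd[OF X] by blast
  note [simp] = carrier_matD[OF M] diagd_simps[OF U(1)]
  have "(\<Sum>i<e. Re ((adj M * (X * M)) $$ (i, i)) powr p) = (\<Sum>i<e. (\<Sum>k<d. x k * conj_weight U M k i) powr p)"
    by (intro sum.cong refl) (subst conj_diagonal[OF U(1) M], simp_all)
  also have "\<dots> \<le> (\<Sum>i<e. \<Sum>k<d. x k powr p * conj_weight U M k i)"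
    using le U(2) conj_weight_sum[OF diagdD(1,2)[OF U(1)] M] p
    by (intro sum_mono powr_jensen) auto
  also have "\<dots> = (\<Sum>i<e. Re ((adj M * ?H) $$ (i, i)))"
    by (intro sum.cong refl) (subst conj_diagonal[OF diagd_herm_fun[OF U(1)] M], simp_all)
  also have "\<dots> = Re (mat_trace (adj M * ?H))"
    by (rule mat_trace_Re_sum[symmetric], intro carrier_matI) simp_all
  finally show ?thesis .
qed

text \<open>The case of a unitary \<open>M\<close>: all column norms are 1 and the conjugation
  disappears from the trace.\<close>

lemma peierls:
  assumes X: "psd d X" and V: "V \<in> carrier_mat d d" "adj V * V = 1\<^sub>m d" and p: "1 \<le> p"
  shows "(\<Sum>i<d. Re ((adj V * (X * V)) $$ (i, i)) powr p) \<le> trpow p X"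
proof -
  obtain U x where U: "diagd d X U x" using psd_diagd[OF X] by blast
  have "(\<Sum>i<d. Re ((adj V * (X * V)) $$ (i, i)) powr p) \<le>
    Re (mat_trace (adj V * (herm_fun (\<lambda>x. x powr p) X * V)))"
    by (rule jensen_trace[OF X V(1) p]) (simp add: V(2))
  also have "\<dots> = trpow p X"
    unfolding trpow_def mat_trace_conj_unitary[OF V herm_fun_carrier[OF U]] ..
  finally show ?thesis .
qed

text \<open>In eigenbases of \<open>Z\<^sup>* Z\<close> and \<open>Z Z\<^sup>*\<close> the matrix \<open>W\<close> of \<open>Z\<close> satisfies
  \<open>W\<^sup>* W = diag x\<close>, \<open>W W\<^sup>* = diag y\<close>, hence \<open>W diag x = diag y W\<close>.\<close>

lemma trpow_swap:
  assumes Z: "Z \<in> carrier_mat d d"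
  shows "trpow p (adj Z * Z) = trpow p (Z * adj Z)"
proof -
  have "psd d (adj Z * Z)" "psd d (Z * adj Z)"
    using psd_adj_mult[OF Z] psd_adj_mult[OF adj_carrier[OF Z]] by simp_all
  then obtain U x V y where U: "diagd d (adj Z * Z) U x" and V: "diagd d (Z * adj Z) V y"
    by (metis psd_diagd)
  note [simp] = carrier_matD[OF Z] diagdD(6,7)[OF U] diagdD(6,7)[OF V]
  define W where "W = adj V * (Z * U)"
  have W: "W \<in> carrier_mat d d" unfolding W_def by (intro carrier_matI) simp_all
  note [simp] = carrier_matD[OF W]
  have 1: "adj W * W = rdiag d x"
    using diagd_conj(1)[OF U]
    by (simp add: W_def adj_mult mult_assoc_dim unitary_cancel[OF diagdD(1,2)[OF V]])
  have 2: "W * adj W = rdiag d y"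
    using diagd_conj(1)[OF V]
    by (simp add: W_def adj_mult mult_assoc_dim unitary_cancel[OF diagdD(1,2)[OF U]])
  have "W * rdiag d x = rdiag d y * W"
    unfolding 1[symmetric] 2[symmetric] by (simp add: mult_assoc_dim)
  note eq = diag_intertwine[OF W this]
  have x: "x j = (\<Sum>i<d. (cmod (W $$ (i, j)))\<^sup>2)" if "j < d" for j
  proof -
    have "(adj W * W) $$ (j, j) = (\<Sum>i<d. cnj (W $$ (i, j)) * W $$ (i, j))"
      using that by (subst index_mult) simp_all
    also have "\<dots> = of_real (\<Sum>i<d. (cmod (W $$ (i, j)))\<^sup>2)"
      by (simp add: complex_norm_square mult.commute del: of_real_power)
    finally show ?thesis using that unfolding 1 by (simp add: index_rdiag del: of_real_sum)
  qed
  have y: "y i = (\<Sum>j<d. (cmod (W $$ (i, j)))\<^sup>2)" if "i < d" for i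
  proof -
    have "(W * adj W) $$ (i, i) = (\<Sum>j<d. W $$ (i, j) * cnj (W $$ (i, j)))"
      using that by (subst index_mult) simp_all
    also have "\<dots> = of_real (\<Sum>j<d. (cmod (W $$ (i, j)))\<^sup>2)"
      by (simp add: complex_norm_square del: of_real_power)
    finally show ?thesis using that unfolding 2 by (simp add: index_rdiag del: of_real_sum)
  qed
  \<comment> \<open>With t^p = t g(t), the factor t can be expanded into a row or column sum of the
    squared moduli of W; g(x_j) may be exchanged for g(y_i) wherever the entry of W is nonzero. At t
    = 0 both sides vanish.\<close>
  define g where "g t = (if t = 0 then 0 else t powr p / t)" for t :: real
  have g: "t powr p = t * g t" for t by (simp add: g_def)
  have "trpow p (adj Z * Z) = (\<Sum>j<d. x j * g (x j))"
    by (simp add: trpow_eq[OF U] g)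
  also have "\<dots> = (\<Sum>j<d. \<Sum>i<d. (cmod (W $$ (i, j)))\<^sup>2 * g (x j))"
    by (intro sum.cong refl) (simp add: sum_distrib_right[symmetric] x[symmetric])
  also have "\<dots> = (\<Sum>j<d. \<Sum>i<d. (cmod (W $$ (i, j)))\<^sup>2 * g (y i))"
  proof (intro sum.cong refl)
    fix j i assume "j \<in> {..<d}" "i \<in> {..<d}"
    then show "(cmod (W $$ (i, j)))\<^sup>2 * g (x j) = (cmod (W $$ (i, j)))\<^sup>2 * g (y i)"
      using eq[of i j] by (cases "W $$ (i, j) = 0") simp_all
  qed
  also have "\<dots> = (\<Sum>i<d. \<Sum>j<d. (cmod (W $$ (i, j)))\<^sup>2 * g (y i))"
    by (rule sum.swap)
  also have "\<dots> = (\<Sum>i<d. y i * g (y i))"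
    by (intro sum.cong refl) (simp add: sum_distrib_right[symmetric] y[symmetric])
  also have "\<dots> = trpow p (Z * adj Z)"
    by (simp add: trpow_eq[OF V] g)
  finally show ?thesis .
qed

section \<open>Divergences of states\<close>

text \<open>The trace inside the logarithm of \<open>sandwiched\<close>, the quantity that
  multiplies under tensor products.\<close>

definition sandw :: "real \<Rightarrow> complex mat \<Rightarrow> complex mat \<Rightarrow> real" where
  "sandw \<alpha> \<rho> \<sigma> = (let S = herm_fun (\<lambda>x. x powr ((1 - \<alpha>) / (2 * \<alpha>))) \<sigma> in trpow \<alpha> (S * \<rho> * S))"

lemma sandwiched_eq:
  "sandwiched \<alpha> \<rho> \<sigma> = (if supp \<rho> \<subseteq> supp \<sigma> then ereal (1 / (\<alpha> - 1) * log 2 (sandw \<alpha> \<rho> \<sigma>)) else \<infinity>)"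
  by (simp add: sandwiched_def sandw_def trpow_def Let_def)

lemma sandwich_psd:
  assumes "psd d \<rho>" "diagd d \<sigma> F q"
  shows "psd d (herm_fun f \<sigma> * \<rho> * herm_fun f \<sigma>)"
  using psd_conj[OF assms(1) herm_fun_carrier[OF assms(2)], of f]
    carrier_matD[OF herm_fun_carrier[OF assms(2)], of f] carrier_matD[OF psd_carrier[OF assms(1)]]
  by (simp add: herm_fun_adj[OF assms(2)] mult_assoc_dim)

text \<open>Take Z = S \<rho>^(1/2) in \<open>trpow_swap\<close>. On the right \<sigma> occurs only
  once, as a single negative power, so the operator depends linearly on that power and can be split
  along the spectrum of \<sigma>.\<close>

lemma sandw_swap:
  assumes \<rho>: "psd d \<rho>" and \<sigma>: "diagd d \<sigma> F q" and \<alpha>: "1 < \<alpha>"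
  shows "sandw \<alpha> \<rho> \<sigma> =
    trpow \<alpha> (herm_fun sqrt \<rho> * (herm_fun (\<lambda>x. x powr (- (\<alpha> - 1) / \<alpha>)) \<sigma> * herm_fun sqrt \<rho>))"
proof -
  define H where "H = herm_fun sqrt \<rho>"
  define S where "S = herm_fun (\<lambda>x. x powr ((1 - \<alpha>) / (2 * \<alpha>))) \<sigma>"
  note H = psd_sqrt[OF \<rho>, folded H_def]
  have S: "S \<in> carrier_mat d d" "adj S = S"
    using herm_fun_carrier[OF \<sigma>] herm_fun_adj[OF \<sigma>] by (simp_all add: S_def)
  note [simp] = carrier_matD[OF H(3)] carrier_matD[OF S(1)] H(2) S(2)
  have SH: "S * H \<in> carrier_mat d d" by (intro carrier_matI) simp_all
  have "S * \<rho> * S = (S * H) * adj (S * H)"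
    by (subst H(1)[symmetric]) (simp add: adj_mult mult_assoc_dim)
  then have "sandw \<alpha> \<rho> \<sigma> = trpow \<alpha> (adj (S * H) * (S * H))"
    by (simp add: sandw_def Let_def S_def[symmetric] trpow_swap[OF SH])
  also have "adj (S * H) * (S * H) = H * (S * S * H)"
    by (simp add: adj_mult mult_assoc_dim)
  also have "S * S = herm_fun (\<lambda>x. x powr (- (\<alpha> - 1) / \<alpha>)) \<sigma>"
    using \<alpha> unfolding S_def herm_fun_mult[OF \<sigma>] by (simp flip: powr_add)
  finally show ?thesis by (simp add: H_def)
qed

text \<open>The range of \<rho> lies in \<open>supp \<rho>\<close>. If w is in the kernel of
  \<sigma>, then \<rho>(\<rho> w) lies in \<open>supp \<sigma>\<close> and is orthogonal to w;
  moving one \<rho> to the other side, this says that \<rho> w has norm 0.\<close>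

lemma supp_subset_kernel:
  assumes \<rho>: "psd d \<rho>" and \<sigma>: "diagd d \<sigma> F q" and supp: "supp \<rho> \<subseteq> supp \<sigma>"
    and j: "j < d" "q j = 0" and i: "i < d"
  shows "(\<rho> * F) $$ (i, j) = 0"
proof -
  note [simp] = carrier_matD[OF psd_carrier[OF \<rho>]] diagdD(6,7,8,9)[OF \<sigma>]
  define w where "w = col F j"
  have w: "w \<in> carrier_vec d" by (simp add: w_def carrier_vecI)
  have "(\<sigma> * F) $$ (k, j) = 0" if "k < d" for k
    using that j mat_diag_mult_right[OF diagdD(1)[OF \<sigma>]]
    by (simp add: diagd_conj(2)[OF \<sigma>])
  then have "\<sigma> *\<^sub>v w = 0\<^sub>v d"
    using j by (intro eq_vecI) (simp_all add: w_def flip: index_mult_mat(1))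
  then have w_ker: "w \<in> mat_kernel \<sigma>"
    using w diagdD(5)[OF \<sigma>] by (simp add: mat_kernel_def)
  have herm: "(\<Sum>k<d. (\<rho> *\<^sub>v x) $ k * cnj (y $ k)) = (\<Sum>k<d. x $ k * cnj ((\<rho> *\<^sub>v y) $ k))"
    if "x \<in> carrier_vec d" "y \<in> carrier_vec d" for x y
  proof -
    have \<rho>s: "\<rho> $$ (k, l) = cnj (\<rho> $$ (l, k))" if "k < d" "l < d" for k l
      using that index_adj[of k \<rho> l] psd_hermitian[OF \<rho>] by simp
    have ind: "(\<rho> *\<^sub>v z) $ k = (\<Sum>l<d. \<rho> $$ (k, l) * z $ l)" if "z \<in> carrier_vec d" "k < d" for z k
      using that by (simp add: scalar_prod_def lessThan_atLeast0)
    have "(\<Sum>k<d. (\<rho> *\<^sub>v x) $ k * cnj (y $ k)) = (\<Sum>k<d. \<Sum>l<d. \<rho> $$ (k, l) * x $ l * cnj (y $ k))"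
      by (intro sum.cong refl) (simp add: ind[OF that(1)] sum_distrib_right del: index_mult_mat_vec)
    also have "\<dots> = (\<Sum>l<d. \<Sum>k<d. \<rho> $$ (k, l) * x $ l * cnj (y $ k))" by (rule sum.swap)
    also have "\<dots> = (\<Sum>l<d. \<Sum>k<d. x $ l * cnj (\<rho> $$ (l, k) * y $ k))"
      by (intro sum.cong refl) (subst \<rho>s, simp_all)
    also have "\<dots> = (\<Sum>l<d. x $ l * cnj ((\<rho> *\<^sub>v y) $ l))"
      by (intro sum.cong refl) (simp add: ind[OF that(2)] sum_distrib_left del: index_mult_mat_vec)
    finally show ?thesis .
  qed
  have cs: "x \<bullet>c y = (\<Sum>k<d. x $ k * cnj (y $ k))" if "y \<in> carrier_vec d" for x y
    using that by (simp add: scalar_prod_def lessThan_atLeast0)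
  have \<rho>w: "\<rho> *\<^sub>v w \<in> carrier_vec d" by (simp add: carrier_vecI)
  have "\<rho> *\<^sub>v w \<in> supp \<rho>"
  proof -
    have "(\<rho> *\<^sub>v w) \<bullet>c z = 0" if "z \<in> mat_kernel \<rho>" for z
    proof -
      have z: "z \<in> carrier_vec d" "\<rho> *\<^sub>v z = 0\<^sub>v d"
        using that by (auto simp: mat_kernel_def)
      show ?thesis unfolding cs[OF z(1)] herm[OF w z(1)] z(2) by simp
    qed
    then show ?thesis by (simp add: supp_def \<rho>w)
  qed
  with supp w_ker have "(\<rho> *\<^sub>v w) \<bullet>c w = 0" by (auto simp: supp_def)
  have "\<rho> *\<^sub>v (\<rho> *\<^sub>v w) \<in> supp \<rho>"
  proof -
    have "(\<rho> *\<^sub>v (\<rho> *\<^sub>v w)) \<bullet>c z = 0" if "z \<in> mat_kernel \<rho>" for z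
    proof -
      have z: "z \<in> carrier_vec d" "\<rho> *\<^sub>v z = 0\<^sub>v d"
        using that by (auto simp: mat_kernel_def)
      show ?thesis unfolding cs[OF z(1)] herm[OF \<rho>w z(1)] z(2) by simp
    qed
    moreover have "\<rho> *\<^sub>v (\<rho> *\<^sub>v w) \<in> carrier_vec d" by (rule carrier_vecI) simp
    ultimately show ?thesis by (simp add: supp_def)
  qed
  with supp w_ker have "(\<rho> *\<^sub>v (\<rho> *\<^sub>v w)) \<bullet>c w = 0" by (auto simp: supp_def)
  then have "(\<Sum>k<d. (\<rho> *\<^sub>v w) $ k * cnj ((\<rho> *\<^sub>v w) $ k)) = 0"
    unfolding cs[OF w] herm[OF \<rho>w w] .
  then have "of_real (\<Sum>k<d. (cmod ((\<rho> *\<^sub>v w) $ k))\<^sup>2) = (0 :: complex)"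
    by (simp add: complex_norm_square del: of_real_power index_mult_mat_vec)
  then have "(\<Sum>k<d. (cmod ((\<rho> *\<^sub>v w) $ k))\<^sup>2) = 0" by (simp only: of_real_eq_0_iff)
  then have "(\<rho> *\<^sub>v w) $ i = 0" using i by (simp add: sum_nonneg_eq_0_iff del: index_mult_mat_vec)
  then show ?thesis using i j by (simp add: w_def index_mult_mat(1))
qed

text \<open>Lets positive and negative powers of \<sigma> cancel next to \<rho>, although their
  product is only the support projection.\<close>

lemma supp_subset_proj:
  assumes \<rho>: "psd d \<rho>" and \<sigma>: "diagd d \<sigma> F q" and supp: "supp \<rho> \<subseteq> supp \<sigma>"
  shows "\<rho> * herm_fun (\<lambda>x. if x = 0 then 0 else 1) \<sigma> = \<rho>"
    "herm_fun (\<lambda>x. if x = 0 then 0 else 1) \<sigma> * \<rho> = \<rho>"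
proof -
  let ?D = "rdiag d (\<lambda>i. if q i = 0 then 0 else 1)"
  let ?P = "herm_fun (\<lambda>x. if x = 0 then 0 else 1) \<sigma>"
  note c = psd_carrier[OF \<rho>] diagdD(1)[OF \<sigma>]
  note [simp] = carrier_matD[OF c(1)] carrier_matD[OF c(2)]
  have pc: "\<rho> * F \<in> carrier_mat d d" by (intro carrier_matI) simp_all
  have "\<rho> * F * ?D = \<rho> * F"
    unfolding mat_diag_mult_right[OF pc]
    by (rule eq_matI) (use supp_subset_kernel[OF assms] in \<open>auto\<close>)
  then have "\<rho> * F * ?D * adj F = \<rho> * F * adj F" by simp
  also have "\<dots> = \<rho>" by (simp add: mult_assoc_dim diagdD(3)[OF \<sigma>] right_mult_one_mat[OF c(1)])
  finally show 1: "\<rho> * ?P = \<rho>"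
    unfolding herm_fun_eq[OF \<sigma>] by (simp add: mult_assoc_dim)
  have [simp]: "dim_row ?P = d" "dim_col ?P = d"
    using herm_fun_carrier[OF \<sigma>] by auto
  have "adj (\<rho> * ?P) = ?P * \<rho>"
    by (simp add: adj_mult herm_fun_adj[OF \<sigma>] psd_hermitian[OF \<rho>])
  then show "?P * \<rho> = \<rho>" using 1 psd_hermitian[OF \<rho>] by simp
qed

text \<open>Hoelder's inequality takes the place of data processing. With X = S \<rho> S and R
  inverse to S on the support, Tr(T \<rho>) = Tr(X R T R) is at most the \<alpha>-norm of X times
  the p-norm of R T R. The latter equals that of T^(1/2) R^2 T^(1/2), whose p-th power has trace at
  most Tr(T \<sigma>) by \<open>jensen_trace\<close>.\<close>

lemma sandw_test_bound:
  assumes \<rho>: "psd d \<rho>" and \<sigma>: "psd d \<sigma>" and supp: "supp \<rho> \<subseteq> supp \<sigma>"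
    and T: "psd d T" "psd d (1\<^sub>m d - T)" and \<alpha>: "1 < \<alpha>"
  shows "Re (mat_trace (T * \<rho>)) powr \<alpha> \<le> sandw \<alpha> \<rho> \<sigma> * Re (mat_trace (T * \<sigma>)) powr (\<alpha> - 1)"
proof -
  let ?b = "Re (mat_trace (T * \<sigma>))"
  let ?s = "Re (mat_trace (T * \<rho>))"
  obtain F q where F: "diagd d \<sigma> F q" and q: "\<And>i. i < d \<Longrightarrow> 0 \<le> q i" using psd_diagd[OF \<sigma>] by blast
  \<comment> \<open>\<sigma>^(-c) is the outer factor in \<open>sandw\<close>, p is the exponent
    conjugate to \<alpha>, and 2 c p = 1 makes the p-th power of \<open>R * R\<close> equal to
    \<sigma>.\<close>
  define c where "c = (\<alpha> - 1) / (2 * \<alpha>)"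
  define p where "p = \<alpha> / (\<alpha> - 1)"
  have p: "1 < p" "1 / \<alpha> + 1 / p = 1" "2 * c * p = 1"
    using \<alpha> by (simp_all add: p_def c_def field_simps)
  define S where "S = herm_fun (\<lambda>x. x powr (- c)) \<sigma>"
  define R where "R = herm_fun (\<lambda>x. x powr c) \<sigma>"
  define X where "X = S * \<rho> * S"
  define H where "H = herm_fun sqrt T"
  note H = psd_sqrt[OF T(1), folded H_def]
  have SR: "S \<in> carrier_mat d d" "R \<in> carrier_mat d d" "adj S = S" "adj R = R"
    using herm_fun_carrier[OF F] herm_fun_adj[OF F] by (simp_all add: S_def R_def)
  note [simp] = carrier_matD[OF H(3)] carrier_matD[OF SR(1)] carrier_matD[OF SR(2)]
    carrier_matD[OF psd_carrier[OF \<rho>]] carrier_matD[OF psd_carrier[OF \<sigma>]]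
    carrier_matD[OF psd_carrier[OF T(1)]] H(2) SR(3,4)
  have RS: "R * S = herm_fun (\<lambda>x. if x = 0 then 0 else 1) \<sigma>" "S * R = herm_fun (\<lambda>x. if x = 0 then 0 else 1) \<sigma>"
    unfolding S_def R_def herm_fun_mult[OF F]
    by (rule herm_fun_cong[OF F], use q in \<open>simp flip: powr_add\<close>)+
  have "R * X * R = (R * S) * \<rho> * (S * R)"
    by (simp add: X_def mult_assoc_dim)
  also have "\<dots> = \<rho>"
    unfolding RS supp_subset_proj[OF \<rho> F supp] ..
  finally have RXR: "R * X * R = \<rho>" .
  have X: "psd d X" unfolding X_def S_def by (rule sandwich_psd[OF \<rho> F])
  obtain V x where V: "diagd d X V x" and x: "\<And>i. i < d \<Longrightarrow> 0 \<le> x i" using psd_diagd[OF X] by blast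
  note [simp] = diagdD(6,7,8,9)[OF V]
  define Z where "Z = H * R"
  have Z: "Z \<in> carrier_mat d d" unfolding Z_def by (intro carrier_matI) simp_all
  note [simp] = carrier_matD[OF Z]
  have ZZ: "adj Z * Z = R * (T * R)"
    unfolding Z_def by (subst H(1)[symmetric]) (simp add: adj_mult mult_assoc_dim)
  \<comment> \<open>Diagonals are taken in the eigenbasis of \<open>X\<close>: the trace then is the
    sum of the \<open>x i * y i\<close>, and \<open>peierls\<close> controls the
    \<open>y i\<close>.\<close>
  define y where "y i = Re ((adj V * (adj Z * Z * V)) $$ (i, i))" for i
  have ZV: "psd d (adj V * (adj Z * Z * V))" by (rule psd_conj[OF psd_adj_mult[OF Z] diagdD(1)[OF V]])
  have y0: "0 \<le> y i" if "i < d" for i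
    using psd_diagonal_nonneg[OF ZV that] by (simp add: y_def less_eq_complex_def)
  have "mat_trace (T * \<rho>) = mat_trace (T * R * X * R)"
    by (subst RXR[symmetric]) (simp add: mult_assoc_dim)
  also have "\<dots> = mat_trace (R * (T * R * X))"
    by (rule mat_trace_mult_comm) simp_all
  also have "R * (T * R * X) = adj Z * Z * V * (rdiag d x * adj V)"
    unfolding ZZ by (subst diagdD(4)[OF V]) (simp add: mult_assoc_dim)
  also have "mat_trace \<dots> = mat_trace (rdiag d x * adj V * (adj Z * Z * V))"
    by (rule mat_trace_mult_comm) simp_all
  also have "rdiag d x * adj V * (adj Z * Z * V) = rdiag d x * (adj V * (adj Z * Z * V))"
    by (simp add: mult_assoc_dim)
  also have "mat_trace \<dots> = (\<Sum>i<d. x i * (adj V * (adj Z * Z * V)) $$ (i, i))"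
    unfolding mat_diag_mult_left[OF psd_carrier[OF ZV]] by (simp add: mat_trace_def)
  finally have s: "?s = (\<Sum>i<d. x i * y i)"
    by (simp add: y_def)
  have "(\<Sum>i<d. y i powr p) \<le> trpow p (adj Z * Z)"
    unfolding y_def by (rule peierls[OF psd_adj_mult[OF Z] diagdD(1,2)[OF V]]) (use p in simp)
  also have "\<dots> = trpow p (Z * adj Z)" by (rule trpow_swap[OF Z])
  also have "\<dots> \<le> ?b"
  proof -
    have "psd d (Z * adj Z)" using psd_adj_mult[OF adj_carrier[OF Z]] by simp
    then obtain W z where W: "diagd d (Z * adj Z) W z" using psd_diagd by blast
    note [simp] = diagdD(6,7)[OF W]
    have RR: "R * R = herm_fun (\<lambda>x. x powr (2 * c)) \<sigma>"
      unfolding R_def herm_fun_mult[OF F] by (simp flip: powr_add)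
    have RR': "diagd d (R * R) F (\<lambda>i. q i powr (2 * c))"
      unfolding RR by (rule diagd_herm_fun[OF F])
    have RRp: "herm_fun (\<lambda>x. x powr p) (R * R) = \<sigma>"
    proof -
      have "herm_fun (\<lambda>x. x powr p) (R * R) = F * (rdiag d (\<lambda>i. (q i powr (2 * c)) powr p) * adj F)"
        by (rule herm_fun_eq[OF RR'])
      also have "\<dots> = herm_fun (\<lambda>x. (x powr (2 * c)) powr p) \<sigma>"
        by (rule herm_fun_eq[OF F, symmetric])
      also have "\<dots> = herm_fun (\<lambda>x. x) \<sigma>"
        by (rule herm_fun_cong[OF F]) (use q p in \<open>simp add: powr_powr\<close>)
      finally show ?thesis by (simp add: herm_fun_id[OF F])
    qed
    \<comment> \<open>\<open>W\<close> diagonalizes \<open>Z * adj Z\<close>, so \<open>M\<close>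
      conjugates \<open>R * R\<close> to a diagonal matrix, as \<open>jensen_trace\<close> requires
      for a full trace; its column norms are at most 1 because T is.\<close>
    define M where "M = H * W"
    have M: "M \<in> carrier_mat d d" unfolding M_def by (intro carrier_matI) simp_all
    note [simp] = carrier_matD[OF M]
    have MM: "adj M * M = adj W * (T * W)"
      unfolding M_def by (subst H(1)[symmetric]) (simp add: adj_mult mult_assoc_dim)
    have le: "Re ((adj M * M) $$ (i, i)) \<le> 1" if "i < d" for i
    proof -
      have TW: "T * W \<in> carrier_mat d d" by (intro carrier_matI) simp_all
      have "psd d (adj W * ((1\<^sub>m d - T) * W))" by (rule psd_conj[OF T(2) diagdD(1)[OF W]])
      also have "(1\<^sub>m d - T) * W = W - T * W"
        by (subst minus_mult_distrib_mat[of _ d d _ _ d])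
          (simp_all add: psd_carrier[OF T(1)] diagdD(1)[OF W])
      also have "adj W * (W - T * W) = 1\<^sub>m d - adj W * (T * W)"
        by (subst mult_minus_distrib_mat[of _ d d _ d])
          (simp_all add: diagdD(1,2)[OF W] TW)
      finally have "psd d (1\<^sub>m d - adj W * (T * W))" .
      from psd_diagonal_nonneg[OF this that] that show ?thesis
        unfolding MM by (simp add: less_eq_complex_def)
    qed
    have MRM: "adj M * (R * R * M) = rdiag d z"
      unfolding diagd_conj(1)[OF W, symmetric] by (simp add: M_def Z_def adj_mult mult_assoc_dim)
    have "trpow p (Z * adj Z) = (\<Sum>i<d. Re ((adj M * (R * R * M)) $$ (i, i)) powr p)"
      unfolding trpow_eq[OF W] MRM by (intro sum.cong refl) (simp add: index_rdiag)
    also have "\<dots> \<le> Re (mat_trace (adj M * (herm_fun (\<lambda>x. x powr p) (R * R) * M)))"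
      by (rule jensen_trace[OF diagd_psd[OF RR'] M _ le]) (use p in simp_all)
    also have "mat_trace (adj M * (herm_fun (\<lambda>x. x powr p) (R * R) * M)) = mat_trace (adj W * (H * (\<sigma> * H) * W))"
      unfolding RRp by (simp add: M_def adj_mult mult_assoc_dim)
    also have "\<dots> = mat_trace (H * (\<sigma> * H))"
      by (rule mat_trace_conj_unitary[OF diagdD(1,2)[OF W]], intro carrier_matI) simp_all
    also have "\<dots> = mat_trace (\<sigma> * H * H)"
      by (rule mat_trace_mult_comm) simp_all
    also have "\<sigma> * H * H = \<sigma> * T" by (simp add: mult_assoc_dim H(1))
    also have "mat_trace (\<sigma> * T) = mat_trace (T * \<sigma>)"
      by (rule mat_trace_mult_comm) simp_all
    finally show ?thesis .
  qed
  finally have yb: "(\<Sum>i<d. y i powr p) \<le> ?b" .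
  have sand: "sandw \<alpha> \<rho> \<sigma> = (\<Sum>i<d. x i powr \<alpha>)"
  proof -
    have "(1 - \<alpha>) / (2 * \<alpha>) = - c" by (simp add: c_def minus_divide_left)
    then show ?thesis
      by (simp add: sandw_def S_def[symmetric] X_def[symmetric] trpow_eq[OF V])
  qed
  have s0: "0 \<le> ?s" unfolding s using x y0 by (intro sum_nonneg) simp
  have "?s \<le> (\<Sum>i<d. x i powr \<alpha>) powr (1 / \<alpha>) * (\<Sum>i<d. y i powr p) powr (1 / p)"
    unfolding s by (rule hoelder_sum) (use x y0 p \<alpha> in auto)
  also have "\<dots> \<le> (\<Sum>i<d. x i powr \<alpha>) powr (1 / \<alpha>) * ?b powr (1 / p)"
    using yb p by (intro mult_left_mono powr_mono2) (auto intro: sum_nonneg)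
  finally have "?s powr \<alpha> \<le>
      (sandw \<alpha> \<rho> \<sigma> powr (1 / \<alpha>) * ?b powr (1 / p)) powr \<alpha>"
    unfolding sand using s0 \<alpha> by (intro powr_mono2) auto
  also have "\<dots> = sandw \<alpha> \<rho> \<sigma> powr 1 * ?b powr (\<alpha> - 1)"
    using \<alpha> by (simp add: powr_mult powr_powr p_def)
  also have "sandw \<alpha> \<rho> \<sigma> powr 1 = sandw \<alpha> \<rho> \<sigma>"
    unfolding sand by (simp add: sum_nonneg)
  finally show ?thesis .
qed

text \<open>Points of weight 0 are discarded before Jensen's inequality is applied, so
  \<open>r\<close> may take default values there.\<close>

lemma log_jensen:
  fixes c r :: "'a \<Rightarrow> real"
  assumes c: "\<And>s. s \<in> S \<Longrightarrow> 0 \<le> c s" "(\<Sum>s\<in>S. c s) = 1"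
    and r: "\<And>s. s \<in> S \<Longrightarrow> 0 < c s \<Longrightarrow> 0 < r s"
  shows "0 < (\<Sum>s\<in>S. c s * r s)" "(\<Sum>s\<in>S. c s * log 2 (r s)) \<le> log 2 (\<Sum>s\<in>S. c s * r s)"
proof -
  let ?r = "(\<Sum>s\<in>S. c s * r s)"
  let ?P = "{s \<in> S. 0 < c s}"
  have fin: "finite S" using c(2) by (metis sum.infinite zero_neq_one)
  have P: "(\<Sum>s\<in>?P. c s * f s) = (\<Sum>s\<in>S. c s * f s)" for f
    by (rule sum.mono_neutral_left) (use fin c(1) in \<open>force simp: not_less order.antisym\<close>)+
  have P1: "(\<Sum>s\<in>?P. c s) = 1" using P[of "\<lambda>_. 1"] c(2) by simp
  then have ne: "?P \<noteq> {}" by (metis sum.empty zero_neq_one)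
  have "0 < (\<Sum>s\<in>?P. c s * r s)" using fin ne r by (intro sum_pos) auto
  then show "0 < ?r" by (simp only: P)
  have "(\<Sum>s\<in>?P. c s * log 2 (r s)) \<le> log 2 (\<Sum>s\<in>?P. c s *\<^sub>R r s)"
    by (rule concave_on_sum[OF _ ne log_concave[of 2] P1]) (use fin r in auto)
  then show "(\<Sum>s\<in>S. c s * log 2 (r s)) \<le> log 2 ?r" by (simp add: P)
qed

lemma conj_weight_swap:
  assumes "U \<in> carrier_mat d d" "V \<in> carrier_mat d d" "i < d" "j < d"
  shows "conj_weight U V i j = conj_weight V U j i"
proof -
  note [simp] = carrier_matD[OF assms(1)] carrier_matD[OF assms(2)]
  have "adj U * V = adj (adj V * U)" by (simp add: adj_mult)
  then have "(adj U * V) $$ (i, j) = cnj ((adj V * U) $$ (j, i))"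
    using assms(3,4) by simp
  then show ?thesis unfolding conj_weight_def by simp
qed

text \<open>Inclusion of supports becomes absolute continuity of the first classical distribution
  with respect to the second.\<close>

lemma supp_subset_weight:
  assumes \<rho>: "psd d \<rho>" and \<sigma>: "diagd d \<sigma> F q" and supp: "supp \<rho> \<subseteq> supp \<sigma>"
    and E: "diagd d \<rho> E p" and ij: "i < d" "j < d" and q: "q j = 0"
  shows "p i * conj_weight F E j i = 0"
proof -
  note [simp] = diagdD(6,7,8,9)[OF \<sigma>] diagdD(6,7,8,9)[OF E]
  have EF: "adj E * F \<in> carrier_mat d d" by (intro carrier_matI) simp_all
  have "adj E * (\<rho> * F) = rdiag d p * (adj E * F)"
    by (subst diagdD(4)[OF E]) (simp add: mult_assoc_dim unitary_cancel[OF diagdD(1,2)[OF E]])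
  then have "of_real (p i) * (adj E * F) $$ (i, j) = (adj E * (\<rho> * F)) $$ (i, j)"
    using ij unfolding mat_diag_mult_left[OF EF] by simp
  also have "\<dots> = (\<Sum>k<d. adj E $$ (i, k) * (\<rho> * F) $$ (k, j))"
    using ij by (subst index_mult) simp_all
  also have "\<dots> = 0"
    by (intro sum.neutral ballI) (simp add: supp_subset_kernel[OF \<rho> \<sigma> supp ij(2) q])
  finally have "p i * conj_weight E F i j = 0" unfolding conj_weight_def by simp
  then show ?thesis using conj_weight_swap[OF diagdD(1)[OF \<sigma>] diagdD(1)[OF E] ij(2,1)] by simp
qed

text \<open>The relative entropy is a classical one for the pair of distributions
  \<open>p\<^sub>i w\<^sub>j\<^sub>i\<close> and \<open>q\<^sub>j w\<^sub>j\<^sub>i\<close> of Nussbaum and Szkola.\<close>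

lemma rel_entropy_sum:
  assumes \<rho>: "psd d \<rho>" and \<sigma>: "diagd d \<sigma> F q" and supp: "supp \<rho> \<subseteq> supp \<sigma>" and E: "diagd d \<rho> E p"
  shows "rel_entropy \<rho> \<sigma> = ereal (\<Sum>i<d. \<Sum>j<d. p i * conj_weight F E j i * (log 2 (p i) - log 2 (q j)))"
proof -
  note [simp] = diagdD(6,7,8,9)[OF \<sigma>] diagdD(6,7,8,9)[OF E]
  define A where "A = herm_fun (log 2) \<rho>"
  define B where "B = herm_fun (log 2) \<sigma>"
  have AB: "A \<in> carrier_mat d d" "B \<in> carrier_mat d d"
    using herm_fun_carrier[OF E] herm_fun_carrier[OF \<sigma>] by (simp_all add: A_def B_def)
  note [simp] = carrier_matD[OF AB(1)] carrier_matD[OF AB(2)]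
  have "\<rho> * (A - B) = \<rho> * A - \<rho> * B"
    by (rule mult_minus_distrib_mat[OF psd_carrier[OF \<rho>] AB])
  then have "mat_trace (\<rho> * (A - B)) = mat_trace (\<rho> * A) - mat_trace (\<rho> * B)"
    by (simp add: mat_trace_diff[of _ d] carrier_matI)
  moreover have "mat_trace (\<rho> * A) = of_real (\<Sum>i<d. p i * log 2 (p i))"
  proof -
    have "\<rho> * A = herm_fun (\<lambda>t. t * log 2 t) \<rho>"
      using herm_fun_mult[OF E, of "\<lambda>t. t" "log 2"] by (simp add: A_def herm_fun_id[OF E])
    then show ?thesis by (simp only: diagd_trace[OF diagd_herm_fun[OF E]])
  qed
  moreover have "mat_trace (\<rho> * B) = of_real (\<Sum>i<d. \<Sum>j<d. p i * conj_weight F E j i * log 2 (q j))"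
  proof -
    have Bd: "diagd d B F (\<lambda>j. log 2 (q j))" unfolding B_def by (rule diagd_herm_fun[OF \<sigma>])
    have EBE: "adj E * (B * E) \<in> carrier_mat d d" by (intro carrier_matI) simp_all
    have "mat_trace (\<rho> * B) = mat_trace (B * \<rho>)"
      by (rule mat_trace_mult_comm) simp_all
    also have "\<dots> = mat_trace (adj E * (B * \<rho> * E))"
      by (rule mat_trace_conj_unitary[OF diagdD(1,2)[OF E], symmetric], intro carrier_matI) simp_all
    also have "adj E * (B * \<rho> * E) = (adj E * (B * E)) * rdiag d p"
      by (simp add: mult_assoc_dim diagd_conj(2)[OF E])
    also have "mat_trace \<dots> = (\<Sum>i<d. (adj E * (B * E)) $$ (i, i) * of_real (p i))"
      unfolding mat_diag_mult_right[OF EBE] by (simp add: mat_trace_def)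
    also have "\<dots> = (\<Sum>i<d. of_real (\<Sum>j<d. p i * conj_weight F E j i * log 2 (q j)))"
    proof (intro sum.cong refl)
      fix i assume "i \<in> {..<d}"
      then have i: "i < d" by simp
      have "(\<Sum>j<d. log 2 (q j) * conj_weight F E j i) * p i = (\<Sum>j<d. p i * conj_weight F E j i * log 2 (q j))"
        unfolding sum_distrib_right by (intro sum.cong refl) simp
      then show "(adj E * (B * E)) $$ (i, i) * of_real (p i) =
          of_real (\<Sum>j<d. p i * conj_weight F E j i * log 2 (q j))"
        unfolding conj_diagonal[OF Bd diagdD(1)[OF E] i] by (metis of_real_mult)
    qed
    finally show ?thesis by simp
  qed
  ultimately have "Re (mat_trace (\<rho> * (A - B))) = (\<Sum>i<d. p i * log 2 (p i)) -
      (\<Sum>i<d. \<Sum>j<d. p i * conj_weight F E j i * log 2 (q j))"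
    by (simp only: minus_complex.simps Re_complex_of_real)
  also have "(\<Sum>i<d. p i * log 2 (p i)) = (\<Sum>i<d. \<Sum>j<d. p i * conj_weight F E j i * log 2 (p i))"
  proof (intro sum.cong refl)
    fix i assume "i \<in> {..<d}"
    then have "(\<Sum>j<d. conj_weight F E j i) = 1"
      by (subst conj_weight_sum[OF diagdD(1,2)[OF \<sigma>] diagdD(1)[OF E]]) (simp_all add: diagdD(2)[OF E])
    then show "p i * log 2 (p i) = (\<Sum>j<d. p i * conj_weight F E j i * log 2 (p i))"
      by (simp add: sum_distrib_left[symmetric] sum_distrib_right[symmetric])
  qed
  finally show ?thesis
    using supp by (simp add: rel_entropy_def A_def B_def right_diff_distrib sum_subtractf)
qed

locale state_pair =
  fixes d \<rho> \<sigma> E p F q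
  assumes rho: "psd d \<rho>" and E: "diagd d \<rho> E p" and F: "diagd d \<sigma> F q"
    and p0: "\<And>i. i < d \<Longrightarrow> 0 \<le> p i" and q0: "\<And>i. i < d \<Longrightarrow> 0 \<le> q i"
    and tr: "mat_trace \<rho> = 1" and supp: "supp \<rho> \<subseteq> supp \<sigma>"
begin

definition c where "c = (\<lambda>(i, j). p i * conj_weight F E j i)"

lemma p_sum: "(\<Sum>i<d. p i) = 1"
  using diagd_trace[OF E] tr by (metis of_real_eq_1_iff)

lemma w_sum: "i < d \<Longrightarrow> (\<Sum>j<d. conj_weight F E j i) = 1"
  by (subst conj_weight_sum[OF diagdD(1,2)[OF F] diagdD(1)[OF E]]) (simp_all add: diagdD(2)[OF E])

lemma w_sum': "j < d \<Longrightarrow> (\<Sum>i<d. conj_weight F E j i) = 1"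
  using conj_weight_sum[OF diagdD(1,2)[OF E] diagdD(1)[OF F], of j]
  by (simp add: conj_weight_swap[OF diagdD(1)[OF F] diagdD(1)[OF E]] diagdD(2)[OF F])

lemma c_nonneg: "s \<in> {..<d} \<times> {..<d} \<Longrightarrow> 0 \<le> c s"
  using p0 by (auto simp: c_def)

lemma c_sum: "(\<Sum>s\<in>{..<d} \<times> {..<d}. c s) = 1"
proof -
  have "(\<Sum>s\<in>{..<d} \<times> {..<d}. c s) = (\<Sum>i<d. \<Sum>j<d. p i * conj_weight F E j i)"
    unfolding c_def sum.cartesian_product ..
  then show ?thesis by (simp add: sum_distrib_left[symmetric] w_sum p_sum)
qed

lemma c_pos:
  assumes "i < d" "j < d" "0 < c (i, j)" shows "0 < p i" "0 < q j"
proof -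
  from assms(3) have "0 < p i * conj_weight F E j i" by (simp only: c_def prod.case)
  then have *: "p i * conj_weight F E j i \<noteq> 0" by linarith
  then show "0 < p i" using p0[OF assms(1)] by (cases "p i = 0") auto
  show "0 < q j" using q0[OF assms(2)] supp_subset_weight[OF rho F supp E assms(1,2)] *
    by (cases "q j = 0") auto
qed

lemma rel_entropy_c:
  "rel_entropy \<rho> \<sigma> = ereal (\<Sum>s\<in>{..<d} \<times> {..<d}. c s * (log 2 (p (fst s)) - log 2 (q (snd s))))"
  unfolding rel_entropy_sum[OF rho F supp E] sum.cartesian_product c_def by (simp add: split_def)

text \<open>Jensen for the ratios q_j / p_i. Their mean is at most the trace of \<sigma> and not
  always equal to it, since indices with p_i = 0 drop out.\<close>

lemma rel_entropy_ge_0: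
  assumes "mat_trace \<sigma> = 1" shows "0 \<le> rel_entropy \<rho> \<sigma>"
proof -
  let ?S = "{..<d} \<times> {..<d}"
  define r where "r = (\<lambda>(i, j). q j / p i)"
  have r: "0 < r s" if "s \<in> ?S" "0 < c s" for s
    using c_pos[of "fst s" "snd s"] that by (auto simp: r_def)
  note J = log_jensen[where S = ?S and c = c and r = r, OF c_nonneg c_sum r]
  have "(\<Sum>s\<in>?S. c s * r s) \<le> (\<Sum>(i, j)\<in>?S. q j * conj_weight F E j i)"
  proof (rule sum_mono)
    fix s assume "s \<in> ?S"
    then obtain i j where s: "s = (i, j)" and ij: "i < d" "j < d" by auto
    show "c s * r s \<le> (case s of (i, j) \<Rightarrow> q j * conj_weight F E j i)"
      using p0[OF ij(1)] q0[OF ij(2)] by (cases "p i = 0") (simp_all add: s c_def r_def)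
  qed
  also have "\<dots> = (\<Sum>i<d. \<Sum>j<d. q j * conj_weight F E j i)"
    by (rule sum.cartesian_product[symmetric])
  also have "\<dots> = (\<Sum>j<d. \<Sum>i<d. q j * conj_weight F E j i)" by (rule sum.swap)
  also have "\<dots> = (\<Sum>j<d. q j)" by (simp add: sum_distrib_left[symmetric] w_sum')
  also have "\<dots> = 1" using diagd_trace[OF F] assms by (metis of_real_eq_1_iff)
  finally have "log 2 (\<Sum>s\<in>?S. c s * r s) \<le> 0" using J(1) by simp
  with J(2) have "(\<Sum>s\<in>?S. c s * log 2 (r s)) \<le> 0" by linarith
  also have "(\<Sum>s\<in>?S. c s * log 2 (r s)) = - (\<Sum>s\<in>?S. c s * (log 2 (p (fst s)) - log 2 (q (snd s))))"
    unfolding sum_negf[symmetric]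
  proof (intro sum.cong refl)
    fix s assume "s \<in> ?S"
    then obtain i j where s: "s = (i, j)" and ij: "i < d" "j < d" by auto
    show "c s * log 2 (r s) = - (c s * (log 2 (p (fst s)) - log 2 (q (snd s))))"
      using c_pos[OF ij] c_nonneg[of s] ij unfolding s
      by (cases "c (i, j) = 0") (auto simp: r_def log_divide algebra_simps)
  qed
  finally show ?thesis unfolding rel_entropy_c by simp
qed

text \<open>With \<open>\<gamma> = (\<alpha> - 1) / \<alpha>\<close> one passes through the Petz quantity \<open>Tr \<rho>\<^sup>1\<^sup>+\<^sup>\<gamma> \<sigma>\<^sup>-\<^sup>\<gamma>\<close>: it dominates
  the relative entropy by Jensen's inequality and is dominated by the sandwiched quantity by
  Hoelder's inequality.\<close>

lemma rel_entropy_le_sandw: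
  assumes \<alpha>: "1 < \<alpha>"
  shows "rel_entropy \<rho> \<sigma> \<le> ereal (1 / (\<alpha> - 1) * log 2 (sandw \<alpha> \<rho> \<sigma>))"
proof -
  let ?Q = "sandw \<alpha> \<rho> \<sigma>"
  let ?S = "{..<d} \<times> {..<d}"
  \<comment> \<open>Two demands fix \<gamma>: -\<gamma> is the exponent of \<sigma> in
    \<open>sandw_swap\<close>, and 1 / \<gamma> is conjugate to \<alpha>, so that the Hoelder factor
    of the \<open>p i powr \<gamma>\<close> is a power of the trace of \<rho>, that is 1.\<close>
  define \<gamma> where "\<gamma> = (\<alpha> - 1) / \<alpha>"
  have \<gamma>: "0 < \<gamma>" "\<gamma> < 1" "1 / (1 / \<gamma>) + 1 / \<alpha> = 1" "- (\<alpha> - 1) / \<alpha> = - \<gamma>"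
    using \<alpha> by (simp_all add: \<gamma>_def field_simps)
  define r where "r = (\<lambda>(i, j). p i powr \<gamma> * q j powr (- \<gamma>))"
  have r: "0 < r s" if "s \<in> ?S" "0 < c s" for s
    using c_pos[of "fst s" "snd s"] that by (auto simp: r_def)
  note J = log_jensen[where S = ?S and c = c and r = r, OF c_nonneg c_sum r]
  define D where "D = (\<Sum>s\<in>?S. c s * (log 2 (p (fst s)) - log 2 (q (snd s))))"
  have D: "(\<Sum>s\<in>?S. c s * log 2 (r s)) = \<gamma> * D"
    unfolding D_def sum_distrib_left
  proof (intro sum.cong refl)
    fix s assume "s \<in> ?S"
    then obtain i j where s: "s = (i, j)" and ij: "i < d" "j < d" by auto
    show "c s * log 2 (r s) = \<gamma> * (c s * (log 2 (p (fst s)) - log 2 (q (snd s))))"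
      using c_pos[OF ij] c_nonneg[of s] ij unfolding s
      by (cases "c (i, j) = 0") (auto simp: r_def log_mult log_powr algebra_simps)
  qed
  define H where "H = herm_fun sqrt \<rho>"
  define G where "G = herm_fun (\<lambda>x. x powr (- \<gamma>)) \<sigma>"
  have GF: "diagd d G F (\<lambda>j. q j powr (- \<gamma>))" unfolding G_def by (rule diagd_herm_fun[OF F])
  have HE: "diagd d H E (\<lambda>i. sqrt (p i))" unfolding H_def by (rule diagd_herm_fun[OF E])
  have Hadj: "adj H = H" by (rule diagd_adj[OF HE])
  note [simp] = diagdD(6,7,8,9)[OF GF] diagdD(6,7,8,9)[OF HE]
  have sand: "?Q = trpow \<alpha> (H * (G * H))"
    unfolding sandw_swap[OF rho F \<alpha>] H_def G_def \<gamma>(4) ..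
  have G: "psd d G" by (rule diagd_psd[OF GF]) simp
  have HGH: "psd d (H * (G * H))" using psd_conj[OF G diagdD(5)[OF HE]] by (simp add: Hadj)
  \<comment> \<open>The diagonal of \<rho>^(1/2) \<sigma>^(-\<gamma>) \<rho>^(1/2) in the eigenbasis
    of \<rho>; the Petz trace is the sum of the \<open>p i powr \<gamma> * y i\<close>.\<close>
  define y where "y i = p i * (\<Sum>j<d. q j powr (- \<gamma>) * conj_weight F E j i)" for i
  have y0: "0 \<le> y i" if "i < d" for i
    unfolding y_def using p0[OF that] by (intro mult_nonneg_nonneg sum_nonneg) auto
  have yE: "Re ((adj E * (H * (G * H) * E)) $$ (i, i)) = y i" if i: "i < d" for i
  proof -
    have EGE: "adj E * (G * E) \<in> carrier_mat d d" by (intro carrier_matI) simp_all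
    have EH: "adj E * (H * A) = rdiag d (\<lambda>i. sqrt (p i)) * (adj E * A)" if "dim_row A = d" for A
      using that by (subst diagdD(4)[OF HE]) (simp add: mult_assoc_dim unitary_cancel[OF diagdD(1,2)[OF HE]])
    have "adj E * (H * (G * H) * E) = adj E * (H * (G * (H * E)))"
      by (simp add: mult_assoc_dim)
    also have "\<dots> = rdiag d (\<lambda>i. sqrt (p i)) * (adj E * (G * E) * rdiag d (\<lambda>i. sqrt (p i)))"
      by (simp add: EH diagd_conj(2)[OF HE] mult_assoc_dim)
    finally have "(adj E * (H * (G * H) * E)) $$ (i, i) =
        of_real (sqrt (p i)) * ((adj E * (G * E)) $$ (i, i) * of_real (sqrt (p i)))"
      using i unfolding mat_diag_mult_right[OF EGE] by (simp add: mat_diag_mult_left[of _ d d])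
    also have "\<dots> = of_real (sqrt (p i) * ((\<Sum>j<d. q j powr (- \<gamma>) * conj_weight F E j i) * sqrt (p i)))"
      unfolding conj_diagonal[OF GF diagdD(1)[OF E] i] by simp
    also have "sqrt (p i) * ((\<Sum>j<d. q j powr (- \<gamma>) * conj_weight F E j i) * sqrt (p i)) = y i"
      using p0[OF i] by (simp add: y_def)
    finally show ?thesis by simp
  qed
  have "(\<Sum>s\<in>?S. c s * r s) = (\<Sum>i<d. \<Sum>j<d. p i * conj_weight F E j i * (p i powr \<gamma> * q j powr (- \<gamma>)))"
    unfolding sum.cartesian_product c_def r_def by (simp add: split_def)
  also have "\<dots> = (\<Sum>i<d. p i powr \<gamma> * y i)"
    unfolding y_def sum_distrib_left by (intro sum.cong refl) (simp add: mult_ac)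
  also have "\<dots> \<le> (\<Sum>i<d. (p i powr \<gamma>) powr (1 / \<gamma>)) powr (1 / (1 / \<gamma>)) * (\<Sum>i<d. y i powr \<alpha>) powr (1 / \<alpha>)"
    by (rule hoelder_sum) (use \<gamma> \<alpha> y0 in auto)
  also have "(\<Sum>i<d. (p i powr \<gamma>) powr (1 / \<gamma>)) = 1"
    using p0 p_sum \<gamma> by (simp add: powr_powr)
  also have "1 powr (1 / (1 / \<gamma>)) * (\<Sum>i<d. y i powr \<alpha>) powr (1 / \<alpha>) = (\<Sum>i<d. y i powr \<alpha>) powr (1 / \<alpha>)"
    by simp
  also have "\<dots> \<le> ?Q powr (1 / \<alpha>)"
  proof -
    have "(\<Sum>i<d. y i powr \<alpha>) = (\<Sum>i<d. Re ((adj E * (H * (G * H) * E)) $$ (i, i)) powr \<alpha>)"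
      by (intro sum.cong refl) (simp add: yE)
    also have "\<dots> \<le> ?Q"
      unfolding sand by (rule peierls[OF HGH diagdD(1,2)[OF E]]) (use \<alpha> in simp)
    finally show ?thesis using \<alpha> by (intro powr_mono2) (auto intro: sum_nonneg)
  qed
  finally have K: "(\<Sum>s\<in>?S. c s * r s) \<le> ?Q powr (1 / \<alpha>)" .
  \<comment> \<open>The logarithm needs strict positivity, which comes from the positive Petz trace:
    for \<open>?Q = 0\<close> its upper bound would be 0.\<close>
  have "0 \<le> ?Q" unfolding sand by (rule trpow_nonneg[OF HGH])
  with K J(1) have Q: "0 < ?Q" by (cases "?Q = 0") auto
  have "\<gamma> * D \<le> log 2 (\<Sum>s\<in>?S. c s * r s)" using J(2) unfolding D .
  also have "\<dots> \<le> log 2 (?Q powr (1 / \<alpha>))"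
    using K J(1) less_le_trans[OF J(1) K] by (subst log_le_cancel_iff) auto
  also have "\<dots> = 1 / \<alpha> * log 2 (?Q)" using Q by (simp add: log_powr)
  finally have "\<alpha> * (\<gamma> * D) \<le> \<alpha> * (1 / \<alpha> * log 2 (?Q))"
    using \<alpha> by (intro mult_left_mono) auto
  then have "(\<alpha> - 1) * D \<le> log 2 (?Q)" using \<alpha> by (simp add: \<gamma>_def)
  then have "D \<le> 1 / (\<alpha> - 1) * log 2 (?Q)" using \<alpha> by (simp add: field_simps)
  then show ?thesis unfolding rel_entropy_c D_def by simp
qed

end

lemma state_pair_exists:
  assumes "\<rho> \<in> density_ops d" "\<sigma> \<in> density_ops d" "supp \<rho> \<subseteq> supp \<sigma>"
  obtains E p F q where "state_pair d \<rho> \<sigma> E p F q"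
  using assms psd_diagd[of d \<rho>] psd_diagd[of d \<sigma>] unfolding density_ops_def state_pair_def mem_Collect_eq by metis

lemma rel_entropy_le_sandwiched:
  assumes "\<rho> \<in> density_ops d" "\<sigma> \<in> density_ops d" "1 < \<alpha>"
  shows "rel_entropy \<rho> \<sigma> \<le> sandwiched \<alpha> \<rho> \<sigma>"
proof (cases "supp \<rho> \<subseteq> supp \<sigma>")
  case True
  with assms(1,2) obtain E p F q where "state_pair d \<rho> \<sigma> E p F q" by (rule state_pair_exists)
  then interpret state_pair d \<rho> \<sigma> E p F q .
  show ?thesis using rel_entropy_le_sandw[OF assms(3)] True by (simp add: sandwiched_eq)
qed (simp add: sandwiched_eq)

lemma rel_entropy_nonneg:
  assumes "\<rho> \<in> density_ops d" "\<sigma> \<in> density_ops d"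
  shows "0 \<le> rel_entropy \<rho> \<sigma>"
proof (cases "supp \<rho> \<subseteq> supp \<sigma>")
  case True
  with assms(1,2) obtain E p F q where "state_pair d \<rho> \<sigma> E p F q" by (rule state_pair_exists)
  then interpret state_pair d \<rho> \<sigma> E p F q .
  show ?thesis using rel_entropy_ge_0 assms(2) by (simp add: density_ops_def)
qed (simp add: rel_entropy_def)

section \<open>One-shot tests\<close>

lemma mat_trace_mult_nonneg:
  assumes "psd d X" "psd d Y"
  shows "0 \<le> Re (mat_trace (X * Y))"
proof -
  define H where "H = herm_fun sqrt X"
  note H = psd_sqrt[OF assms(1), folded H_def]
  note [simp] = carrier_matD[OF H(3)] carrier_matD[OF psd_carrier[OF assms(2)]] H(2)
  have "psd d (H * (Y * H))" using psd_conj[OF assms(2) H(3)] by simp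
  note HYH = psd_carrier[OF this] psd_diagonal_nonneg[OF this]
  have "X * Y = H * (H * Y)" by (subst H(1)[symmetric]) (simp add: mult_assoc_dim)
  also have "mat_trace \<dots> = mat_trace (H * Y * H)"
    by (rule mat_trace_mult_comm) simp_all
  also have "H * Y * H = H * (Y * H)" by (simp add: mult_assoc_dim)
  finally have eq: "mat_trace (X * Y) = mat_trace (H * (Y * H))" .
  show ?thesis
    unfolding eq mat_trace_Re_sum[OF HYH(1)]
    by (intro sum_nonneg) (use HYH(2) in \<open>simp add: mat_trace_Re_sum[OF HYH(1)] less_eq_complex_def\<close>)
qed

lemma mat_trace_mult_mono:
  assumes "psd d X" "psd d (B - A)" "A \<in> carrier_mat d d" "B \<in> carrier_mat d d"
  shows "Re (mat_trace (X * A)) \<le> Re (mat_trace (X * B))"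
proof -
  note X = psd_carrier[OF assms(1)]
  have "X * (B - A) = X * B - X * A" by (rule mult_minus_distrib_mat[OF X assms(4,3)])
  then have "mat_trace (X * (B - A)) = mat_trace (X * B) - mat_trace (X * A)"
    using mat_trace_diff[OF mult_carrier_mat[OF X assms(4)] mult_carrier_mat[OF X assms(3)]] by simp
  then show ?thesis using mat_trace_mult_nonneg[OF assms(1,2)] by simp
qed

lemma diagd_diff:
  assumes "diagd d X U x" "diagd d Y U y"
  shows "diagd d (X - Y) U (\<lambda>i. x i - y i)"
proof (rule diagdI[OF diagdD(1,2)[OF assms(1)]])
  fix i j assume ij: "i < d" "j < d"
  show "(X - Y) $$ (i, j) = (\<Sum>k<d. of_real (x k - y k) * U $$ (i, k) * cnj (U $$ (j, k)))"
    using ij diagd_index[OF assms(1) ij] diagd_index[OF assms(2) ij] diagdD(8,9)[OF assms(1)] diagdD(8,9)[OF assms(2)]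
    by (simp add: left_diff_distrib sum_subtractf)
qed (rule minus_carrier_mat[OF diagdD(5)[OF assms(2)]])

lemma diagd_test:
  assumes "diagd d T U t" "\<And>i. i < d \<Longrightarrow> 0 \<le> t i \<and> t i \<le> 1"
  shows "psd d T" "psd d (1\<^sub>m d - T)"
  using diagd_psd[OF assms(1)] diagd_psd[OF diagd_diff[OF diagd_one[OF diagdD(1,2)[OF assms(1)]] assms(1)]] assms(2)
  by simp_all

text \<open>With the likelihood ratio t_j = p_j 2^g, each summand on the left is p_j
  t_j^(\<alpha>-1). Group the j by the integer part b of log t_j: from A on, the mass 2^(-\<epsilon>
  b) of a group outweighs the factor 2^((\<alpha>-1) b), because \<alpha> - 1 is at most \<epsilon>;
  below A the mass is at most 1. There are at most C + 1 groups since p_j is at most 1. The summand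
  1 in A + 1 is due to rounding.\<close>

lemma bucket_bound:
  fixes p :: "nat \<Rightarrow> real"
  assumes p0: "\<And>j. j < d \<Longrightarrow> 0 \<le> p j" and p1: "(\<Sum>j<d. p j) \<le> 1" and g: "g \<le> C"
    and \<alpha>: "1 < \<alpha>" "\<alpha> - 1 \<le> \<epsilon>" and A: "0 \<le> A"
    and tail: "\<And>b. A \<le> b \<Longrightarrow>
      (\<Sum>j | j < d \<and> 0 < p j \<and> 2 powr b \<le> p j * 2 powr real g. p j) \<le> 2 powr (- \<epsilon> * b)"
  shows "2 powr ((\<alpha> - 1) * real g) * (\<Sum>j<d. p j powr \<alpha>) \<le> real (C + 1) * 2 powr ((\<alpha> - 1) * (A + 1))"
proof -
  let ?b = "\<lambda>b. 2 powr ((\<alpha> - 1) * (real b + 1))"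
  let ?A = "2 powr ((\<alpha> - 1) * (A + 1))"
  define S where "S = {j. j < d \<and> 0 < p j}"
  have fin: "finite S" by (simp add: S_def)
  define t where "t j = p j * 2 powr real g" for j
  \<comment> \<open>\<open>nat\<close> puts every ratio below 2 into group 0, so the lower bound on
    t_j is available only in the other groups.\<close>
  define bk where "bk j = nat \<lfloor>log 2 (t j)\<rfloor>" for j
  have t0: "0 < t j" if "j \<in> S" for j using that by (simp add: t_def S_def)
  have pj: "p j \<le> 1" if "j \<in> S" for j
  proof -
    have "p j \<le> (\<Sum>j<d. p j)" using that p0 by (intro member_le_sum) (auto simp: S_def)
    with p1 show ?thesis by simp
  qed
  have t_le: "t j \<le> 2 powr (real (bk j) + 1)" if "j \<in> S" for j
  proof -
    have "log 2 (t j) \<le> real (bk j) + 1" unfolding bk_def by linarith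
    then show ?thesis using t0[OF that] by (simp add: log_le_iff)
  qed
  have t_ge: "2 powr real (bk j) \<le> t j" if "j \<in> S" "bk j \<noteq> 0" for j
  proof -
    have "real (bk j) \<le> log 2 (t j)" using that(2) unfolding bk_def by linarith
    then show ?thesis using t0[OF that(1)] by (simp add: le_log_iff)
  qed
  have bk: "bk j \<le> C" if "j \<in> S" for j
  proof -
    have "t j \<le> 2 powr real g" using pj[OF that] by (simp add: t_def mult_left_le_one_le)
    then have "log 2 (t j) \<le> real g" using t0[OF that] by (simp add: log_le_iff)
    then have "bk j \<le> g" unfolding bk_def by linarith
    with g show ?thesis by simp
  qed
  have "2 powr ((\<alpha> - 1) * real g) * (\<Sum>j<d. p j powr \<alpha>) = (\<Sum>j<d. 2 powr ((\<alpha> - 1) * real g) * p j powr \<alpha>)"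
    by (rule sum_distrib_left)
  also have "\<dots> = (\<Sum>j\<in>S. 2 powr ((\<alpha> - 1) * real g) * p j powr \<alpha>)"
    by (rule sum.mono_neutral_right) (use p0 in \<open>force simp: S_def\<close>)+
  also have "\<dots> = (\<Sum>j\<in>S. p j * t j powr (\<alpha> - 1))"
  proof (intro sum.cong refl)
    fix j assume "j \<in> S"
    then have "0 < p j" by (simp add: S_def)
    then have "p j powr \<alpha> = p j * p j powr (\<alpha> - 1)" by (simp add: powr_mult_base)
    then show "2 powr ((\<alpha> - 1) * real g) * p j powr \<alpha> = p j * t j powr (\<alpha> - 1)"
      using \<open>0 < p j\<close> by (simp add: t_def powr_mult powr_powr mult_ac)
  qed
  also have "\<dots> = (\<Sum>b\<in>{..C}. \<Sum>j\<in>{j \<in> S. bk j = b}. p j * t j powr (\<alpha> - 1))"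
    by (rule sum.group[symmetric]) (use fin bk in auto)
  also have "\<dots> \<le> (\<Sum>b\<in>{..C}. ?A)"
  proof (rule sum_mono)
    fix b assume "b \<in> {..C}"
    let ?B = "{j \<in> S. bk j = b}"
    define m where "m = (\<Sum>j\<in>?B. p j)"
    have m1: "m \<le> 1"
    proof -
      have "m \<le> (\<Sum>j<d. p j)" unfolding m_def using p0 by (intro sum_mono2) (auto simp: S_def)
      with p1 show ?thesis by simp
    qed
    have m0: "0 \<le> m" unfolding m_def by (intro sum_nonneg) (auto simp: S_def)
    have "(\<Sum>j\<in>?B. p j * t j powr (\<alpha> - 1)) \<le> (\<Sum>j\<in>?B. p j * ?b b)"
    proof (intro sum_mono mult_left_mono)
      fix j assume j: "j \<in> ?B"
      then have "t j powr (\<alpha> - 1) \<le> (2 powr (real b + 1)) powr (\<alpha> - 1)"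
        using t_le[of j] t0[of j] \<alpha> by (intro powr_mono2) auto
      then show "t j powr (\<alpha> - 1) \<le> ?b b"
        by (simp add: powr_powr mult.commute)
    qed (simp add: S_def)
    also have "\<dots> = m * ?b b"
      unfolding m_def by (rule sum_distrib_right[symmetric])
    also have "\<dots> \<le> ?A"
    proof (cases "real b \<le> A")
      case True
      have "m * ?b b \<le> 1 * ?A"
        using m1 m0 True \<alpha> by (intro mult_mono powr_mono mult_left_mono) auto
      then show ?thesis by simp
    next
      case False
      then have b: "A \<le> real b" "b \<noteq> 0" using A by (auto intro: ccontr)
      have "m \<le> (\<Sum>j | j < d \<and> 0 < p j \<and> 2 powr real b \<le> p j * 2 powr real g. p j)"
        unfolding m_def using t_ge b(2) by (intro sum_mono2) (auto simp: S_def t_def)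
      also have "\<dots> \<le> 2 powr (- \<epsilon> * real b)" by (rule tail[OF b(1)])
      finally have "m * ?b b \<le> 2 powr (- \<epsilon> * real b) * ?b b"
        by (intro mult_right_mono) auto
      also have "\<dots> = 2 powr ((\<alpha> - 1 - \<epsilon>) * real b + (\<alpha> - 1))"
        unfolding powr_add[symmetric] by (simp add: algebra_simps)
      also have "\<dots> \<le> ?A"
      proof (rule powr_mono)
        have "(\<alpha> - 1 - \<epsilon>) * real b \<le> 0" using \<alpha> by (intro mult_nonpos_nonneg) auto
        moreover have "0 \<le> (\<alpha> - 1) * A" using \<alpha> A by simp
        ultimately show "(\<alpha> - 1 - \<epsilon>) * real b + (\<alpha> - 1) \<le> (\<alpha> - 1) * (A + 1)"
          by (simp add: distrib_left)
      qed simp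
      finally show ?thesis .
    qed
    finally show "(\<Sum>j\<in>?B. p j * t j powr (\<alpha> - 1)) \<le> ?A" .
  qed
  also have "\<dots> = real (C + 1) * ?A" by simp
  finally show ?thesis .
qed

text \<open>The test projects onto the eigenvalues of \<open>P \<rho> P\<close> exceeding \<open>2\<^sup>b\<close> times the (nearly constant)
  value of \<open>\<sigma>\<close> on the range of \<open>P\<close>.\<close>

lemma block_test:
  assumes \<rho>: "psd d \<rho>" "mat_trace \<rho> = 1" and \<sigma>: "diagd d \<sigma> F q" "\<And>i. i < d \<Longrightarrow> 0 \<le> q i"
    and P: "diagd d P F (\<lambda>i. if I i then 1 else 0)"
    and g: "\<And>i. i < d \<Longrightarrow> I i \<Longrightarrow> q i \<le> 2 powr (- g)"
  obtains W p where "diagd d (P * \<rho> * P) W p" "\<And>j. j < d \<Longrightarrow> 0 \<le> p j" "(\<Sum>j<d. p j) \<le> 1"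
    "\<And>b. \<exists>T. psd d T \<and> psd d (1\<^sub>m d - T) \<and> Re (mat_trace (T * \<sigma>)) \<le> 2 powr (- b) \<and>
      Re (mat_trace (T * \<rho>)) = (\<Sum>j | j < d \<and> 0 < p j \<and> 2 powr b \<le> p j * 2 powr g. p j)"
proof -
  let ?I = "(\<lambda>i. if I i then 1 else 0)"
  define A where "A = P * \<rho> * P"
  note c = diagdD(5)[OF P] diagdD(5)[OF \<sigma>(1)] psd_carrier[OF \<rho>(1)]
  note [simp] = carrier_matD[OF c(1)] carrier_matD[OF c(2)] carrier_matD[OF c(3)]
  have Padj: "adj P = P" by (rule diagd_adj[OF P])
  have "diagd d (P * P) F ?I"
    by (rule back_subst[of "diagd d _ F", OF diagd_mult[OF P P]]) auto
  then have PP: "P * P = P" by (rule trans[OF diagdD(4) diagdD(4)[OF P, symmetric]])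
  have A: "psd d A" using psd_conj[OF \<rho>(1) c(1)] by (simp add: A_def Padj mult_assoc_dim)
  note [simp] = carrier_matD[OF psd_carrier[OF A]]
  obtain W p where W: "diagd d A W p" and p0: "\<And>j. j < d \<Longrightarrow> 0 \<le> p j" using psd_diagd[OF A] by blast
  have PA: "P * A = A" "A * P = A"
  proof -
    have "P * A = (P * P) * (\<rho> * P)" unfolding A_def by (simp add: mult_assoc_dim)
    then show "P * A = A" by (simp add: PP) (simp add: A_def mult_assoc_dim)
    have "A * P = P * \<rho> * (P * P)" unfolding A_def by (simp add: mult_assoc_dim)
    then show "A * P = A" by (simp add: PP) (simp add: A_def)
  qed
  \<comment> \<open>An operator living on the range of \<open>P\<close> sees only the compression of
    \<open>Y\<close> to that range.\<close>
  have trX: "mat_trace (X * Y) = mat_trace (X * (P * (Y * P)))"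
    if X: "X \<in> carrier_mat d d" "P * X = X" "X * P = X" and Y: "Y \<in> carrier_mat d d" for X Y
  proof -
    note [simp] = carrier_matD[OF X(1)] carrier_matD[OF Y]
    have "mat_trace (X * Y) = mat_trace (P * (X * P * Y))"
      using X(2,3) by (simp add: mult_assoc_dim[symmetric])
    also have "\<dots> = mat_trace (X * P * Y * P)"
      by (rule mat_trace_mult_comm) simp_all
    finally show ?thesis by (simp add: mult_assoc_dim)
  qed
  have P01: "psd d P" "psd d (1\<^sub>m d - P)" by (rule diagd_test[OF P]; simp)+
  have "mat_trace A = mat_trace (P * \<rho>)"
  proof -
    have "mat_trace A = mat_trace (P * (P * \<rho>))"
      unfolding A_def by (rule mat_trace_mult_comm) simp_all
    also have "P * (P * \<rho>) = P * P * \<rho>" by (simp add: mult_assoc_dim)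
    finally show ?thesis by (simp add: PP)
  qed
  also have "mat_trace (P * \<rho>) = mat_trace (\<rho> * P)"
    by (rule mat_trace_mult_comm) simp_all
  finally have "Re (mat_trace A) \<le> Re (mat_trace (\<rho> * 1\<^sub>m d))"
    using mat_trace_mult_mono[OF \<rho>(1) P01(2) c(1) one_carrier_mat] by simp
  then have p1: "(\<Sum>j<d. p j) \<le> 1"
    using \<rho>(2) by (simp add: diagd_trace[OF W] right_mult_one_mat[OF c(3)] del: of_real_sum)
  have "\<exists>T. psd d T \<and> psd d (1\<^sub>m d - T) \<and> Re (mat_trace (T * \<sigma>)) \<le> 2 powr (- b) \<and>
      Re (mat_trace (T * \<rho>)) = (\<Sum>j | j < d \<and> 0 < p j \<and> 2 powr b \<le> p j * 2 powr g. p j)" for b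
  proof -
    define sel where "sel t \<longleftrightarrow> 0 < t \<and> 2 powr b \<le> t * 2 powr g" for t :: real
    define T where "T = herm_fun (\<lambda>t. if sel t then 1 else 0) A"
    \<comment> \<open>\<open>K\<close> inverts the compressed state on the selected eigenvalues.
      Writing \<open>T\<close> as a product with \<open>A\<close> shows that it lives on the range
      of \<open>P\<close>.\<close>
    define K where "K = herm_fun (\<lambda>t. if sel t then 1 / t else 0) A"
    have T: "diagd d T W (\<lambda>j. if sel (p j) then 1 else 0)" unfolding T_def by (rule diagd_herm_fun[OF W])
    have T01: "psd d T" "psd d (1\<^sub>m d - T)" by (rule diagd_test[OF T]; simp)+
    have Kc: "K \<in> carrier_mat d d" unfolding K_def by (rule herm_fun_carrier[OF W])
    note [simp] = carrier_matD[OF diagdD(5)[OF T]] carrier_matD[OF Kc]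
    have "K * A = herm_fun (\<lambda>t. (if sel t then 1 / t else 0) * t) A"
      using herm_fun_mult[OF W, of _ "\<lambda>t. t"] by (simp add: K_def herm_fun_id[OF W])
    also have "\<dots> = T" unfolding T_def by (rule herm_fun_cong[OF W]) (auto simp: sel_def)
    finally have KA: "K * A = T" .
    have "A * K = herm_fun (\<lambda>t. t * (if sel t then 1 / t else 0)) A"
      using herm_fun_mult[OF W, of "\<lambda>t. t"] by (simp add: K_def herm_fun_id[OF W])
    also have "\<dots> = T" unfolding T_def by (rule herm_fun_cong[OF W]) (auto simp: sel_def)
    finally have AK: "A * K = T" .
    have PT: "P * T = T" using PA(1) by (subst (1 2) AK[symmetric]) (simp add: mult_assoc_dim[symmetric])
    have TP: "T * P = T" using PA(2) by (subst (1 2) KA[symmetric]) (simp add: mult_assoc_dim)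
    have "T * (P * (\<rho> * P)) = herm_fun (\<lambda>t. (if sel t then 1 else 0) * t) A"
      using herm_fun_mult[OF W, of _ "\<lambda>t. t"]
      by (simp add: T_def herm_fun_id[OF W] mult_assoc_dim[symmetric] A_def[symmetric] del: mult_zero_left)
    then have "mat_trace (T * \<rho>) = of_real (\<Sum>j<d. (if sel (p j) then 1 else 0) * p j)"
      using trX[OF diagdD(5)[OF T] PT TP c(3)] diagd_trace[OF diagd_herm_fun[OF W]] by simp
    also have "(\<Sum>j<d. (if sel (p j) then 1 else 0) * p j) = (\<Sum>j | j < d \<and> sel (p j). p j)"
      by (rule sum.mono_neutral_cong_right) auto
    finally have s: "Re (mat_trace (T * \<rho>)) = (\<Sum>j | j < d \<and> sel (p j). p j)" by simp
    have PsP: "diagd d (P * (\<sigma> * P)) F (\<lambda>i. if I i then q i else 0)"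
      by (rule back_subst[of "diagd d _ F", OF diagd_mult[OF P diagd_mult[OF \<sigma>(1) P]]]) auto
    \<comment> \<open>On the range of \<open>P\<close>, \<sigma> is at most 2^(-g), so the Type-II
      error is at most 2^(-g) times the rank of \<open>T\<close>; each selected eigenvalue satisfies
      2^(-g) \<le> 2^(-b) p_j, and the p_j sum to at most 1.\<close>
    have "psd d (2 powr (- g) \<cdot>\<^sub>m 1\<^sub>m d - P * (\<sigma> * P))"
    proof (rule diagd_psd[OF diagd_diff[OF _ PsP]])
      show "diagd d (of_real (2 powr (- g)) \<cdot>\<^sub>m 1\<^sub>m d) F (\<lambda>_. 2 powr (- g))"
        by (rule diagdI[OF diagdD(1,2)[OF P]])
          (simp_all add: diagd_index[OF diagd_one[OF diagdD(1,2)[OF P]]] sum_distrib_left mult.assoc del: index_one_mat(1))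
      show "0 \<le> 2 powr (- g) - (if I i then q i else 0)" if "i < d" for i using g[OF that] by simp
    qed
    from mat_trace_mult_mono[OF T01(1) this diagdD(5)[OF PsP]]
    have "Re (mat_trace (T * (P * (\<sigma> * P)))) \<le> Re (mat_trace (T * (of_real (2 powr (- g)) \<cdot>\<^sub>m 1\<^sub>m d)))"
      by simp
    also have "T * (of_real (2 powr (- g)) \<cdot>\<^sub>m 1\<^sub>m d) = of_real (2 powr (- g)) \<cdot>\<^sub>m T"
      using right_mult_one_mat[OF diagdD(5)[OF T]]
      by (subst mult_smult_distrib[OF diagdD(5)[OF T] one_carrier_mat]) simp
    also have "Re (mat_trace (of_real (2 powr (- g)) \<cdot>\<^sub>m T)) = 2 powr (- g) * Re (mat_trace T)"
      by (simp add: mat_trace_def sum_distrib_left)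
    also have "mat_trace T = of_real (\<Sum>j<d. if sel (p j) then 1 else 0)"
      by (rule diagd_trace[OF T])
    also have "2 powr (- g) * Re (of_real (\<Sum>j<d. if sel (p j) then 1 else 0)) = (\<Sum>j<d. if sel (p j) then 2 powr (- g) else 0)"
      by (simp add: sum_distrib_left if_distrib cong: if_cong)
    also have "\<dots> \<le> (\<Sum>j<d. 2 powr (- b) * p j)"
    proof (rule sum_mono)
      fix j assume j: "j \<in> {..<d}"
      show "(if sel (p j) then 2 powr (- g) else 0) \<le> 2 powr (- b) * p j"
        using p0[of j] j by (auto simp: sel_def powr_minus field_simps)
    qed
    also have "\<dots> = 2 powr (- b) * (\<Sum>j<d. p j)" by (rule sum_distrib_left[symmetric])
    also have "\<dots> \<le> 2 powr (- b)" using p1 by (simp add: mult_left_le)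
    finally have "Re (mat_trace (T * \<sigma>)) \<le> 2 powr (- b)"
      unfolding trX[OF diagdD(5)[OF T] PT TP c(2)] .
    with T01 s show ?thesis by (auto simp: sel_def)
  qed
  with W p0 p1 show ?thesis using that unfolding A_def by blast
qed

text \<open>Jensen with uniform weights: the price for moving a convex power inside a sum is only
  polynomial in the number of terms.\<close>

lemma powr_sum_le:
  fixes b :: "nat \<Rightarrow> real"
  assumes "1 \<le> \<alpha>" "\<And>g. g \<le> C \<Longrightarrow> 0 \<le> b g"
  shows "(\<Sum>g\<le>C. b g) powr \<alpha> \<le> real (C + 1) powr (\<alpha> - 1) * (\<Sum>g\<le>C. b g powr \<alpha>)"
proof -
  let ?s = "(\<Sum>g\<le>C. b g)"
  let ?b = "(\<Sum>g\<le>C. b g powr \<alpha>)"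
  let ?v = "real (C + 1)"
  have "(\<Sum>g\<le>C. b g * (1 / ?v)) powr \<alpha> \<le> (\<Sum>g\<le>C. b g powr \<alpha> * (1 / ?v))"
    by (rule powr_jensen) (use assms in auto)
  then have "(?s / ?v) powr \<alpha> \<le> ?b / ?v"
    by (simp only: times_divide_eq_right mult_1_right sum_divide_distrib[symmetric])
  then have "?v powr \<alpha> * (?s powr \<alpha> / ?v powr \<alpha>) \<le> ?v powr \<alpha> * (?b / ?v)"
    using assms by (intro mult_left_mono) (auto simp: powr_divide sum_nonneg)
  then have "?s powr \<alpha> \<le> ?v powr \<alpha> / ?v * ?b"
    by simp
  also have "?v powr \<alpha> / ?v = ?v powr (\<alpha> - 1)" by (simp add: powr_diff)
  finally show ?thesis .
qed

text \<open>Splitting \<open>\<sigma>\<^sup>-\<^sup>\<gamma>\<close> dyadically by spectral projections \<open>P\<^sub>g\<close> in \<open>\<rho>\<^sup>1\<^sup>/\<^sup>2 \<sigma>\<^sup>-\<^sup>\<gamma> \<rho>\<^sup>1\<^sup>/\<^sup>2\<close> replaces the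
  pinching inequality: a large sandwiched quantity makes one of the \<open>P\<^sub>g \<rho> P\<^sub>g\<close> large.\<close>

lemma one_shot_test:
  assumes \<rho>: "psd d \<rho>" "mat_trace \<rho> = 1"
    and F: "diagd d \<sigma> F q" "\<And>i. i < d \<Longrightarrow> 0 \<le> q i" "\<And>i. i < d \<Longrightarrow> q i \<le> 1"
      "\<And>i. i < d \<Longrightarrow> 0 < q i \<Longrightarrow> 2 powr (- real C) \<le> q i"
    and \<alpha>: "1 < \<alpha>" "\<alpha> - 1 \<le> \<epsilon>" and A: "0 \<le> A"
    and big: "2 powr (\<alpha> - 1) * real (C + 1) powr (\<alpha> + 1) * 2 powr ((\<alpha> - 1) * (A + 1)) < sandw \<alpha> \<rho> \<sigma>"
  shows "\<exists>T b. psd d T \<and> psd d (1\<^sub>m d - T) \<and> A \<le> b \<and>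
    Re (mat_trace (T * \<sigma>)) \<le> 2 powr (- b) \<and> 2 powr (- \<epsilon> * b) \<le> Re (mat_trace (T * \<rho>))"
proof (rule ccontr)
  let ?s = "\<lambda>p b g. \<Sum>j | j < d \<and> 0 < p j \<and> 2 powr b \<le> p j * 2 powr real g. (p j :: real)"
  let ?h = "\<lambda>g. 2 powr ((\<alpha> - 1) * (real g + 1))"
  let ?A = "2 powr ((\<alpha> - 1) * (A + 1))"
  \<comment> \<open>If no b admits a good test, then \<open>block_test\<close> turns this, for every
    level g, into the tail bound that \<open>bucket_bound\<close> expects.\<close>
  assume contr: "\<not> ?thesis"
  let ?v = "real (C + 1)"
  define \<gamma> where "\<gamma> = (\<alpha> - 1) / \<alpha>"
  have \<gamma>: "0 < \<gamma>" "\<gamma> * \<alpha> = \<alpha> - 1" "- (\<alpha> - 1) / \<alpha> = - \<gamma>"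
    using \<alpha> by (simp_all add: \<gamma>_def minus_divide_left)
  \<comment> \<open>The dyadic level g of an eigenvalue t: 2^(-g-1) \<le> t \<le> 2^(-g). The upper
    bound serves the Type-II error, the lower one the estimate of t^(-\<gamma>). Zero eigenvalues
    belong to no block and contribute nothing, as \<open>0 powr (- \<gamma>) = 0\<close>.\<close>
  define gr where "gr t = nat \<lfloor>- log 2 t\<rfloor>" for t :: real
  have gr1: "t \<le> 2 powr (- real (gr t))" if "0 < t" "t \<le> 1" for t
  proof -
    have "0 \<le> - log 2 t" using that by simp
    then have "real (gr t) \<le> - log 2 t" unfolding gr_def by linarith
    then have "log 2 t \<le> - real (gr t)" by simp
    then show ?thesis using that by (simp add: log_le_iff)
  qed
  have gr2: "2 powr (- (real (gr t) + 1)) \<le> t" if "0 < t" for t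
  proof -
    have "- (real (gr t) + 1) \<le> log 2 t" unfolding gr_def by linarith
    then show ?thesis using that by (simp add: le_log_iff)
  qed
  have grC: "gr (q j) \<le> C" if "j < d" "0 < q j" for j
  proof -
    have "- real C \<le> log 2 (q j)" using F(4)[OF that] that(2) by (simp add: le_log_iff)
    then show ?thesis unfolding gr_def by linarith
  qed
  define P where "P g = herm_fun (\<lambda>t. if 0 < t \<and> gr t = g then 1 else 0) \<sigma>" for g
  have P: "diagd d (P g) F (\<lambda>i. if 0 < q i \<and> gr (q i) = g then 1 else 0)" for g
    unfolding P_def by (rule diagd_herm_fun[OF F(1)])
  define H where "H = herm_fun sqrt \<rho>"
  note H = psd_sqrt[OF \<rho>(1), folded H_def]
  define G where "G = herm_fun (\<lambda>t. t powr (- \<gamma>)) \<sigma>"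
  have G: "diagd d G F (\<lambda>j. q j powr (- \<gamma>))" unfolding G_def by (rule diagd_herm_fun[OF F(1)])
  note [simp] = carrier_matD[OF H(3)] H(2) diagdD(8,9)[OF G] diagdD(8,9)[OF P] diagdD(6,7)[OF G]
    carrier_matD[OF psd_carrier[OF \<rho>(1)]]
  have psdH: "psd d (H * (Y * H))" if "psd d Y" for Y using psd_conj[OF that H(3)] by simp
  have HGH: "psd d (H * (G * H))" by (rule psdH[OF diagd_psd[OF G]]) simp
  have HPH: "psd d (H * (P g * H))" for g by (rule psdH[OF diagd_psd[OF P]]) simp
  \<comment> \<open>The eigenbasis of the whole operator is used for all blocks: the eigenvalues
    \<open>x i\<close> are then bounded by sums of diagonal entries \<open>z g i\<close> of the
    blocks, and \<open>peierls\<close> returns from these to power traces.\<close>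
  obtain V x where V: "diagd d (H * (G * H)) V x" and x0: "\<And>i. i < d \<Longrightarrow> 0 \<le> x i"
    using psd_diagd[OF HGH] by blast
  note [simp] = diagdD(6,7)[OF V]
  define w where "w j i = conj_weight F (H * V) j i" for j i
  have HV: "H * V \<in> carrier_mat d d" by (intro carrier_matI) simp_all
  define z where "z g i = (\<Sum>j | j < d \<and> 0 < q j \<and> gr (q j) = g. w j i)" for g i
  have z0: "0 \<le> z g i" for g i unfolding z_def w_def by (intro sum_nonneg) simp
  have HVx: "adj V * (H * (Y * H) * V) = adj (H * V) * (Y * (H * V))" if "dim_row Y = d" "dim_col Y = d" for Y
    using that by (simp add: adj_mult mult_assoc_dim)
  have x: "x i = (\<Sum>j<d. q j powr (- \<gamma>) * w j i)" if i: "i < d" for i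
  proof -
    have "of_real (x i) = (adj V * (H * (G * H) * V)) $$ (i, i)"
      using i by (simp add: diagd_conj(1)[OF V] index_rdiag)
    also have "\<dots> = of_real (\<Sum>j<d. q j powr (- \<gamma>) * w j i)"
      by (subst HVx) (simp_all add: conj_diagonal[OF G HV i] w_def)
    finally show ?thesis by (simp only: of_real_eq_iff)
  qed
  have z: "Re ((adj V * (H * (P g * H) * V)) $$ (i, i)) = z g i" if i: "i < d" for g i
  proof -
    have "Re ((adj V * (H * (P g * H) * V)) $$ (i, i)) = (\<Sum>j<d. (if 0 < q j \<and> gr (q j) = g then 1 else 0) * w j i)"
      by (subst HVx) (simp_all only: diagdD(8,9)[OF P] conj_diagonal[OF P HV i] w_def Re_complex_of_real)
    also have "\<dots> = z g i"
      unfolding z_def by (rule sum.mono_neutral_cong_right) auto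
    finally show ?thesis .
  qed
  have xz: "x i \<le> (\<Sum>g\<le>C. 2 powr (\<gamma> * (real g + 1)) * z g i)" if i: "i < d" for i
  proof -
    let ?S = "{j. j < d \<and> 0 < q j}"
    have "x i = (\<Sum>j\<in>?S. q j powr (- \<gamma>) * w j i)"
      unfolding x[OF i]
    proof (rule sum.mono_neutral_right)
      show "\<forall>j\<in>{..<d} - ?S. q j powr (- \<gamma>) * w j i = 0"
      proof
        fix j assume "j \<in> {..<d} - ?S"
        then have "q j = 0" using F(2)[of j] by auto
        then show "q j powr (- \<gamma>) * w j i = 0" by simp
      qed
    qed auto
    also have "\<dots> = (\<Sum>g\<in>{..C}. \<Sum>j\<in>{j \<in> ?S. gr (q j) = g}. q j powr (- \<gamma>) * w j i)"
      by (rule sum.group[symmetric]) (use grC in auto)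
    also have "\<dots> \<le> (\<Sum>g\<in>{..C}. \<Sum>j\<in>{j \<in> ?S. gr (q j) = g}. 2 powr (\<gamma> * (real g + 1)) * w j i)"
    proof (intro sum_mono mult_right_mono)
      fix g j assume j: "j \<in> {j \<in> ?S. gr (q j) = g}"
      then have "2 powr (- (real g + 1)) \<le> q j" using gr2[of "q j"] by auto
      then have "q j powr (- \<gamma>) \<le> (2 powr (- (real g + 1))) powr (- \<gamma>)"
        using \<gamma> by (intro powr_mono2') auto
      then show "q j powr (- \<gamma>) \<le> 2 powr (\<gamma> * (real g + 1))" by (simp add: powr_powr algebra_simps)
    qed (simp add: w_def)
    also have "\<dots> = (\<Sum>g\<le>C. 2 powr (\<gamma> * (real g + 1)) * z g i)"
      unfolding z_def sum_distrib_left[symmetric] by (simp add: conj_assoc)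
    finally show ?thesis .
  qed
  have block: "2 powr ((\<alpha> - 1) * real g) * trpow \<alpha> (H * (P g * H)) \<le> ?v * ?A"
    if g: "g \<le> C" for g
  proof -
    have "q i \<le> 2 powr (- real g)" if "i < d" "0 < q i \<and> gr (q i) = g" for i
      using gr1[of "q i"] F(3)[OF that(1)] that(2) by auto
    from block_test[OF \<rho> F(1,2) P this] obtain W p where
      W: "diagd d (P g * \<rho> * P g) W p" and p: "\<And>j. j < d \<Longrightarrow> 0 \<le> p j" "(\<Sum>j<d. p j) \<le> 1" and
      T: "\<And>b. \<exists>T. psd d T \<and> psd d (1\<^sub>m d - T) \<and> Re (mat_trace (T * \<sigma>)) \<le> 2 powr (- b) \<and>
        Re (mat_trace (T * \<rho>)) = (?s p b g)"
      by blast
    have "(?s p b g) \<le> 2 powr (- \<epsilon> * b)" if "A \<le> b" for b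
    proof -
      obtain T where T: "psd d T" "psd d (1\<^sub>m d - T)" "Re (mat_trace (T * \<sigma>)) \<le> 2 powr (- b)"
        and s: "Re (mat_trace (T * \<rho>)) = (?s p b g)"
        using T[of b] by blast
      have "\<not> 2 powr (- \<epsilon> * b) \<le> Re (mat_trace (T * \<rho>))" using contr that T by blast
      then show ?thesis unfolding s by (rule order.strict_implies_order[OF not_le_imp_less])
    qed
    from bucket_bound[OF p g \<alpha> A this]
    have "2 powr ((\<alpha> - 1) * real g) * trpow \<alpha> (P g * \<rho> * P g) \<le> ?v * ?A"
      by (simp add: trpow_eq[OF W])
    \<comment> \<open>\<open>trpow_swap\<close> for P \<rho>^(1/2): the test is built from P \<rho>
      P, while the splitting of \<sigma>^(-\<gamma>) produces \<rho>^(1/2) P \<rho>^(1/2).\<close>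
    also have "trpow \<alpha> (P g * \<rho> * P g) = trpow \<alpha> (H * (P g * H))"
    proof -
      have Padj: "adj (P g) = P g" by (rule diagd_adj[OF P])
      have PP: "P g * P g = P g"
        unfolding P_def herm_fun_mult[OF F(1)] by (rule herm_fun_cong[OF F(1)]) simp
      have PH: "P g * H \<in> carrier_mat d d" by (intro carrier_matI) simp_all
      have "P g * \<rho> * P g = (P g * H) * adj (P g * H)"
        by (subst H(1)[symmetric]) (simp add: adj_mult Padj mult_assoc_dim)
      moreover have "H * (P g * H) = adj (P g * H) * (P g * H)"
        by (subst PP[symmetric]) (simp add: adj_mult Padj mult_assoc_dim)
      ultimately show ?thesis by (simp add: trpow_swap[OF PH])
    qed
    finally show ?thesis .
  qed
  have "sandw \<alpha> \<rho> \<sigma> = (\<Sum>i<d. x i powr \<alpha>)"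
    unfolding sandw_swap[OF \<rho>(1) F(1) \<alpha>(1)] \<gamma>(3) H_def[symmetric] G_def[symmetric] by (rule trpow_eq[OF V])
  also have "\<dots> \<le> (\<Sum>i<d. ?v powr (\<alpha> - 1) * (\<Sum>g\<le>C. ?h g * z g i powr \<alpha>))"
  proof (rule sum_mono)
    fix i assume "i \<in> {..<d}"
    then have i: "i < d" by simp
    have "x i powr \<alpha> \<le> (\<Sum>g\<le>C. 2 powr (\<gamma> * (real g + 1)) * z g i) powr \<alpha>"
      using xz[OF i] x0[OF i] \<alpha> by (intro powr_mono2) auto
    also have "\<dots> \<le> ?v powr (\<alpha> - 1) * (\<Sum>g\<le>C. (2 powr (\<gamma> * (real g + 1)) * z g i) powr \<alpha>)"
      by (rule powr_sum_le) (use \<alpha> z0 in auto)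
    also have "(\<Sum>g\<le>C. (2 powr (\<gamma> * (real g + 1)) * z g i) powr \<alpha>) =
        (\<Sum>g\<le>C. ?h g * z g i powr \<alpha>)"
    proof (intro sum.cong refl)
      fix g
      have "\<gamma> * (real g + 1) * \<alpha> = \<gamma> * \<alpha> * (real g + 1)" by (simp only: mult_ac)
      then have "\<gamma> * (real g + 1) * \<alpha> = (\<alpha> - 1) * (real g + 1)" by (simp only: \<gamma>(2))
      then show "(2 powr (\<gamma> * (real g + 1)) * z g i) powr \<alpha> = ?h g * z g i powr \<alpha>"
        by (simp only: powr_mult powr_powr)
    qed
    finally show "x i powr \<alpha> \<le> ?v powr (\<alpha> - 1) * (\<Sum>g\<le>C. ?h g * z g i powr \<alpha>)" .
  qed
  also have "\<dots> = ?v powr (\<alpha> - 1) * (\<Sum>i<d. \<Sum>g\<le>C. ?h g * z g i powr \<alpha>)"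
    by (rule sum_distrib_left[symmetric])
  also have "(\<Sum>i<d. \<Sum>g\<le>C. ?h g * z g i powr \<alpha>) =
      (\<Sum>g\<le>C. ?h g * (\<Sum>i<d. z g i powr \<alpha>))"
    by (subst sum.swap) (simp only: sum_distrib_left)
  also have "?v powr (\<alpha> - 1) * \<dots> \<le> ?v powr (\<alpha> - 1) * (\<Sum>g\<le>C. 2 powr (\<alpha> - 1) * (?v * ?A))"
  proof (intro mult_left_mono sum_mono)
    fix g assume "g \<in> {..C}"
    then have g: "g \<le> C" by simp
    have "(\<Sum>i<d. z g i powr \<alpha>) = (\<Sum>i<d. Re ((adj V * (H * (P g * H) * V)) $$ (i, i)) powr \<alpha>)"
      by (intro sum.cong refl) (simp add: z)
    also have "\<dots> \<le> trpow \<alpha> (H * (P g * H))"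
      by (rule peierls[OF HPH diagdD(1,2)[OF V]]) (use \<alpha> in simp)
    finally have "?h g * (\<Sum>i<d. z g i powr \<alpha>) \<le>
        ?h g * trpow \<alpha> (H * (P g * H))"
      by (intro mult_left_mono) auto
    also have "\<dots> = 2 powr (\<alpha> - 1) * (2 powr ((\<alpha> - 1) * real g) * trpow \<alpha> (H * (P g * H)))"
      by (simp add: distrib_left powr_add)
    also have "\<dots> \<le> 2 powr (\<alpha> - 1) * (?v * ?A)"
      by (intro mult_left_mono block[OF g]) auto
    finally show "?h g * (\<Sum>i<d. z g i powr \<alpha>) \<le>
        2 powr (\<alpha> - 1) * (?v * ?A)" .
  qed auto
  \<comment> \<open>The exponent \<alpha> + 1 of C + 1 is the sum of \<alpha> - 1 from
    \<open>powr_sum_le\<close>, 1 from the number of levels and 1 from the number of groups in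
    \<open>bucket_bound\<close>.\<close>
  also have "\<dots> = 2 powr (\<alpha> - 1) * ?v powr (\<alpha> + 1) * ?A"
  proof -
    have "?v powr (\<alpha> + 1) = ?v powr (\<alpha> - 1) * ?v powr 1 * ?v powr 1"
      unfolding powr_add[symmetric] by simp
    then have v: "?v powr (\<alpha> + 1) = ?v powr (\<alpha> - 1) * ?v * ?v" by simp
    have "(\<Sum>g\<le>C. y) = ?v * y" for y :: real by simp
    then show ?thesis unfolding v by (simp only: mult_ac)
  qed
  finally have "\<not> 2 powr (\<alpha> - 1) * ?v powr (\<alpha> + 1) * ?A < sandw \<alpha> \<rho> \<sigma>"
    by (rule leD)
  with big show False by contradiction
qed

section \<open>Kronecker products\<close>

lemma sum_mult_split:
  fixes g :: "nat \<Rightarrow> 'a :: comm_monoid_add"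
  shows "(\<Sum>k<n * m. g k) = (\<Sum>a<n. \<Sum>b<m. g (a * m + b))"
proof -
  have "(\<Sum>k\<in>{a * m..<a * m + m}. g k) = (\<Sum>b<m. g (a * m + b))" for a
    by (rule sum.reindex_bij_witness[of _ "\<lambda>b. a * m + b" "\<lambda>k. k - a * m"]) auto
  then show ?thesis by (simp add: sum.nat_group[symmetric])
qed

lemma mult_add_less: "a < n \<Longrightarrow> b < m \<Longrightarrow> a * m + b < n * (m :: nat)"
proof -
  assume "a < n" "b < m"
  then have "a * m + b < Suc a * m" by simp
  also have "\<dots> \<le> n * m" using \<open>a < n\<close> by (intro mult_le_mono1) simp
  finally show ?thesis .
qed

lemma div_mod_less:
  assumes "r < a * (b :: nat)" shows "r div b < a" "r mod b < b"
proof -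
  have "0 < b" using assms by (cases b) auto
  with assms show "r div b < a" "r mod b < b" by (auto simp: less_mult_imp_div_less)
qed

lemma dim_kron [simp]:
  "dim_row (kron X Y) = dim_row X * dim_row Y" "dim_col (kron X Y) = dim_col X * dim_col Y"
  by (simp_all add: kron_def)

lemma index_kron:
  "i < dim_row X * dim_row Y \<Longrightarrow> j < dim_col X * dim_col Y \<Longrightarrow>
    kron X Y $$ (i, j) = X $$ (i div dim_row Y, j div dim_col Y) * Y $$ (i mod dim_row Y, j mod dim_col Y)"
  by (simp add: kron_def)

lemma kron_carrier: "X \<in> carrier_mat a b \<Longrightarrow> Y \<in> carrier_mat c d \<Longrightarrow> kron X Y \<in> carrier_mat (a * c) (b * d)"
  by (rule carrier_matI) auto

lemma kron_mult:
  assumes "dim_col A = dim_row C" "dim_col B = dim_row D"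
  shows "kron A B * kron C D = kron (A * C) (B * D)"
proof (rule eq_matI)
  fix i j assume "i < dim_row (kron (A * C) (B * D))" "j < dim_col (kron (A * C) (B * D))"
  then have ij: "i < dim_row A * dim_row B" "j < dim_col C * dim_col D" by auto
  note l = div_mod_less[OF ij(1)] div_mod_less[OF ij(2)]
  let ?f = "\<lambda>k l. A $$ (i div dim_row B, k) * B $$ (i mod dim_row B, l) * (C $$ (k, j div dim_col D) * D $$ (l, j mod dim_col D))"
  have "(kron A B * kron C D) $$ (i, j) = (\<Sum>k<dim_row C * dim_row D. kron A B $$ (i, k) * kron C D $$ (k, j))"
    using ij assms by (subst index_mult) simp_all
  also have "\<dots> = (\<Sum>k<dim_row C * dim_row D. ?f (k div dim_row D) (k mod dim_row D))"
    using ij assms by (intro sum.cong refl) (simp add: index_kron)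
  also have "\<dots> = (\<Sum>k<dim_row C. \<Sum>l<dim_row D. ?f k l)"
    unfolding sum_mult_split by (intro sum.cong refl) simp
  also have "\<dots> = (\<Sum>k<dim_row C. \<Sum>l<dim_row D. (A $$ (i div dim_row B, k) * C $$ (k, j div dim_col D)) *
      (B $$ (i mod dim_row B, l) * D $$ (l, j mod dim_col D)))"
    by (intro sum.cong refl) (simp only: mult_ac)
  also have "\<dots> = (A * C) $$ (i div dim_row B, j div dim_col D) * (B * D) $$ (i mod dim_row B, j mod dim_col D)"
    using l assms by (simp only: index_mult sum_product)
  also have "\<dots> = kron (A * C) (B * D) $$ (i, j)"
    using ij by (simp add: index_kron)
  finally show "(kron A B * kron C D) $$ (i, j) = kron (A * C) (B * D) $$ (i, j)" .
qed simp_all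

lemma adj_kron: "adj (kron A B) = kron (adj A) (adj B)"
  by (rule eq_matI) (auto simp: index_kron div_mod_less)

lemma kron_rdiag:
  "kron (rdiag a x) (rdiag b y) = rdiag (a * b) (\<lambda>i. x (i div b) * y (i mod b))"
proof (rule eq_matI)
  let ?D = "rdiag (a * b) (\<lambda>i. x (i div b) * y (i mod b))"
  show "dim_row (kron (rdiag a x) (rdiag b y)) = dim_row ?D" "dim_col (kron (rdiag a x) (rdiag b y)) = dim_col ?D"
    by (simp_all only: dim_kron dim_mat_diag)
  fix i j assume "i < dim_row ?D" "j < dim_col ?D"
  then have ij: "i < a * b" "j < a * b" by (simp_all only: dim_mat_diag)
  have "i = j \<longleftrightarrow> i div b = j div b \<and> i mod b = j mod b" by (metis div_mult_mod_eq)
  moreover have "?D $$ (i, j) = (if i = j then of_real (x (i div b) * y (i mod b)) else 0)"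
    using ij by (rule index_rdiag)
  ultimately show "kron (rdiag a x) (rdiag b y) $$ (i, j) = ?D $$ (i, j)"
    using ij div_mod_less[OF ij(1)] div_mod_less[OF ij(2)] by (simp add: index_kron index_rdiag)
qed

lemma kron_one: "kron (1\<^sub>m a) (1\<^sub>m b) = 1\<^sub>m (a * b)"
  using kron_rdiag[of a "\<lambda>_. 1" b "\<lambda>_. 1"] by simp

lemma kron_diagd:
  assumes "diagd a X U x" "diagd b Y V y"
  shows "diagd (a * b) (kron X Y) (kron U V) (\<lambda>i. x (i div b) * y (i mod b))"
proof -
  note [simp] = diagdD(6-9)[OF assms(1)] diagdD(6-9)[OF assms(2)]
  have "kron X Y = kron U V * (kron (rdiag a x) (rdiag b y) * adj (kron U V))"
    by (subst diagdD(4)[OF assms(1)], subst diagdD(4)[OF assms(2)]) (simp add: kron_mult adj_kron)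
  moreover have "adj (kron U V) * kron U V = 1\<^sub>m (a * b)"
    by (simp add: adj_kron kron_mult diagdD(2)[OF assms(1)] diagdD(2)[OF assms(2)] kron_one)
  moreover have "kron U V \<in> carrier_mat (a * b) (a * b)" by (intro carrier_matI) simp_all
  ultimately show ?thesis by (simp add: diagd_def kron_rdiag mult_assoc_dim)
qed

lemma kron_psd:
  assumes "psd a X" "psd b Y" shows "psd (a * b) (kron X Y)"
proof -
  obtain U x V y where "diagd a X U x" "diagd b Y V y"
    and "\<And>i. i < a \<Longrightarrow> 0 \<le> x i" "\<And>i. i < b \<Longrightarrow> 0 \<le> y i"
    using psd_diagd[OF assms(1)] psd_diagd[OF assms(2)] by metis
  then show ?thesis
    by (intro diagd_psd[OF kron_diagd]) (auto simp: div_mod_less)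
qed

lemma mat_trace_kron:
  assumes "X \<in> carrier_mat a a" "Y \<in> carrier_mat b b"
  shows "mat_trace (kron X Y) = mat_trace X * mat_trace Y"
proof -
  have "mat_trace (kron X Y) = (\<Sum>i<a. \<Sum>k<b. X $$ (i, i) * Y $$ (k, k))"
    using assms unfolding mat_trace_def dim_kron
    by (simp add: sum_mult_split index_kron mult_add_less)
  then show ?thesis using assms by (simp add: mat_trace_def sum_product)
qed

lemma kron_density:
  "X \<in> density_ops a \<Longrightarrow> Y \<in> density_ops b \<Longrightarrow> kron X Y \<in> density_ops (a * b)"
  using mat_trace_kron[of X a Y b] by (simp add: density_ops_def kron_psd psd_carrier)

lemma kron_assoc: "kron (kron A B) C = kron A (kron B C)"
proof (rule eq_matI)
  fix i j assume "i < dim_row (kron A (kron B C))" "j < dim_col (kron A (kron B C))"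
  then have ij: "i < dim_row A * dim_row B * dim_row C" "j < dim_col A * dim_col B * dim_col C"
    by (simp_all add: mult.assoc)
  have dm: "k div c div b = k div (b * c)" "k div c mod b = k mod (b * c) div c" "k mod (b * c) mod c = k mod c"
    for k b c :: nat
  proof -
    show "k div c div b = k div (b * c)" by (metis div_mult2_eq mult.commute)
    show "k div c mod b = k mod (b * c) div c"
      unfolding mult.commute[of b c] by (cases "c = 0") (simp_all add: mod_mult2_eq)
    show "k mod (b * c) mod c = k mod c" by (rule mod_mod_cancel) simp
  qed
  have lt: "k mod (b * c) < b * c" "k < a * (b * c)" "k div c < a * b" if "k < a * b * c" for k a b c :: nat
    using that div_mod_less(1)[OF that] div_mod_less(2)[of k a "b * c"] by (simp_all add: mult.assoc)
  show "kron (kron A B) C $$ (i, j) = kron A (kron B C) $$ (i, j)"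
    using ij by (simp only: index_kron dim_kron lt dm mult.assoc[where 'a = complex])
qed (simp_all add: mult.assoc)

text \<open>Meant for powers, which are multiplicative on the nonnegative reals including 0; this
  makes \<open>sandw\<close> multiplicative.\<close>

lemma herm_fun_kron:
  assumes "psd a X" "psd b Y" and f: "\<And>s t. 0 \<le> s \<Longrightarrow> 0 \<le> t \<Longrightarrow> f (s * t) = f s * f t"
  shows "herm_fun f (kron X Y) = kron (herm_fun f X) (herm_fun f Y)"
proof -
  obtain U x V y where U: "diagd a X U x" and V: "diagd b Y V y"
    and xy: "\<And>i. i < a \<Longrightarrow> 0 \<le> x i" "\<And>i. i < b \<Longrightarrow> 0 \<le> y i"
    using psd_diagd[OF assms(1)] psd_diagd[OF assms(2)] by metis
  note K = kron_diagd[OF U V]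
  have "herm_fun f (kron X Y) = kron U V * (rdiag (a * b) (\<lambda>i. f (x (i div b)) * f (y (i mod b))) * adj (kron U V))"
  proof -
    have eq: "f (x (i div b) * y (i mod b)) = f (x (i div b)) * f (y (i mod b))" if "i < a * b" for i
      by (intro f xy div_mod_less[OF that])
    have "rdiag (a * b) (\<lambda>i. f (x (i div b) * y (i mod b))) = rdiag (a * b) (\<lambda>i. f (x (i div b)) * f (y (i mod b)))"
      unfolding mat_diag_def by (rule cong_mat) (auto simp: eq)
    then show ?thesis unfolding herm_fun_eq[OF K] by (simp only:)
  qed
  also have "\<dots> = kron (herm_fun f X) (herm_fun f Y)"
    by (rule diagdD(4)[OF kron_diagd[OF diagd_herm_fun[OF U] diagd_herm_fun[OF V]], symmetric])
  finally show ?thesis .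
qed

lemma trpow_kron:
  assumes "psd a X" "psd b Y"
  shows "trpow p (kron X Y) = trpow p X * trpow p Y"
proof -
  obtain U x V y where U: "diagd a X U x" and V: "diagd b Y V y"
    using psd_diagd[OF assms(1)] psd_diagd[OF assms(2)] by metis
  have "trpow p (kron X Y) = Re (mat_trace (herm_fun (\<lambda>x. x powr p) X) * mat_trace (herm_fun (\<lambda>x. x powr p) Y))"
    unfolding trpow_def
    by (subst herm_fun_kron[OF assms])
       (simp_all add: powr_mult mat_trace_kron[OF herm_fun_carrier[OF U] herm_fun_carrier[OF V]])
  then show ?thesis
    unfolding trpow_eq[OF U] trpow_eq[OF V] diagd_trace[OF diagd_herm_fun[OF U]] diagd_trace[OF diagd_herm_fun[OF V]]
    by (simp del: of_real_sum)
qed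

lemma sandw_kron:
  assumes "psd a \<rho>" "psd a \<sigma>" "psd b \<rho>'" "psd b \<sigma>'"
  shows "sandw \<alpha> (kron \<rho> \<rho>') (kron \<sigma> \<sigma>') = sandw \<alpha> \<rho> \<sigma> * sandw \<alpha> \<rho>' \<sigma>'"
proof -
  obtain F q F' q' where F: "diagd a \<sigma> F q" "diagd b \<sigma>' F' q'"
    using psd_diagd[OF assms(2)] psd_diagd[OF assms(4)] by metis
  let ?f = "\<lambda>x :: real. x powr ((1 - \<alpha>) / (2 * \<alpha>))"
  note [simp] = diagdD(8,9)[OF diagd_herm_fun[OF F(1)]] diagdD(8,9)[OF diagd_herm_fun[OF F(2)]]
    carrier_matD[OF psd_carrier[OF assms(1)]] carrier_matD[OF psd_carrier[OF assms(3)]]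
  have "herm_fun ?f (kron \<sigma> \<sigma>') = kron (herm_fun ?f \<sigma>) (herm_fun ?f \<sigma>')"
    by (rule herm_fun_kron[OF assms(2,4)]) (simp add: powr_mult)
  then show ?thesis
    by (simp add: sandw_def Let_def kron_mult
        trpow_kron[OF sandwich_psd[OF assms(1) F(1)] sandwich_psd[OF assms(3) F(2)]])
qed

section \<open>Superoperators\<close>

text \<open>The linear part of \<open>channel\<close>, isolated since it also covers maps such as Y
  \<mapsto> F(X \<otimes> Y) with a fixed X, which need not preserve the trace.\<close>

definition superop :: "nat \<Rightarrow> nat \<Rightarrow> (complex mat \<Rightarrow> complex mat) \<Rightarrow> bool" where
  "superop a b F \<longleftrightarrow> (\<forall>X \<in> carrier_mat a a. F X \<in> carrier_mat b b) \<and>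
     (\<forall>X \<in> carrier_mat a a. \<forall>Y \<in> carrier_mat a a. F (X + Y) = F X + F Y) \<and>
     (\<forall>c. \<forall>X \<in> carrier_mat a a. F (c \<cdot>\<^sub>m X) = c \<cdot>\<^sub>m F X)"

lemma superopD:
  assumes "superop a b F" "X \<in> carrier_mat a a"
  shows "F X \<in> carrier_mat b b" "Y \<in> carrier_mat a a \<Longrightarrow> F (X + Y) = F X + F Y"
    "F (c \<cdot>\<^sub>m X) = c \<cdot>\<^sub>m F X"
  using assms by (auto simp: superop_def)

lemma mat_unit_carrier [simp]: "mat_unit a i j \<in> carrier_mat a a"
  "dim_row (mat_unit a i j) = a" "dim_col (mat_unit a i j) = a"
  by (simp_all add: mat_unit_def)

lemma index_mat_unit: "k < a \<Longrightarrow> l < a \<Longrightarrow> mat_unit a i j $$ (k, l) = (if k = i \<and> l = j then 1 else 0)"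
  by (simp add: mat_unit_def)

lemma superop_expand:
  assumes F: "superop a b F" and X: "X \<in> carrier_mat a a" and rs: "r < b" "s < b"
  shows "F X $$ (r, s) = (\<Sum>i<a. \<Sum>j<a. X $$ (i, j) * F (mat_unit a i j) $$ (r, s))"
proof -
  \<comment> \<open>Induction on the set of retained entries: inserting one entry adds one multiple
    of a matrix unit.\<close>
  define Z where "Z S = mat a a (\<lambda>(i, j). if (i, j) \<in> S then X $$ (i, j) else 0)" for S
  have Zc: "Z S \<in> carrier_mat a a" for S by (simp add: Z_def)
  have "F (Z S) $$ (r, s) = (\<Sum>(i, j)\<in>S. X $$ (i, j) * F (mat_unit a i j) $$ (r, s))"
    if "finite S" "S \<subseteq> {..<a} \<times> {..<a}" for S
    using that
  proof (induction S rule: finite_induct)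
    case empty
    have "0 \<cdot>\<^sub>m Z {} = Z {}" by (rule eq_matI) (auto simp: Z_def)
    then have "F (Z {}) = 0 \<cdot>\<^sub>m F (Z {})" using superopD(3)[OF F Zc, of 0 "{}"] by simp
    then have "F (Z {}) $$ (r, s) = (0 \<cdot>\<^sub>m F (Z {})) $$ (r, s)" by simp
    also have "\<dots> = 0" using superopD(1)[OF F Zc[of "{}"]] rs by (subst index_smult_mat) auto
    finally show ?case by simp
  next
    case (insert x S)
    obtain i j where x: "x = (i, j)" by (cases x)
    have ij: "i < a" "j < a" using insert.prems x by auto
    have "Z (insert x S) = X $$ (i, j) \<cdot>\<^sub>m mat_unit a i j + Z S"
      by (rule eq_matI) (use insert.hyps x in \<open>auto simp: Z_def index_mat_unit\<close>)
    then have "F (Z (insert x S)) = X $$ (i, j) \<cdot>\<^sub>m F (mat_unit a i j) + F (Z S)"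
      using superopD(2)[OF F _ Zc[of S], of "X $$ (i, j) \<cdot>\<^sub>m mat_unit a i j"]
        superopD(3)[OF F mat_unit_carrier(1)] by (simp add: smult_carrier_mat)
    then show ?case
      using insert.IH insert.hyps insert.prems rs x carrier_matD[OF superopD(1)[OF F Zc[of S]]]
        carrier_matD[OF superopD(1)[OF F mat_unit_carrier(1)[of a i j]]] by simp
  qed
  from this[of "{..<a} \<times> {..<a}"]
  have "F (Z ({..<a} \<times> {..<a})) $$ (r, s) = (\<Sum>i<a. \<Sum>j<a. X $$ (i, j) * F (mat_unit a i j) $$ (r, s))"
    by (simp add: sum.cartesian_product)
  moreover have "Z ({..<a} \<times> {..<a}) = X" by (rule eq_matI) (use X in \<open>auto simp: Z_def\<close>)
  ultimately show ?thesis by simp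
qed

lemma tensor_map_dim [simp]:
  "dim_row (tensor_map a a' b b' F G X) = a' * b'" "dim_col (tensor_map a a' b b' F G X) = a' * b'"
  by (simp_all add: tensor_map_def)

lemma tensor_map_superop: "superop (a * b) (a' * b') (tensor_map a a' b b' F G)"
  unfolding superop_def
proof (intro conjI ballI allI)
  let ?T = "tensor_map a a' b b' F G"
  fix X Y :: "complex mat" and c
  assume X: "X \<in> carrier_mat (a * b) (a * b)"
  show "?T X \<in> carrier_mat (a' * b') (a' * b')" by (rule carrier_matI) simp_all
  show "?T (c \<cdot>\<^sub>m X) = c \<cdot>\<^sub>m ?T X"
  proof (rule eq_matI)
    fix r s assume "r < dim_row (c \<cdot>\<^sub>m ?T X)" "s < dim_col (c \<cdot>\<^sub>m ?T X)"
    then show "?T (c \<cdot>\<^sub>m X) $$ (r, s) = (c \<cdot>\<^sub>m ?T X) $$ (r, s)"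
      using carrier_matD[OF X] by (simp add: tensor_map_def sum_distrib_left mult_add_less mult.assoc)
  qed simp_all
  assume Y: "Y \<in> carrier_mat (a * b) (a * b)"
  show "?T (X + Y) = ?T X + ?T Y"
  proof (rule eq_matI)
    fix r s assume "r < dim_row (?T X + ?T Y)"
      "s < dim_col (?T X + ?T Y)"
    then show "?T (X + Y) $$ (r, s) =
        (?T X + ?T Y) $$ (r, s)"
      using carrier_matD[OF X] carrier_matD[OF Y]
      by (simp add: tensor_map_def sum.distrib mult_add_less distrib_right)
  qed simp_all
qed

lemma tensor_map_kron:
  assumes F: "superop a a' F" and G: "superop b b' G"
    and X: "X \<in> carrier_mat a a" and Y: "Y \<in> carrier_mat b b"
  shows "tensor_map a a' b b' F G (kron X Y) = kron (F X) (G Y)"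
proof (rule eq_matI)
  let ?T = "tensor_map a a' b b' F G"
  note [simp] = carrier_matD[OF superopD(1)[OF F X]] carrier_matD[OF superopD(1)[OF G Y]]
    carrier_matD[OF superopD(1)[OF F mat_unit_carrier(1)]] carrier_matD[OF superopD(1)[OF G mat_unit_carrier(1)]]
    carrier_matD[OF X] carrier_matD[OF Y]
  show "dim_row (?T (kron X Y)) = dim_row (kron (F X) (G Y))"
    "dim_col (?T (kron X Y)) = dim_col (kron (F X) (G Y))" by simp_all
  fix r s assume "r < dim_row (kron (F X) (G Y))" "s < dim_col (kron (F X) (G Y))"
  then have rs: "r < a' * b'" "s < a' * b'" by auto
  note l = div_mod_less[OF rs(1)] div_mod_less[OF rs(2)]
  let ?F = "\<lambda>i j. F (mat_unit a i j) $$ (r div b', s div b')"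
  let ?G = "\<lambda>k l. G (mat_unit b k l) $$ (r mod b', s mod b')"
  have "?T (kron X Y) $$ (r, s) =
      (\<Sum>i<a. \<Sum>j<a. \<Sum>k<b. \<Sum>l<b. (X $$ (i, j) * ?F i j) * (Y $$ (k, l) * ?G k l))"
    using rs by (simp add: tensor_map_def index_kron mult_add_less mult_ac)
  also have "\<dots> = (\<Sum>i<a. \<Sum>j<a. X $$ (i, j) * ?F i j) * (\<Sum>k<b. \<Sum>l<b. Y $$ (k, l) * ?G k l)"
    by (simp only: sum_distrib_right) (simp only: sum_distrib_left)
  also have "\<dots> = F X $$ (r div b', s div b') * G Y $$ (r mod b', s mod b')"
    using superop_expand[OF F X l(1,3)] superop_expand[OF G Y l(2,4)] by simp
  finally show "?T (kron X Y) $$ (r, s) = kron (F X) (G Y) $$ (r, s)"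
    using rs by (simp add: index_kron)
qed

lemma mat_unit_kron:
  assumes "i < a * b" "j < a * b"
  shows "mat_unit (a * b) i j = kron (mat_unit a (i div b) (j div b)) (mat_unit b (i mod b) (j mod b))"
proof (rule eq_matI)
  let ?K = "kron (mat_unit a (i div b) (j div b)) (mat_unit b (i mod b) (j mod b))"
  fix k l assume "k < dim_row (?K)"
    "l < dim_col (?K)"
  then have kl: "k < a * b" "l < a * b" by auto
  have eq: "x = y \<longleftrightarrow> x div b = y div b \<and> x mod b = y mod b" for x y by (metis div_mult_mod_eq)
  show "mat_unit (a * b) i j $$ (k, l) = ?K $$ (k, l)"
    using kl eq[of k i] eq[of l j] by (auto simp: index_kron index_mat_unit div_mod_less)
qed simp_all

text \<open>Product matrices span, because matrix units of the composite system are Kronecker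
  products of matrix units.\<close>

lemma superop_eq_kron:
  assumes F: "superop (a * b) c F" and G: "superop (a * b) c G"
    and eq: "\<And>X Y. X \<in> carrier_mat a a \<Longrightarrow> Y \<in> carrier_mat b b \<Longrightarrow> F (kron X Y) = G (kron X Y)"
    and Z: "Z \<in> carrier_mat (a * b) (a * b)"
  shows "F Z = G Z"
proof (rule eq_matI)
  note [simp] = carrier_matD[OF superopD(1)[OF F Z]] carrier_matD[OF superopD(1)[OF G Z]]
  show "dim_row (F Z) = dim_row (G Z)" "dim_col (F Z) = dim_col (G Z)" by simp_all
  fix r s assume "r < dim_row (G Z)" "s < dim_col (G Z)"
  then have rs: "r < c" "s < c" by auto
  show "F Z $$ (r, s) = G Z $$ (r, s)"
    unfolding superop_expand[OF F Z rs] superop_expand[OF G Z rs]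
    by (intro sum.cong refl) (simp add: mat_unit_kron eq)
qed

lemma superop_mat_trace:
  assumes F: "superop a b F" and X: "X \<in> carrier_mat a a"
  shows "mat_trace (F X) = (\<Sum>i<a. \<Sum>j<a. X $$ (i, j) * mat_trace (F (mat_unit a i j)))"
proof -
  note [simp] = carrier_matD[OF superopD(1)[OF F X]] carrier_matD[OF superopD(1)[OF F mat_unit_carrier(1)]]
  have "mat_trace (F X) = (\<Sum>r<b. \<Sum>i<a. \<Sum>j<a. X $$ (i, j) * F (mat_unit a i j) $$ (r, r))"
    unfolding mat_trace_def by (simp add: superop_expand[OF F X])
  also have "\<dots> = (\<Sum>i<a. \<Sum>r<b. \<Sum>j<a. X $$ (i, j) * F (mat_unit a i j) $$ (r, r))"
    by (rule sum.swap)
  also have "\<dots> = (\<Sum>i<a. \<Sum>j<a. \<Sum>r<b. X $$ (i, j) * F (mat_unit a i j) $$ (r, r))"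
    by (rule sum.cong[OF refl], rule sum.swap)
  finally show ?thesis by (simp add: mat_trace_def sum_distrib_left)
qed

text \<open>\<open>K t r i\<close> is an entry of the Kraus operator \<open>K\<^sub>t\<close> in \<open>F X = \<Sum>\<^sub>t K\<^sub>t X K\<^sub>t\<^sup>*\<close>.\<close>

definition has_kraus :: "nat \<Rightarrow> nat \<Rightarrow> (complex mat \<Rightarrow> complex mat) \<Rightarrow> bool" where
  "has_kraus a b F \<longleftrightarrow> (\<exists>n K. \<forall>i<a. \<forall>j<a. \<forall>r<b. \<forall>s<b.
     F (mat_unit a i j) $$ (r, s) = (\<Sum>t<(n::nat). K t r i * cnj (K t s j)))"

text \<open>Channels in Kraus form: products of Kraus operators show at once that tensor products of
  channels are again positive, whereas complete positivity as stated in \<open>channel\<close>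
  extends one map by an identity only.\<close>

definition qchan :: "nat \<Rightarrow> nat \<Rightarrow> (complex mat \<Rightarrow> complex mat) \<Rightarrow> bool" where
  "qchan a b F \<longleftrightarrow> superop a b F \<and> has_kraus a b F \<and>
     (\<forall>X \<in> carrier_mat a a. mat_trace (F X) = mat_trace X)"

lemma has_kraus_psd:
  assumes F: "superop a b F" "has_kraus a b F" and X: "psd a X"
  shows "psd b (F X)"
  unfolding psd_iff_sum
proof safe
  show "F X \<in> carrier_mat b b" by (rule superopD(1)[OF F(1) psd_carrier[OF X]])
  fix w :: "nat \<Rightarrow> complex"
  obtain n K where K: "\<And>i j r s. i < a \<Longrightarrow> j < a \<Longrightarrow> r < b \<Longrightarrow> s < b \<Longrightarrow>
      F (mat_unit a i j) $$ (r, s) = (\<Sum>t<(n::nat). K t r i * cnj (K t s j))"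
    using F(2) unfolding has_kraus_def by blast
  let ?k = "\<lambda>i j r s t. X $$ (i, j) * (K t r i * cnj (w r) * (cnj (K t s j) * w s))"
  \<comment> \<open>These are the entries of the vector obtained by applying the adjoint of K_t to
    w; the form of \<open>F X\<close> at w is the sum over t of the form of \<open>X\<close> at
    these vectors.\<close>
  define u where "u t i = (\<Sum>r<b. cnj (K t r i) * w r)" for t i
  have "(\<Sum>r<b. \<Sum>s<b. F X $$ (r, s) * w s * cnj (w r)) =
    (\<Sum>r<b. \<Sum>s<b. \<Sum>i<a. \<Sum>j<a. \<Sum>t<n. ?k i j r s t)"
  proof (intro sum.cong refl)
    fix r s assume rs: "r \<in> {..<b}" "s \<in> {..<b}"
    then have "F X $$ (r, s) = (\<Sum>i<a. \<Sum>j<a. X $$ (i, j) * (\<Sum>t<n. K t r i * cnj (K t s j)))"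
      by (simp add: superop_expand[OF F(1) psd_carrier[OF X]] K)
    then have "F X $$ (r, s) * w s * cnj (w r) =
        (\<Sum>i<a. \<Sum>j<a. \<Sum>t<n. X $$ (i, j) * (K t r i * cnj (K t s j)) * w s * cnj (w r))"
      by (simp only: sum_distrib_left sum_distrib_right)
    also have "\<dots> = (\<Sum>i<a. \<Sum>j<a. \<Sum>t<n. ?k i j r s t)"
      by (intro sum.cong refl) (simp only: mult_ac)
    finally show "F X $$ (r, s) * w s * cnj (w r) =
        (\<Sum>i<a. \<Sum>j<a. \<Sum>t<n. ?k i j r s t)" .
  qed
  also have "\<dots> = (\<Sum>i<a. \<Sum>j<a. \<Sum>r<b. \<Sum>s<b. \<Sum>t<n. ?k i j r s t)"
    by (rule sum_swap4)
  also have "\<dots> = (\<Sum>i<a. \<Sum>j<a. \<Sum>t<n. X $$ (i, j) * u t j * cnj (u t i))"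
  proof (rule sum.cong[OF refl], rule sum.cong[OF refl])
    fix i j
    have "(\<Sum>r<b. \<Sum>s<b. \<Sum>t<n. ?k i j r s t) =
      (\<Sum>r<b. \<Sum>t<n. \<Sum>s<b. ?k i j r s t)"
      by (rule sum.cong[OF refl], rule sum.swap)
    also have "\<dots> = (\<Sum>t<n. \<Sum>r<b. \<Sum>s<b. ?k i j r s t)"
      by (rule sum.swap)
    also have "\<dots> = (\<Sum>t<n. X $$ (i, j) * (cnj (u t i) * u t j))"
      by (simp only: u_def cnj_sum complex_cnj_mult complex_cnj_cnj sum_product)
         (simp only: sum_distrib_left)
    also have "\<dots> = (\<Sum>t<n. X $$ (i, j) * u t j * cnj (u t i))"
      by (intro sum.cong refl) (simp only: mult_ac)
    finally show "(\<Sum>r<b. \<Sum>s<b. \<Sum>t<n. ?k i j r s t) =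
      (\<Sum>t<n. X $$ (i, j) * u t j * cnj (u t i))" .
  qed
  also have "\<dots> = (\<Sum>i<a. \<Sum>t<n. \<Sum>j<a. X $$ (i, j) * u t j * cnj (u t i))"
    by (rule sum.cong[OF refl], rule sum.swap)
  also have "\<dots> = (\<Sum>t<n. \<Sum>i<a. \<Sum>j<a. X $$ (i, j) * u t j * cnj (u t i))"
    by (rule sum.swap)
  also have "0 \<le> \<dots>"
    by (rule sum_nonneg) (use X in \<open>unfold psd_iff_sum, blast\<close>)
  finally show "0 \<le> (\<Sum>r<b. \<Sum>s<b. F X $$ (r, s) * w s * cnj (w r))" .
qed

lemma qchan_density:
  "qchan a b F \<Longrightarrow> \<rho> \<in> density_ops a \<Longrightarrow> F \<rho> \<in> density_ops b"
  using has_kraus_psd[of a b F \<rho>] psd_carrier[of a \<rho>] by (simp add: qchan_def density_ops_def)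

lemma qchan_id: "qchan a a (\<lambda>X. X)"
proof -
  have "has_kraus a a (\<lambda>X. X)"
    unfolding has_kraus_def
    by (rule exI[of _ 1], rule exI[of _ "\<lambda>t r i. if r = i then 1 else 0"]) (auto simp: index_mat_unit)
  then show ?thesis by (simp add: qchan_def superop_def)
qed

lemma qchan_tensor_map:
  assumes "qchan a a' F" "qchan b b' G"
  shows "qchan (a * b) (a' * b') (tensor_map a a' b b' F G)"
proof -
  let ?T = "tensor_map a a' b b' F G"
  have F: "superop a a' F" and G: "superop b b' G" using assms by (simp_all add: qchan_def)
  note T = tensor_map_superop[of a b a' b' F G]
  note [simp] = carrier_matD[OF superopD(1)[OF F mat_unit_carrier(1)]] carrier_matD[OF superopD(1)[OF G mat_unit_carrier(1)]]
  have unit: "?T (mat_unit (a * b) i j) =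
      kron (F (mat_unit a (i div b) (j div b))) (G (mat_unit b (i mod b) (j mod b)))" if "i < a * b" "j < a * b" for i j
    by (simp only: mat_unit_kron[OF that] tensor_map_kron[OF F G mat_unit_carrier(1) mat_unit_carrier(1)])
  have tp: "mat_trace (?T X) = mat_trace X" if X: "X \<in> carrier_mat (a * b) (a * b)" for X
  proof -
    have "mat_trace (?T (mat_unit (a * b) i j)) = mat_trace (mat_unit (a * b) i j)"
      if ij: "i < a * b" "j < a * b" for i j
    proof -
      have "mat_trace (?T (mat_unit (a * b) i j)) =
        mat_trace (mat_unit a (i div b) (j div b)) * mat_trace (mat_unit b (i mod b) (j mod b))"
        using assms unfolding unit[OF ij] qchan_def
        by (simp add: mat_trace_kron[OF superopD(1)[OF F mat_unit_carrier(1)] superopD(1)[OF G mat_unit_carrier(1)]])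
      also have "\<dots> = mat_trace (mat_unit (a * b) i j)"
        by (simp add: mat_unit_kron[OF ij] mat_trace_kron[OF mat_unit_carrier(1) mat_unit_carrier(1)])
      finally show ?thesis .
    qed
    then have "mat_trace (?T X) =
        (\<Sum>i<a * b. \<Sum>j<a * b. X $$ (i, j) * mat_trace (mat_unit (a * b) i j))"
      by (simp add: superop_mat_trace[OF T X])
    also have "\<dots> = mat_trace X"
      using superop_mat_trace[of "a * b" "a * b" "\<lambda>X. X", OF _ X] qchan_id by (simp add: qchan_def)
    finally show ?thesis .
  qed
  have "has_kraus (a * b) (a' * b') (?T)"
  proof -
    obtain n K where K: "\<And>i j r s. i < a \<Longrightarrow> j < a \<Longrightarrow> r < a' \<Longrightarrow> s < a' \<Longrightarrow>
        F (mat_unit a i j) $$ (r, s) = (\<Sum>t<(n::nat). K t r i * cnj (K t s j))"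
      using assms(1) unfolding qchan_def has_kraus_def by blast
    obtain m L where L: "\<And>i j r s. i < b \<Longrightarrow> j < b \<Longrightarrow> r < b' \<Longrightarrow> s < b' \<Longrightarrow>
        G (mat_unit b i j) $$ (r, s) = (\<Sum>t<(m::nat). L t r i * cnj (L t s j))"
      using assms(2) unfolding qchan_def has_kraus_def by blast
    define Q where "Q t r i = K (t div m) (r div b') (i div b) * L (t mod m) (r mod b') (i mod b)" for t r i
    have "?T (mat_unit (a * b) i j) $$ (r, s) = (\<Sum>t<n * m. Q t r i * cnj (Q t s j))"
      if ij: "i < a * b" "j < a * b" and rs: "r < a' * b'" "s < a' * b'" for i j r s
    proof -
      have "(\<Sum>t<n * m. Q t r i * cnj (Q t s j)) =
        (\<Sum>t<n. \<Sum>u<m. (K t (r div b') (i div b) * cnj (K t (s div b') (j div b))) *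
          (L u (r mod b') (i mod b) * cnj (L u (s mod b') (j mod b))))"
        unfolding sum_mult_split by (intro sum.cong refl) (simp add: Q_def mult_ac)
      also have "\<dots> = F (mat_unit a (i div b) (j div b)) $$ (r div b', s div b') *
          G (mat_unit b (i mod b) (j mod b)) $$ (r mod b', s mod b')"
        using div_mod_less[OF ij(1)] div_mod_less[OF ij(2)] div_mod_less[OF rs(1)] div_mod_less[OF rs(2)]
        by (simp only: K L sum_product)
      also have "\<dots> = ?T (mat_unit (a * b) i j) $$ (r, s)"
        using rs by (simp add: unit[OF ij] index_kron)
      finally show ?thesis by (rule sym)
    qed
    then show ?thesis unfolding has_kraus_def by blast
  qed
  with T tp show ?thesis by (simp add: qchan_def)
qed

text \<open>The Kraus operators come from the spectral decomposition of the Choi matrix.\<close>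

lemma channel_qchan:
  assumes N: "channel a b N"
  shows "qchan a b N"
proof -
  have S: "superop a b N" using N by (simp add: channel_def superop_def)
  note [simp] = carrier_matD[OF superopD(1)[OF S mat_unit_carrier(1)]]
  \<comment> \<open>The unnormalized maximally entangled matrix, with entries 1 between index pairs
    of the form (i, i). Its image is the Choi matrix, whose blocks are the values of
    \<open>N\<close> on matrix units.\<close>
  define X where "X = mat (a * a) (a * a) (\<lambda>(p, q). if p div a = p mod a \<and> q div a = q mod a then 1 else 0 :: complex)"
  have "psd (a * a) X"
    unfolding psd_iff_sum
  proof safe
    show "X \<in> carrier_mat (a * a) (a * a)" by (simp add: X_def)
    fix w :: "nat \<Rightarrow> complex"
    define e where "e p = (if p div a = p mod a then 1 else 0 :: complex)" for p
    define u where "u = (\<Sum>p<a * a. e p * w p)"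
    have "(\<Sum>i<a * a. \<Sum>j<a * a. X $$ (i, j) * w j * cnj (w i)) = (\<Sum>i<a * a. \<Sum>j<a * a. (cnj (e i * w i)) * (e j * w j))"
      by (intro sum.cong refl) (simp add: X_def e_def)
    also have "\<dots> = cnj u * u" by (simp only: u_def cnj_sum sum_product)
    also have "0 \<le> \<dots>" by (simp add: less_eq_complex_def)
    finally show "0 \<le> (\<Sum>i<a * a. \<Sum>j<a * a. X $$ (i, j) * w j * cnj (w i))" .
  qed
  define C where "C = tensor_map a a a b (\<lambda>Y. Y) N X"
  have "psd (a * b) C"
    using N \<open>psd (a * a) X\<close> unfolding channel_def C_def by blast
  then obtain U c where U: "diagd (a * b) C U c" and c: "\<And>i. i < a * b \<Longrightarrow> 0 \<le> c i"
    using psd_diagd by blast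
  have C: "N (mat_unit a i j) $$ (r, s) = C $$ (i * b + r, j * b + s)" if "i < a" "j < a" "r < b" "s < b" for i j r s
  proof -
    have lt: "i * b + r < a * b" "j * b + s < a * b" using that by (auto intro: mult_add_less)
    have "C $$ (i * b + r, j * b + s) = (\<Sum>i'<a. \<Sum>j'<a. \<Sum>k<a. \<Sum>l<a.
        X $$ (i' * a + k, j' * a + l) * kron (mat_unit a i' j') (N (mat_unit a k l)) $$ (i * b + r, j * b + s))"
      using lt by (simp add: C_def tensor_map_def)
    also have "\<dots> = (\<Sum>i'<a. \<Sum>j'<a. \<Sum>k<a. \<Sum>l<a.
        if k = i' then if l = j' then if i = i' then if j = j' then N (mat_unit a k l) $$ (r, s) else 0 else 0 else 0 else 0)"
      using lt that by (intro sum.cong refl) (auto simp: X_def index_kron index_mat_unit mult_add_less)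
    also have "\<dots> = N (mat_unit a i j) $$ (r, s)"
    proof -
      have "(\<Sum>k<a. if P then f k else 0) = (if P then \<Sum>k<a. f k else 0)" for P and f :: "nat \<Rightarrow> complex" by simp
      with that(1,2) show ?thesis by simp
    qed
    finally show ?thesis by (rule sym)
  qed
  \<comment> \<open>The t-th eigenvector of the Choi matrix, scaled by the root of its eigenvalue
    and read as a matrix: position i * b + r becomes row r and column i.\<close>
  define K where "K t r i = of_real (sqrt (c t)) * U $$ (i * b + r, t)" for t r i
  have "N (mat_unit a i j) $$ (r, s) = (\<Sum>t<a * b. K t r i * cnj (K t s j))"
    if "i < a" "j < a" "r < b" "s < b" for i j r s
    unfolding C[OF that]
  proof (subst diagd_index[OF U])
    show "i * b + r < a * b" "j * b + s < a * b" using that by (auto intro: mult_add_less)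
    show "(\<Sum>t<a * b. of_real (c t) * U $$ (i * b + r, t) * cnj (U $$ (j * b + s, t))) = (\<Sum>t<a * b. K t r i * cnj (K t s j))"
    proof (intro sum.cong refl)
      fix t assume "t \<in> {..<a * b}"
      then have "complex_of_real (sqrt (c t)) * complex_of_real (sqrt (c t)) = of_real (c t)"
        using c[of t] by (simp flip: of_real_mult)
      then show "of_real (c t) * U $$ (i * b + r, t) * cnj (U $$ (j * b + s, t)) = K t r i * cnj (K t s j)"
        by (simp add: K_def mult_ac)
    qed
  qed
  then have "has_kraus a b N" unfolding has_kraus_def by blast
  with S N show ?thesis by (simp add: qchan_def channel_def)
qed

lemma qchan_tensor_pow:
  assumes "qchan a b N"
  shows "qchan (a ^ n) (b ^ n) (tensor_pow a b N n)"
proof (induction n)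
  case 0
  show ?case using qchan_id[of 1] by simp
next
  case (Suc n)
  show ?case using qchan_tensor_map[OF Suc assms] by (simp add: mult.commute)
qed

section \<open>Tensor powers on product inputs\<close>

lemma kron_add_right:
  "Y \<in> carrier_mat c c \<Longrightarrow> Z \<in> carrier_mat c c \<Longrightarrow> kron X (Y + Z) = kron X Y + kron X Z"
  by (rule eq_matI) (auto simp: index_kron div_mod_less distrib_left)

lemma kron_smult_right: "kron X (k \<cdot>\<^sub>m Y) = k \<cdot>\<^sub>m kron X Y"
  by (rule eq_matI) (auto simp: index_kron div_mod_less)

lemma kron_scalar_right:
  assumes "Y \<in> carrier_mat 1 1" shows "kron X Y = Y $$ (0, 0) \<cdot>\<^sub>m X"
  by (rule eq_matI) (use carrier_matD[OF assms] in \<open>auto simp: index_kron\<close>)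

lemma superop_kron_left:
  assumes "superop (c * a) e F" "X \<in> carrier_mat c c"
  shows "superop a e (\<lambda>Y. F (kron X Y))"
  unfolding superop_def
proof (intro conjI ballI allI)
  fix Y :: "complex mat" assume Y: "Y \<in> carrier_mat a a"
  note XY = kron_carrier[OF assms(2) Y]
  show "F (kron X Y) \<in> carrier_mat e e" by (rule superopD(1)[OF assms(1) XY])
  show "F (kron X (k \<cdot>\<^sub>m Y)) = k \<cdot>\<^sub>m F (kron X Y)" for k
    unfolding kron_smult_right by (rule superopD(3)[OF assms(1) XY])
  fix Z :: "complex mat" assume Z: "Z \<in> carrier_mat a a"
  show "F (kron X (Y + Z)) = F (kron X Y) + F (kron X Z)"
    unfolding kron_add_right[OF Y Z] by (rule superopD(2)[OF assms(1) XY kron_carrier[OF assms(2) Z]])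
qed

lemma superop_kron_right:
  assumes "superop a b F" "X \<in> carrier_mat c c"
  shows "superop a (c * b) (\<lambda>Y. kron X (F Y))"
  unfolding superop_def
proof (intro conjI ballI allI)
  fix Y :: "complex mat" assume Y: "Y \<in> carrier_mat a a"
  note FY = superopD(1)[OF assms(1) Y]
  show "kron X (F Y) \<in> carrier_mat (c * b) (c * b)" by (rule kron_carrier[OF assms(2) FY])
  show "kron X (F (k \<cdot>\<^sub>m Y)) = k \<cdot>\<^sub>m kron X (F Y)" for k
    by (simp add: superopD(3)[OF assms(1) Y] kron_smult_right)
  fix Z :: "complex mat" assume Z: "Z \<in> carrier_mat a a"
  show "kron X (F (Y + Z)) = kron X (F Y) + kron X (F Z)"
    by (simp add: superopD(2)[OF assms(1) Y Z] kron_add_right[OF FY superopD(1)[OF assms(1) Z]])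
qed

text \<open>\<open>tensor_pow\<close> appends factors on the right, so the induction removes the
  last factor of \<open>Y\<close>. By \<open>superop_eq_kron\<close> it is enough to treat
  \<open>Y = kron V W\<close>, where associativity of \<open>kron\<close> isolates
  \<open>W\<close>.\<close>

lemma tensor_pow_add:
  assumes N: "superop a b N" and TN: "\<And>n. superop (a ^ n) (b ^ n) (tensor_pow a b N n)"
    and X: "X \<in> carrier_mat (a ^ m) (a ^ m)"
  shows "Y \<in> carrier_mat (a ^ n) (a ^ n) \<Longrightarrow>
    tensor_pow a b N (m + n) (kron X Y) = kron (tensor_pow a b N m X) (tensor_pow a b N n Y)"
proof (induction n arbitrary: Y)
  case 0
  then have "Y \<in> carrier_mat 1 1" by simp
  then show ?case by (simp add: kron_scalar_right superopD(3)[OF TN X])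
next
  case (Suc n)
  let ?T = "tensor_pow a b N"
  have "superop (a ^ m * a ^ Suc n) (b ^ m * b ^ Suc n) (?T (m + Suc n))"
    using TN[of "m + Suc n"] by (simp only: power_add)
  from superop_kron_left[OF this X]
  have L: "superop (a ^ n * a) (b ^ m * b ^ Suc n) (\<lambda>Y. ?T (m + Suc n) (kron X Y))"
    by (simp only: power_Suc2)
  from superop_kron_right[OF TN[of "Suc n"] superopD(1)[OF TN X]]
  have R: "superop (a ^ n * a) (b ^ m * b ^ Suc n) (\<lambda>Y. kron (?T m X) (?T (Suc n) Y))"
    by (simp only: power_Suc2)
  have Y: "Y \<in> carrier_mat (a ^ n * a) (a ^ n * a)" using Suc.prems by (simp only: power_Suc2)
  show ?case
  proof (rule superop_eq_kron[OF L R _ Y])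
    fix V W :: "complex mat" assume V: "V \<in> carrier_mat (a ^ n) (a ^ n)" and W: "W \<in> carrier_mat a a"
    have XV: "kron X V \<in> carrier_mat (a ^ (m + n)) (a ^ (m + n))"
      unfolding power_add by (rule kron_carrier[OF X V])
    have "?T (m + Suc n) (kron X (kron V W)) = tensor_map (a ^ (m + n)) (b ^ (m + n)) a b (?T (m + n)) N (kron (kron X V) W)"
      by (simp add: kron_assoc)
    also have "\<dots> = kron (?T (m + n) (kron X V)) (N W)" by (rule tensor_map_kron[OF TN N XV W])
    also have "\<dots> = kron (?T m X) (kron (?T n V) (N W))" by (simp add: Suc.IH[OF V] kron_assoc)
    also have "kron (?T n V) (N W) = ?T (Suc n) (kron V W)" by (simp add: tensor_map_kron[OF TN N V W])
    finally show "?T (m + Suc n) (kron X (kron V W)) = kron (?T m X) (?T (Suc n) (kron V W))" .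
  qed
qed

section \<open>Strategies\<close>

lemma mat_trace_adj: "X \<in> carrier_mat d d \<Longrightarrow> mat_trace (adj X) = cnj (mat_trace X)"
  by (auto simp: mat_trace_def)

text \<open>The errors are real parts of traces; only because these traces are real does the real
  part of a product of them factor.\<close>

lemma mat_trace_mult_real:
  assumes "psd d X" "psd d Y" shows "mat_trace (X * Y) = of_real (Re (mat_trace (X * Y)))"
proof -
  note c = psd_carrier[OF assms(1)] psd_carrier[OF assms(2)]
  have "cnj (mat_trace (X * Y)) = mat_trace (adj (X * Y))"
    by (rule mat_trace_adj[symmetric, OF mult_carrier_mat[OF c]])
  also have "adj (X * Y) = Y * X"
    using c by (simp add: adj_mult psd_hermitian[OF assms(1)] psd_hermitian[OF assms(2)])
  also have "mat_trace (Y * X) = mat_trace (X * Y)" by (rule mat_trace_mult_comm) (use c in auto)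
  finally show ?thesis by (auto simp: complex_eq_iff)
qed

lemma test_diagd:
  assumes "psd d T" "psd d (1\<^sub>m d - T)"
  obtains U t where "diagd d T U t" "\<And>i. i < d \<Longrightarrow> 0 \<le> t i \<and> t i \<le> 1"
proof -
  obtain U t where U: "diagd d T U t" and t: "\<And>i. i < d \<Longrightarrow> 0 \<le> t i" using psd_diagd[OF assms(1)] by blast
  have D: "diagd d (1\<^sub>m d - T) U (\<lambda>i. 1 - t i)" by (rule diagd_diff[OF diagd_one[OF diagdD(1,2)[OF U]] U])
  have "t i \<le> 1" if "i < d" for i
  proof -
    have "psd d (rdiag d (\<lambda>i. 1 - t i))"
      using psd_conj[OF assms(2) diagdD(1)[OF U]] unfolding diagd_conj(1)[OF D] .
    from psd_diagonal_nonneg[OF this that] that show ?thesis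
      by (simp add: index_rdiag less_eq_complex_def del: of_real_diff)
  qed
  with U t that show ?thesis by blast
qed

lemma test_kron:
  assumes "psd a T" "psd a (1\<^sub>m a - T)" "psd b T'" "psd b (1\<^sub>m b - T')"
  shows "psd (a * b) (kron T T')" "psd (a * b) (1\<^sub>m (a * b) - kron T T')"
proof -
  obtain U t where U: "diagd a T U t" "\<And>i. i < a \<Longrightarrow> 0 \<le> t i \<and> t i \<le> 1" using test_diagd[OF assms(1,2)] by blast
  obtain V s where V: "diagd b T' V s" "\<And>i. i < b \<Longrightarrow> 0 \<le> s i \<and> s i \<le> 1" using test_diagd[OF assms(3,4)] by blast
  have "0 \<le> t (i div b) * s (i mod b) \<and> t (i div b) * s (i mod b) \<le> 1" if "i < a * b" for i
    using U(2)[OF div_mod_less(1)[OF that]] V(2)[OF div_mod_less(2)[OF that]] by (simp add: mult_le_one)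
  from diagd_test[OF kron_diagd[OF U(1) V(1)] this]
  show "psd (a * b) (kron T T')" "psd (a * b) (1\<^sub>m (a * b) - kron T T')" by auto
qed

lemma density_opsD:
  assumes "\<rho> \<in> density_ops d" shows "psd d \<rho>" "mat_trace \<rho> = 1" "\<rho> \<in> carrier_mat d d"
  using assms psd_carrier by (auto simp: density_ops_def)

lemma density_ops_nonempty:
  assumes "0 < d" obtains \<rho> where "\<rho> \<in> density_ops d"
proof -
  let ?f = "\<lambda>i. if i = (0::nat) then 1 else (0::real)"
  have D: "diagd d (rdiag d ?f) (1\<^sub>m d) ?f"
    by (simp add: diagd_def)
  have "rdiag d ?f \<in> density_ops d"
    using diagd_psd[OF D] diagd_trace[OF D] assms by (simp add: density_ops_def)
  then show ?thesis by (rule that)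
qed

lemma eventually_real_ge: "\<forall>\<^sub>F n in sequentially. x \<le> real n"
  by (rule eventually_sequentiallyI[of "nat \<lceil>x\<rceil>"]) linarith

section \<open>Strategies for a fixed pair of channels\<close>

context
  fixes a b N M
  assumes N: "qchan a b N" and M: "qchan a b M"
begin

text \<open>The success probability s replaces the Type-I error because both s and \<beta> multiply
  when strategies are run side by side.\<close>

definition attains :: "nat \<Rightarrow> real \<Rightarrow> real \<Rightarrow> bool" where
  "attains n s \<beta> \<longleftrightarrow> (\<exists>\<psi> T. strategy a b n \<psi> T \<and>
     1 - type_I_error a b N n \<psi> T = s \<and> type_II_error a b M n \<psi> T = \<beta>)"

abbreviation "\<N> n \<equiv> tensor_pow a b N n"
abbreviation "\<M> n \<equiv> tensor_pow a b M n"

lemma pow_density: "\<psi> \<in> density_ops (a ^ n) \<Longrightarrow> \<N> n \<psi> \<in> density_ops (b ^ n)"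
  "\<psi> \<in> density_ops (a ^ n) \<Longrightarrow> \<M> n \<psi> \<in> density_ops (b ^ n)"
  using qchan_density[OF qchan_tensor_pow[OF N]] qchan_density[OF qchan_tensor_pow[OF M]] by auto

lemma pow_kron:
  assumes "X \<in> carrier_mat (a ^ m) (a ^ m)" "Y \<in> carrier_mat (a ^ n) (a ^ n)"
  shows "\<N> (m + n) (kron X Y) = kron (\<N> m X) (\<N> n Y)"
    "\<M> (m + n) (kron X Y) = kron (\<M> m X) (\<M> n Y)"
  by (rule tensor_pow_add[OF _ _ assms];
      use N M qchan_tensor_pow[OF N] qchan_tensor_pow[OF M] in \<open>simp add: qchan_def\<close>)+

lemma one_minus_type_I:
  assumes "strategy a b n \<psi> T"
  shows "1 - type_I_error a b N n \<psi> T = Re (mat_trace (T * \<N> n \<psi>))"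
proof -
  from assms have T: "T \<in> carrier_mat (b ^ n) (b ^ n)" by (simp add: strategy_def psd_carrier)
  have "\<N> n \<psi> \<in> density_ops (b ^ n)" using assms pow_density by (simp add: strategy_def)
  note X = density_opsD[OF this]
  have "(1\<^sub>m (b ^ n) - T) * \<N> n \<psi> = \<N> n \<psi> - T * \<N> n \<psi>"
    by (subst minus_mult_distrib_mat[OF one_carrier_mat T X(3)]) (simp add: left_mult_one_mat[OF X(3)])
  then show ?thesis
    using mat_trace_diff[OF X(3) mult_carrier_mat[OF T X(3)]] X(2) by (simp add: type_I_error_def)
qed

lemma attains_alt:
  "attains n s \<beta> \<longleftrightarrow> (\<exists>\<psi> T. strategy a b n \<psi> T \<and>
     Re (mat_trace (T * \<N> n \<psi>)) = s \<and> Re (mat_trace (T * \<M> n \<psi>)) = \<beta>)"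
  unfolding attains_def type_II_error_def by (metis one_minus_type_I)

lemma attains_bounds:
  assumes "attains n s \<beta>" shows "0 \<le> s" "s \<le> 1" "0 \<le> \<beta>"
proof -
  obtain \<psi> T where T: "strategy a b n \<psi> T" and
    s: "Re (mat_trace (T * \<N> n \<psi>)) = s" "Re (mat_trace (T * \<M> n \<psi>)) = \<beta>"
    using assms unfolding attains_alt by blast
  from T have \<psi>: "\<psi> \<in> density_ops (a ^ n)" and T: "psd (b ^ n) T" "psd (b ^ n) (1\<^sub>m (b ^ n) - T)"
    by (simp_all add: strategy_def)
  note X = density_opsD[OF pow_density(1)[OF \<psi>]]
  note Y = density_opsD[OF pow_density(2)[OF \<psi>]]
  show "0 \<le> s" unfolding s[symmetric] by (rule mat_trace_mult_nonneg[OF T(1) X(1)])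
  show "0 \<le> \<beta>" unfolding s[symmetric] by (rule mat_trace_mult_nonneg[OF T(1) Y(1)])
  have "mat_trace (T * \<N> n \<psi>) = mat_trace (\<N> n \<psi> * T)"
    by (rule mat_trace_mult_comm) (use psd_carrier[OF T(1)] X(3) in auto)
  with mat_trace_mult_mono[OF X(1) T(2) psd_carrier[OF T(1)] one_carrier_mat] s(1) X(2)
  show "s \<le> 1" by (simp add: right_mult_one_mat[OF X(3)])
qed

lemma attains_mult:
  assumes "attains m s \<beta>" "attains n s' \<beta>'"
  shows "attains (m + n) (s * s') (\<beta> * \<beta>')"
proof -
  obtain \<psi> T where T: "strategy a b m \<psi> T" and
    s: "Re (mat_trace (T * \<N> m \<psi>)) = s" "Re (mat_trace (T * \<M> m \<psi>)) = \<beta>"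
    using assms(1) unfolding attains_alt by blast
  obtain \<phi> S where S: "strategy a b n \<phi> S" and
    s': "Re (mat_trace (S * \<N> n \<phi>)) = s'" "Re (mat_trace (S * \<M> n \<phi>)) = \<beta>'"
    using assms(2) unfolding attains_alt by blast
  from T have \<psi>: "\<psi> \<in> density_ops (a ^ m)" and T: "psd (b ^ m) T" "psd (b ^ m) (1\<^sub>m (b ^ m) - T)"
    by (simp_all add: strategy_def)
  from S have \<phi>: "\<phi> \<in> density_ops (a ^ n)" and S: "psd (b ^ n) S" "psd (b ^ n) (1\<^sub>m (b ^ n) - S)"
    by (simp_all add: strategy_def)
  have strat: "strategy a b (m + n) (kron \<psi> \<phi>) (kron T S)"
    using kron_density[OF \<psi> \<phi>] test_kron[OF T S] by (simp add: strategy_def power_add)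
  have tr: "Re (mat_trace (kron T S * kron X Y)) = Re (mat_trace (T * X)) * Re (mat_trace (S * Y))"
    if X: "psd (b ^ m) X" and Y: "psd (b ^ n) Y" for X Y
  proof -
    note c = psd_carrier[OF T(1)] psd_carrier[OF S(1)] psd_carrier[OF X] psd_carrier[OF Y]
    have "kron T S * kron X Y = kron (T * X) (S * Y)"
      using c by (simp add: kron_mult)
    then have "mat_trace (kron T S * kron X Y) = mat_trace (T * X) * mat_trace (S * Y)"
      using mat_trace_kron[OF mult_carrier_mat[OF c(1,3)] mult_carrier_mat[OF c(2,4)]] by simp
    then show ?thesis
      using mat_trace_mult_real[OF T(1) X] mat_trace_mult_real[OF S(1) Y] by (metis Re_complex_of_real of_real_mult)
  qed
  note D = density_opsD(1)[OF pow_density(1)[OF \<psi>]] density_opsD(1)[OF pow_density(1)[OF \<phi>]]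
    density_opsD(1)[OF pow_density(2)[OF \<psi>]] density_opsD(1)[OF pow_density(2)[OF \<phi>]]
  note K = pow_kron[OF density_opsD(3)[OF \<psi>] density_opsD(3)[OF \<phi>]]
  show ?thesis
    unfolding attains_alt
    by (rule exI[of _ "kron \<psi> \<phi>"], rule exI[of _ "kron T S"])
      (simp only: strat K tr[OF D(1,2)] tr[OF D(3,4)] s s')
qed

lemma attains_trivial:
  assumes "0 < a" shows "attains n 1 1"
proof -
  obtain \<psi> where \<psi>: "\<psi> \<in> density_ops (a ^ n)" using density_ops_nonempty[of "a ^ n"] assms by auto
  note X = density_opsD[OF pow_density(1)[OF \<psi>]]
  note Y = density_opsD[OF pow_density(2)[OF \<psi>]]
  have "psd (b ^ n) (1\<^sub>m (b ^ n) - 1\<^sub>m (b ^ n))"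
    by (rule diagd_test(2)[OF diagd_one[of "1\<^sub>m (b ^ n)"]]) simp_all
  then have "strategy a b n \<psi> (1\<^sub>m (b ^ n))" using \<psi> psd_one by (simp add: strategy_def)
  then show ?thesis
    unfolding attains_alt using X Y
    by (intro exI[of _ \<psi>] exI[of _ "1\<^sub>m (b ^ n)"]) (simp add: left_mult_one_mat[OF X(3)] left_mult_one_mat[OF Y(3)])
qed

lemma attains_power:
  assumes "0 < a" "attains m s \<beta>"
  shows "attains (m * j) (s ^ j) (\<beta> ^ j)"
proof (induction j)
  case 0
  show ?case using attains_trivial[OF assms(1), of 0] by simp
next
  case (Suc j)
  from attains_mult[OF assms(2) this] show ?case by simp
qed

text \<open>Besides the sandwiched quantity, C bounds the nonzero spectrum of the alternative from
  below. Under tensor products Q multiplies and C adds up, so the number of dyadic levels grows only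
  linearly with the number of copies.\<close>

definition sandw_pair :: "real \<Rightarrow> nat \<Rightarrow> real \<Rightarrow> nat \<Rightarrow> bool" where
  "sandw_pair \<alpha> n Q C \<longleftrightarrow> (\<exists>\<rho> \<in> density_ops (a ^ n).
     sandw \<alpha> (\<N> n \<rho>) (\<M> n \<rho>) = Q \<and>
     (\<exists>F q. diagd (b ^ n) (\<M> n \<rho>) F q \<and> (\<forall>i < b ^ n. 0 \<le> q i) \<and>
       (\<forall>i < b ^ n. 0 < q i \<longrightarrow> 2 powr (- real C) \<le> q i)))"

lemma sandw_pair_mult:
  assumes "sandw_pair \<alpha> m Q C" "sandw_pair \<alpha> n Q' C'"
  shows "sandw_pair \<alpha> (m + n) (Q * Q') (C + C')"
proof -
  obtain \<rho> F q where \<rho>: "\<rho> \<in> density_ops (a ^ m)"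
    "sandw \<alpha> (\<N> m \<rho>) (\<M> m \<rho>) = Q"
    and F: "diagd (b ^ m) (\<M> m \<rho>) F q"
    and q: "\<And>i. i < b ^ m \<Longrightarrow> 0 \<le> q i" "\<And>i. i < b ^ m \<Longrightarrow> 0 < q i \<Longrightarrow> 2 powr (- real C) \<le> q i"
    using assms(1) unfolding sandw_pair_def by blast
  obtain \<phi> G r where \<phi>: "\<phi> \<in> density_ops (a ^ n)"
    "sandw \<alpha> (\<N> n \<phi>) (\<M> n \<phi>) = Q'"
    and G: "diagd (b ^ n) (\<M> n \<phi>) G r"
    and r: "\<And>i. i < b ^ n \<Longrightarrow> 0 \<le> r i" "\<And>i. i < b ^ n \<Longrightarrow> 0 < r i \<Longrightarrow> 2 powr (- real C') \<le> r i"
    using assms(2) unfolding sandw_pair_def by blast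
  note D = density_opsD(1)[OF pow_density(1)[OF \<rho>(1)]] density_opsD(1)[OF pow_density(2)[OF \<rho>(1)]]
    density_opsD(1)[OF pow_density(1)[OF \<phi>(1)]] density_opsD(1)[OF pow_density(2)[OF \<phi>(1)]]
  note K = pow_kron[OF density_opsD(3)[OF \<rho>(1)] density_opsD(3)[OF \<phi>(1)]]
  let ?q = "\<lambda>i. q (i div b ^ n) * r (i mod b ^ n)"
  have "2 powr (- real (C + C')) \<le> ?q i"
    if i: "i < b ^ m * b ^ n" and pos: "0 < ?q i" for i
  proof -
    note l = div_mod_less[OF i]
    have "0 < q (i div b ^ n)" "0 < r (i mod b ^ n)"
      using pos q(1)[OF l(1)] r(1)[OF l(2)] by (auto simp: zero_less_mult_iff)
    then have "2 powr (- real C) * 2 powr (- real C') \<le> ?q i"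
      using q(2)[OF l(1)] r(2)[OF l(2)] by (intro mult_mono) auto
    then show ?thesis by (simp add: powr_add[symmetric])
  qed
  moreover have "0 \<le> ?q i" if i: "i < b ^ m * b ^ n" for i
    using q(1)[OF div_mod_less(1)[OF i]] r(1)[OF div_mod_less(2)[OF i]] by simp
  moreover have "sandw \<alpha> (\<N> (m + n) (kron \<rho> \<phi>)) (\<M> (m + n) (kron \<rho> \<phi>)) = Q * Q'"
    unfolding K sandw_kron[OF D] \<rho>(2) \<phi>(2) ..
  moreover have "kron \<rho> \<phi> \<in> density_ops (a ^ (m + n))"
    unfolding power_add by (rule kron_density[OF \<rho>(1) \<phi>(1)])
  moreover have "diagd (b ^ (m + n)) (\<M> (m + n) (kron \<rho> \<phi>)) (kron F G) ?q"
    unfolding K power_add by (rule kron_diagd[OF F G])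
  ultimately show ?thesis unfolding sandw_pair_def power_add by blast
qed

lemma sandw_pair_power:
  assumes "sandw_pair \<alpha> n Q C" shows "sandw_pair \<alpha> (n * Suc k) (Q ^ Suc k) (C * Suc k)"
proof (induction k)
  case (Suc k)
  from sandw_pair_mult[OF assms this] show ?case by simp
qed (use assms in simp)

lemma sandw_pair_exists:
  assumes "\<rho> \<in> density_ops (a ^ n)"
  obtains C where "sandw_pair \<alpha> n (sandw \<alpha> (\<N> n \<rho>) (\<M> n \<rho>)) C"
proof -
  obtain F q where F: "diagd (b ^ n) (\<M> n \<rho>) F q" "\<And>i. i < b ^ n \<Longrightarrow> 0 \<le> q i"
    using psd_diagd[OF density_opsD(1)[OF pow_density(2)[OF assms]]] by blast
  define c where "c i = nat \<lceil>- log 2 (q i)\<rceil>" for i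
  define C where "C = (\<Sum>i<b ^ n. c i)"
  have "2 powr (- real C) \<le> q i" if "i < b ^ n" "0 < q i" for i
  proof -
    have "c i \<le> C" unfolding C_def using that by (intro member_le_sum) auto
    moreover have "- log 2 (q i) \<le> real (c i)" unfolding c_def by linarith
    ultimately have "- real C \<le> log 2 (q i)" by linarith
    then show ?thesis using that by (simp add: le_log_iff)
  qed
  with F assms have "sandw_pair \<alpha> n (sandw \<alpha> (\<N> n \<rho>) (\<M> n \<rho>)) C"
    unfolding sandw_pair_def by blast
  then show ?thesis by (rule that)
qed

text \<open>For m = n (k + 1) uses, Q exceeds 2^((\<alpha>-1) m L), while
  \<open>one_shot_test\<close> with A = m R asks for 2^((\<alpha>-1) m R) up to a factor polynomial
  in k. The gap between L and R wins for large k.\<close>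

lemma block_strategy:
  assumes \<alpha>: "1 < \<alpha>" "\<alpha> - 1 \<le> \<epsilon>" and RL: "0 < R" "R < L" and n: "1 \<le> n"
    and \<rho>: "\<rho> \<in> density_ops (a ^ n)"
    and Q: "2 powr ((\<alpha> - 1) * (real n * L)) < sandw \<alpha> (\<N> n \<rho>) (\<M> n \<rho>)"
  obtains m s \<beta> c where "1 \<le> m" "attains m s \<beta>" "real m * R \<le> c" "\<beta> \<le> 2 powr (- c)" "2 powr (- \<epsilon> * c) \<le> s"
proof -
  define Q where "Q = sandw \<alpha> (\<N> n \<rho>) (\<M> n \<rho>)"
  obtain C where C: "sandw_pair \<alpha> n Q C" using sandw_pair_exists[OF \<rho>] unfolding Q_def by blast
  define B where "B = (\<alpha> - 1) * real n * (L - R)"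
  have B: "0 < B" using \<alpha> RL n by (simp add: B_def)
  define C' where "C' = real C + 1"
  have "0 < C'" by (simp add: C'_def)
  have "0 < \<alpha> + 1" using \<alpha> by simp
  have "filterlim (\<lambda>k::nat. B * (real k + 1) - (\<alpha> + 1) * log 2 (C' * (real k + 1) + 1)) at_top sequentially"
    using \<open>0 < B\<close> \<open>0 < C'\<close> \<open>0 < \<alpha> + 1\<close> by real_asymp
  then have "eventually (\<lambda>k. 2 * (\<alpha> - 1) \<le> B * (real k + 1) - (\<alpha> + 1) * log 2 (C' * (real k + 1) + 1)) sequentially"
    by (rule filterlim_at_top[THEN iffD1, rule_format])
  \<comment> \<open>The constant 2 (\<alpha> - 1) pays for the factor 2^(\<alpha>-1) and for the
    summand 1 in A + 1. Using k + 1 copies rules out an empty block.\<close>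
  then obtain k where k: "2 * (\<alpha> - 1) \<le> B * (real k + 1) - (\<alpha> + 1) * log 2 (C' * (real k + 1) + 1)"
    by (meson eventually_sequentially order_refl)
  define m where "m = n * Suc k"
  have "sandw_pair \<alpha> m (Q ^ Suc k) (C * Suc k)"
    using sandw_pair_power[OF C] by (simp only: m_def)
  then obtain \<phi> F q where \<phi>: "\<phi> \<in> density_ops (a ^ m)"
    "sandw \<alpha> (\<N> m \<phi>) (\<M> m \<phi>) = Q ^ Suc k"
    and F: "diagd (b ^ m) (\<M> m \<phi>) F q"
    and q: "\<And>i. i < b ^ m \<Longrightarrow> 0 \<le> q i" "\<And>i. i < b ^ m \<Longrightarrow> 0 < q i \<Longrightarrow> 2 powr (- real (C * Suc k)) \<le> q i"
    unfolding sandw_pair_def by blast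
  note X = density_opsD[OF pow_density(1)[OF \<phi>(1)]]
  note Y = density_opsD[OF pow_density(2)[OF \<phi>(1)]]
  have q1: "q i \<le> 1" if "i < b ^ m" for i
  proof -
    have "(\<Sum>i<b ^ m. q i) = 1" using diagd_trace[OF F] Y(2) by (metis of_real_eq_1_iff)
    moreover have "q i \<le> (\<Sum>i<b ^ m. q i)" using that q(1) by (intro member_le_sum) auto
    ultimately show ?thesis by simp
  qed
  have big: "2 powr (\<alpha> - 1) * real (C * Suc k + 1) powr (\<alpha> + 1) * 2 powr ((\<alpha> - 1) * (real m * R + 1)) <
      sandw \<alpha> (\<N> m \<phi>) (\<M> m \<phi>)"
  proof -
    define v where "v = real (C * Suc k + 1)"
    have v: "0 < v" unfolding v_def by (simp only: of_nat_0_less_iff)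
    have "v \<le> C' * (real k + 1) + 1" by (simp add: v_def C'_def algebra_simps)
    note v = v this
    have "log 2 v \<le> log 2 (C' * (real k + 1) + 1)" using v by (subst log_le_cancel_iff) auto
    then have "(\<alpha> + 1) * log 2 v \<le> (\<alpha> + 1) * log 2 (C' * (real k + 1) + 1)"
      using \<alpha> by (intro mult_left_mono) auto
    with k have *: "(\<alpha> - 1) + (\<alpha> + 1) * log 2 v + (\<alpha> - 1) * (real m * R + 1) \<le> (\<alpha> - 1) * (real n * L) * real (Suc k)"
      by (simp add: B_def m_def algebra_simps)
    have "v powr (\<alpha> + 1) = 2 powr ((\<alpha> + 1) * log 2 v)"
      using v by (simp add: powr_def log_def)
    then have "2 powr (\<alpha> - 1) * v powr (\<alpha> + 1) * 2 powr ((\<alpha> - 1) * (real m * R + 1)) =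
        2 powr ((\<alpha> - 1) + (\<alpha> + 1) * log 2 v + (\<alpha> - 1) * (real m * R + 1))"
      by (simp only: powr_add)
    also have "\<dots> \<le> 2 powr ((\<alpha> - 1) * (real n * L) * real (Suc k))"
      using * by (rule powr_mono) simp
    also have "\<dots> = (2 powr ((\<alpha> - 1) * (real n * L))) ^ Suc k"
      by (simp only: powr_powr[symmetric]) (rule powr_realpow, simp)
    also have "\<dots> < Q ^ Suc k" using Q unfolding Q_def by (intro power_strict_mono) auto
    finally show ?thesis unfolding \<phi>(2) v_def .
  qed
  obtain T c where T: "psd (b ^ m) T" "psd (b ^ m) (1\<^sub>m (b ^ m) - T)" and c: "real m * R \<le> c"
    "Re (mat_trace (T * \<M> m \<phi>)) \<le> 2 powr (- c)"
    "2 powr (- \<epsilon> * c) \<le> Re (mat_trace (T * \<N> m \<phi>))"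
    using one_shot_test[OF X(1,2) F q(1) q1 q(2) \<alpha> _ big] RL by auto
  have "attains m (Re (mat_trace (T * \<N> m \<phi>))) (Re (mat_trace (T * \<M> m \<phi>)))"
    unfolding attains_alt using \<phi>(1) T by (auto simp: strategy_def)
  moreover have "1 \<le> m" using n by (simp add: m_def)
  ultimately show ?thesis using c that by blast
qed

text \<open>The block strategy is repeated only as often as the Type-II exponent \<open>R'\<close> requires, so that
  the success probability decays at rate at most about \<open>\<epsilon> R'\<close>, whatever the size of \<open>c\<close>.\<close>

lemma repeat_block_strategy:
  assumes a: "0 < a" and m: "attains m s \<beta>" and R: "0 < R'" "R' < R" "real m * R \<le> c" "1 \<le> m"
    and \<beta>: "\<beta> \<le> 2 powr (- c)" and s: "2 powr (- \<epsilon> * c) \<le> s" and \<epsilon>: "0 \<le> \<epsilon>" "2 * \<epsilon> * R' \<le> \<delta>" "0 < \<delta>"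
  shows "\<forall>\<^sub>F n in sequentially. \<exists>s \<beta>. attains n s \<beta> \<and> \<beta> \<le> 2 powr (- real n * R') \<and> 2 powr (- \<delta> * real n) \<le> s"
proof -
  have mR: "0 < real m * R" using R by simp
  then have c: "0 < c" using R by linarith
  \<comment> \<open>The first threshold guarantees that all repetitions fit into n uses, which needs
    R' < R; the second pays for rounding up their number, a loss of at most \<epsilon> c in the
    exponent. Each of this loss and the main term \<epsilon> n R' takes half of \<delta> n.\<close>
  have "\<forall>\<^sub>F n in sequentially. real m / (1 - R' / R) \<le> real n \<and> 2 * \<epsilon> * c / \<delta> \<le> real n"
    by (intro eventually_conj eventually_real_ge)
  then show ?thesis
  proof (rule eventually_mono)
    fix n assume *: "real m / (1 - R' / R) \<le> real n \<and> 2 * \<epsilon> * c / \<delta> \<le> real n"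
    \<comment> \<open>The least number of repetitions with total Type-II exponent c j at least n
      R'.\<close>
    define j where "j = nat \<lceil>real n * R' / c\<rceil>"
    have "0 \<le> real n * R' / c" using R c by simp
    then have j: "real n * R' / c \<le> real j" "real j \<le> real n * R' / c + 1"
      unfolding j_def by linarith+
    have j1: "real n * R' \<le> c * real j" and j2: "c * real j \<le> real n * R' + c"
      using j c by (simp_all add: field_simps)
    have "real m * real j \<le> real m * (real n * R' / c) + real m"
      using mult_left_mono[OF j(2), of "real m"] by (simp add: distrib_left)
    also have "real m * (real n * R' / c) \<le> real n * R' / R"
    proof -
      have "real n * R' * (real m * R) \<le> real n * R' * c" using R by (intro mult_left_mono) auto
      then show ?thesis using c R by (simp add: field_simps)
    qed
    also have "real n * R' / R + real m \<le> real n"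
    proof -
      have "0 < 1 - R' / R" using R by simp
      then have "real m \<le> real n * (1 - R' / R)" using * by (simp add: divide_le_eq)
      then show ?thesis by (simp add: algebra_simps)
    qed
    finally have "real (m * j) \<le> real n" by simp
    then have mj: "m * j \<le> n" by (simp only: of_nat_le_iff)
    have "attains (m * j + (n - m * j)) (s ^ j * 1) (\<beta> ^ j * 1)"
      by (rule attains_mult[OF attains_power[OF a m] attains_trivial[OF a]])
    then have "attains n (s ^ j) (\<beta> ^ j)" using mj by simp
    moreover have "\<beta> ^ j \<le> 2 powr (- real n * R')"
    proof -
      have "\<beta> ^ j \<le> (2 powr (- c)) ^ j" using \<beta> attains_bounds(3)[OF m] by (intro power_mono) auto
      also have "\<dots> = 2 powr (- (c * real j))" by (simp add: powr_realpow[symmetric] powr_powr)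
      also have "\<dots> \<le> 2 powr (- real n * R')" using j1 by (intro powr_mono) auto
      finally show ?thesis .
    qed
    moreover have "2 powr (- \<delta> * real n) \<le> s ^ j"
    proof -
      have "2 * (\<epsilon> * (c * real j)) \<le> 2 * (\<epsilon> * (real n * R' + c))"
        using j2 \<epsilon> by (intro mult_left_mono) auto
      also have "\<dots> = real n * (2 * \<epsilon> * R') + 2 * \<epsilon> * c" by (simp add: algebra_simps)
      also have "\<dots> \<le> real n * \<delta> + real n * \<delta>"
        using * \<epsilon> by (intro add_mono mult_left_mono) (auto simp: divide_le_eq)
      finally have "\<epsilon> * (c * real j) \<le> \<delta> * real n" by (simp add: mult.commute)
      then have "2 powr (- \<delta> * real n) \<le> 2 powr (- (\<epsilon> * (c * real j)))" by (intro powr_mono) auto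
      also have "\<dots> = (2 powr (- \<epsilon> * c)) ^ j" by (simp add: powr_realpow[symmetric] powr_powr mult.assoc)
      also have "\<dots> \<le> s ^ j" using s by (intro power_mono) auto
      finally show ?thesis .
    qed
    ultimately show "\<exists>s \<beta>. attains n s \<beta> \<and> \<beta> \<le> 2 powr (- real n * R') \<and> 2 powr (- \<delta> * real n) \<le> s"
      by blast
  qed
qed

text \<open>The strategy with at least half of the supremal success probability serves all rates \<open>\<delta>\<close> at once.\<close>

lemma subexponential_contradiction:
  assumes a: "0 < a" and esc: "exp_strong_converse a b N M" and R: "d_reg a b N M < ereal R" "0 < R"
    and ev: "\<And>\<delta>. 0 < \<delta> \<Longrightarrow> \<forall>\<^sub>F n in sequentially.
      \<exists>s \<beta>. attains n s \<beta> \<and> \<beta> \<le> 2 powr (- real n * R) \<and> 2 powr (- \<delta> * real n) \<le> s"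
  shows False
proof -
  let ?I = "type_I_error a b N"
  let ?II = "type_II_error a b M"
  define S where "S n = {s. \<exists>\<beta>. attains n s \<beta> \<and> \<beta> \<le> 2 powr (- real n * R)}" for n
  have "\<exists>\<psi> T. strategy a b n \<psi> T \<and> (S n \<noteq> {} \<longrightarrow> ?II n \<psi> T \<le> 2 powr (- real n * R) \<and>
      (\<forall>s\<in>S n. s \<le> 2 * (1 - ?I n \<psi> T)))" for n
  proof (cases "S n = {}")
    case True
    then show ?thesis using attains_trivial[OF a, of n] by (auto simp: attains_def)
  next
    case False
    have bdd: "bdd_above (S n)" using attains_bounds by (intro bdd_aboveI[of _ 1]) (auto simp: S_def)
    have "\<exists>s0\<in>S n. \<forall>s\<in>S n. s \<le> 2 * s0"
    proof (cases "0 < Sup (S n)")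
      case True
      then have "Sup (S n) / 2 < Sup (S n)" by simp
      then obtain s0 where s0: "s0 \<in> S n" "Sup (S n) / 2 < s0" using less_cSup_iff[OF False bdd] by blast
      have "s \<le> 2 * s0" if "s \<in> S n" for s using cSup_upper[OF that bdd] s0(2) by linarith
      with s0(1) show ?thesis by blast
    next
      \<comment> \<open>Success probabilities are nonnegative, so here all of them vanish and any
        element of \<open>S n\<close> will do.\<close>
      case neg: False
      obtain s0 where s0: "s0 \<in> S n" using False by blast
      then have "0 \<le> s0" using attains_bounds by (auto simp: S_def)
      then have "s \<le> 2 * s0" if "s \<in> S n" for s using cSup_upper[OF that bdd] neg by linarith
      with s0 show ?thesis by blast
    qed
    then show ?thesis unfolding S_def attains_def by blast
  qed
  then obtain \<psi> T where strat: "\<And>n. strategy a b n (\<psi> n) (T n)"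
    and II: "\<And>n. S n \<noteq> {} \<Longrightarrow> ?II n (\<psi> n) (T n) \<le> 2 powr (- real n * R)"
    and I: "\<And>n s. s \<in> S n \<Longrightarrow> s \<le> 2 * (1 - ?I n (\<psi> n) (T n))"
    by (metis empty_iff)
  have "(0 :: real) < 1" by simp
  from ev[OF this] eventually_gt_at_top[of 0]
  have "\<forall>\<^sub>F n in sequentially. ereal R \<le> ereal (1 / real n) * neg_log2 (?II n (\<psi> n) (T n))"
  proof eventually_elim
    case (elim n)
    then have "S n \<noteq> {}" by (auto simp: S_def)
    note II = II[OF this]
    have n: "0 < real n" using elim by simp
    show ?case
    proof (cases "0 < ?II n (\<psi> n) (T n)")
      case True
      then have "log 2 (?II n (\<psi> n) (T n)) \<le> - real n * R"
        using II by (simp add: log_le_iff)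
      then have "R \<le> 1 / real n * - log 2 (?II n (\<psi> n) (T n))"
        using n by (simp add: field_simps)
      then show ?thesis using True by (simp add: neg_log2_def)
    qed (use n in \<open>simp add: neg_log2_def\<close>)
  qed
  then have "ereal R \<le> liminf (\<lambda>n. ereal (1 / real n) * neg_log2 (?II n (\<psi> n) (T n)))"
    by (rule Liminf_bounded)
  with R(1) have "d_reg a b N M < liminf (\<lambda>n. ereal (1 / real n) * neg_log2 (?II n (\<psi> n) (T n)))"
    by (rule less_le_trans)
  with esc strat obtain c k where c: "0 < c" and k: "strict_mono (k :: nat \<Rightarrow> nat)"
    and conv: "\<forall>\<^sub>F i in sequentially. 1 - ?I (k i) (\<psi> (k i)) (T (k i)) \<le> 2 powr (- c * real (k i))"
    unfolding exp_strong_converse_def by blast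
  \<comment> \<open>Half the rate granted by the strong converse: 2^(-c n / 2) \<le> 2 * 2^(-c n)
    fails as soon as n > 2 / c, and the subsequence passes this point.\<close>
  have "\<forall>\<^sub>F n in sequentially. 2 powr (- (c / 2) * real n) \<le> 2 * (1 - ?I n (\<psi> n) (T n)) \<and> 2 / c < real n"
  proof (rule eventually_conj)
    show "\<forall>\<^sub>F n in sequentially. 2 powr (- (c / 2) * real n) \<le> 2 * (1 - ?I n (\<psi> n) (T n))"
      using ev[OF half_gt_zero[OF c]]
    proof eventually_elim
      case (elim n)
      then obtain s where "s \<in> S n" "2 powr (- (c / 2) * real n) \<le> s" by (auto simp: S_def)
      with I show ?case using order_trans by blast
    qed
    show "\<forall>\<^sub>F n in sequentially. 2 / c < real n"
      using filterlim_real_sequentially by (simp add: filterlim_at_top_dense)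
  qed
  then have "\<forall>\<^sub>F i in sequentially. 2 powr (- (c / 2) * real (k i)) \<le> 2 * (1 - ?I (k i) (\<psi> (k i)) (T (k i))) \<and> 2 / c < real (k i)"
    by (rule eventually_compose_filterlim[OF _ filterlim_subseq[OF k]])
  with conv have "\<forall>\<^sub>F i :: nat in sequentially. False"
  proof eventually_elim
    case (elim i)
    have "2 powr (- (c / 2) * real (k i)) \<le> 2 * (1 - ?I (k i) (\<psi> (k i)) (T (k i)))"
      using elim(2) by blast
    also have "\<dots> \<le> 2 * 2 powr (- c * real (k i))" using elim(1) by (rule mult_left_mono) simp
    also have "\<dots> = 2 powr (1 - c * real (k i))" by (simp add: powr_add powr_diff powr_minus field_simps)
    finally have "- (c / 2) * real (k i) \<le> 1 - c * real (k i)" by simp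
    moreover have "1 < c / 2 * real (k i)" using elim c by (simp add: field_simps)
    ultimately show False by (simp add: field_simps)
  qed
  then show False by simp
qed

section \<open>Regularized divergences and the two implications\<close>

lemma chan_div_le_reg:
  assumes "1 \<le> n" "\<rho> \<in> density_ops (a ^ n)"
  shows "ereal (1 / real n) * D (\<N> n \<rho>) (\<M> n \<rho>) \<le> chan_div_reg D a b N M"
proof -
  have "D (\<N> n \<rho>) (\<M> n \<rho>) \<le> chan_div D (a ^ n) (\<N> n) (\<M> n)"
    unfolding chan_div_def by (rule SUP_upper[OF assms(2)])
  then have "ereal (1 / real n) * D (\<N> n \<rho>) (\<M> n \<rho>) \<le>
      ereal (1 / real n) * chan_div D (a ^ n) (\<N> n) (\<M> n)"
    by (rule ereal_mult_left_mono) simp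
  also have "\<dots> \<le> chan_div_reg D a b N M"
    unfolding chan_div_reg_def by (rule SUP_upper) (use assms in simp)
  finally show ?thesis .
qed

lemma
  assumes "1 \<le> n"
  shows ereal_scaled_less: "ereal (1 / real n) * x < ereal r \<Longrightarrow> x < ereal (real n * r)"
    and ereal_less_scaled: "ereal r < ereal (1 / real n) * x \<Longrightarrow> ereal (real n * r) < x"
  using assms by (cases x; auto simp: field_simps split: if_splits)+

lemma less_reg:
  assumes "ereal L < chan_div_reg D a b N M"
  obtains n \<rho> where "1 \<le> n" "\<rho> \<in> density_ops (a ^ n)"
    "ereal (real n * L) < D (\<N> n \<rho>) (\<M> n \<rho>)"
proof -
  obtain n where n: "1 \<le> n" "ereal L < ereal (1 / real n) * chan_div D (a ^ n) (\<N> n) (\<M> n)"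
    using assms unfolding chan_div_reg_def less_SUP_iff by auto
  from ereal_less_scaled[OF n] obtain \<rho> where "\<rho> \<in> density_ops (a ^ n)"
    "ereal (real n * L) < D (\<N> n \<rho>) (\<M> n \<rho>)"
    unfolding chan_div_def less_SUP_iff by auto
  with n(1) show ?thesis by (rule that)
qed

lemma d_reg_le_sandwiched:
  assumes "1 < \<alpha>" shows "d_reg a b N M \<le> sandwiched_d_reg \<alpha> a b N M"
  unfolding chan_div_reg_def chan_div_def
  by (intro SUP_subset_mono order_refl ereal_mult_left_mono rel_entropy_le_sandwiched[OF pow_density assms]) simp_all

lemma exp_strong_converse_if_limit:
  assumes lim: "((\<lambda>\<alpha>. sandwiched_d_reg \<alpha> a b N M) \<longlongrightarrow> d_reg a b N M) (at_right 1)"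
  shows "exp_strong_converse a b N M"
  unfolding exp_strong_converse_def
proof (intro allI impI)
  fix \<psi> T
  let ?II = "\<lambda>n. type_II_error a b M n (\<psi> n) (T n)"
  let ?I = "\<lambda>n. type_I_error a b N n (\<psi> n) (T n)"
  assume strat: "\<forall>n\<ge>1. strategy a b n (\<psi> n) (T n)"
    and less: "d_reg a b N M < liminf (\<lambda>n. ereal (1 / real n) * neg_log2 (?II n))"
  obtain r2 where r2: "d_reg a b N M < ereal r2" "ereal r2 < liminf (\<lambda>n. ereal (1 / real n) * neg_log2 (?II n))"
    using ereal_dense2[OF less] by blast
  obtain r1 where r1: "d_reg a b N M < ereal r1" "ereal r1 < ereal r2"
    using ereal_dense2[OF r2(1)] by blast
  have "\<forall>\<^sub>F \<alpha> in at_right 1. sandwiched_d_reg \<alpha> a b N M < ereal r1 \<and> 1 < \<alpha>"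
    using order_tendstoD(2)[OF lim r1(1)] eventually_at_right_less[of "1 :: real"] by (rule eventually_conj)
  then obtain \<alpha> :: real where \<alpha>: "1 < \<alpha>" "sandwiched_d_reg \<alpha> a b N M < ereal r1"
    using eventually_happens'[OF trivial_limit_at_right_real] by blast
  \<comment> \<open>The rate that results from putting Q \<le> 2^((\<alpha>-1) n r1) and \<beta>
    \<le> 2^(-n r2) into \<open>sandw_test_bound\<close> and taking the \<alpha>-th root.\<close>
  define c where "c = (\<alpha> - 1) / \<alpha> * (r2 - r1)"
  have c: "0 < c" using \<alpha> r1 by (simp add: c_def)
  have "\<forall>\<^sub>F n in sequentially. ereal r2 < ereal (1 / real n) * neg_log2 (?II n)"
    by (rule less_LiminfD[OF r2(2)])
  then have "\<forall>\<^sub>F n in sequentially. 1 - ?I n \<le> 2 powr (- c * real n)"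
    using eventually_ge_at_top[of 1]
  proof eventually_elim
    case (elim n)
    from elim(2) strat have st: "strategy a b n (\<psi> n) (T n)" by simp
    then have \<psi>: "\<psi> n \<in> density_ops (a ^ n)" and Tn: "psd (b ^ n) (T n)" "psd (b ^ n) (1\<^sub>m (b ^ n) - T n)"
      by (simp_all add: strategy_def)
    let ?X = "\<N> n (\<psi> n)" and ?Y = "\<M> n (\<psi> n)"
    note X = density_opsD[OF pow_density(1)[OF \<psi>]]
    note Y = density_opsD[OF pow_density(2)[OF \<psi>]]
    define s where "s = Re (mat_trace (T n * ?X))"
    define \<beta> where "\<beta> = Re (mat_trace (T n * ?Y))"
    define Q where "Q = sandw \<alpha> ?X ?Y"
    have s0: "0 \<le> s" unfolding s_def by (rule mat_trace_mult_nonneg[OF Tn(1) X(1)])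
    have \<beta>0: "0 \<le> \<beta>" unfolding \<beta>_def by (rule mat_trace_mult_nonneg[OF Tn(1) Y(1)])
    have \<beta>: "\<beta> \<le> 2 powr (- real n * r2)"
    proof (cases "\<beta> = 0")
      case False
      with \<beta>0 have pos: "0 < \<beta>" by simp
      from ereal_less_scaled[OF elim(2,1)] have "real n * r2 < - log 2 \<beta>"
        using pos by (simp add: type_II_error_def \<beta>_def neg_log2_def)
      then have "log 2 \<beta> \<le> - real n * r2" by simp
      then show ?thesis using pos by (simp add: log_le_iff)
    qed simp
    have "ereal (1 / real n) * sandwiched \<alpha> ?X ?Y < ereal r1"
      using chan_div_le_reg[OF elim(2) \<psi>, of "sandwiched \<alpha>"] \<alpha>(2) by (rule le_less_trans)
    from ereal_scaled_less[OF elim(2) this]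
    have D: "sandwiched \<alpha> ?X ?Y < ereal (real n * r1)" .
    then have supp: "supp ?X \<subseteq> supp ?Y" by (auto simp: sandwiched_eq split: if_splits)
    have bound: "s powr \<alpha> \<le> Q * \<beta> powr (\<alpha> - 1)"
      unfolding s_def \<beta>_def Q_def by (rule sandw_test_bound[OF X(1) Y(1) supp Tn \<alpha>(1)])
    \<comment> \<open>The divergence bounds Q only through its logarithm, which is informative for
      positive Q alone; otherwise the claim is immediate.\<close>
    have Q: "Q \<le> 2 powr ((\<alpha> - 1) * (real n * r1))"
    proof (cases "0 < Q")
      case True
      from D supp have "1 / (\<alpha> - 1) * log 2 Q < real n * r1" by (simp add: sandwiched_eq Q_def)
      then have "log 2 Q \<le> (\<alpha> - 1) * (real n * r1)" using \<alpha>(1) by (simp add: field_simps)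
      then show ?thesis using True by (simp add: log_le_iff)
    next
      case False
      then show ?thesis by (meson linorder_not_less order_trans powr_ge_zero)
    qed
    have "Q * \<beta> powr (\<alpha> - 1) \<le> 2 powr ((\<alpha> - 1) * (real n * r1)) * (2 powr (- real n * r2)) powr (\<alpha> - 1)"
      using Q \<beta> \<beta>0 \<alpha>(1) by (intro mult_mono powr_mono2) auto
    also have "\<dots> = 2 powr (- c * real n * \<alpha>)"
    proof -
      have "c * \<alpha> = (\<alpha> - 1) * (r2 - r1)" using \<alpha>(1) by (simp add: c_def)
      then have "- (c * \<alpha>) * real n = (\<alpha> - 1) * (real n * r1) + - real n * r2 * (\<alpha> - 1)"
        by (simp only:) (simp add: algebra_simps)
      moreover have "- c * real n * \<alpha> = - (c * \<alpha>) * real n" by simp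
      ultimately have "- c * real n * \<alpha> = (\<alpha> - 1) * (real n * r1) + - real n * r2 * (\<alpha> - 1)" by simp
      then show ?thesis by (simp only: powr_powr powr_add)
    qed
    finally have "s powr \<alpha> \<le> 2 powr (- c * real n * \<alpha>)" using bound by linarith
    then have "(s powr \<alpha>) powr (1 / \<alpha>) \<le> (2 powr (- c * real n * \<alpha>)) powr (1 / \<alpha>)"
      using \<alpha>(1) by (intro powr_mono2) auto
    then have "s \<le> 2 powr (- c * real n)" using \<alpha>(1) s0 by (simp add: powr_powr)
    then show ?case by (simp add: one_minus_type_I[OF st] s_def)
  qed
  \<comment> \<open>The bound holds for all large n, so the whole sequence serves as the
    subsequence.\<close>
  with c show "\<exists>c>0. \<exists>k :: nat \<Rightarrow> nat. strict_mono k \<and>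
      (\<forall>\<^sub>F i in sequentially. 1 - type_I_error a b N (k i) (\<psi> (k i)) (T (k i)) \<le> 2 powr (- c * real (k i)))"
    by (intro exI[of _ c] conjI exI[of _ "\<lambda>i. i"]) (auto simp: strict_mono_def)
qed

lemma limit_if_exp_strong_converse:
  assumes esc: "exp_strong_converse a b N M"
  shows "((\<lambda>\<alpha>. sandwiched_d_reg \<alpha> a b N M) \<longlongrightarrow> d_reg a b N M) (at_right 1)"
proof (cases "a = 0")
  case True
  \<comment> \<open>In dimension 0 there are no states and both suprema range over the empty set; n
    \<ge> 1 matters because a^0 = 1.\<close>
  have "density_ops (a ^ n) = {}" if "1 \<le> n" for n
  proof -
    have "a ^ n = 0" using that True by simp
    show ?thesis unfolding \<open>a ^ n = 0\<close> by (auto simp: density_ops_def mat_trace_def dest!: psd_carrier)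
  qed
  then have "sandwiched_d_reg \<alpha> a b N M = d_reg a b N M" for \<alpha>
    unfolding chan_div_reg_def chan_div_def by (intro SUP_cong) auto
  then show ?thesis by (simp only: tendsto_const)
next
  case False
  then have a: "0 < a" by simp
  have ge: "\<forall>\<^sub>F \<alpha> in at_right 1. d_reg a b N M \<le> sandwiched_d_reg \<alpha> a b N M"
    using eventually_at_right_less[of "1 :: real"] by eventually_elim (rule d_reg_le_sandwiched)
  have d0: "0 \<le> d_reg a b N M"
  proof -
    obtain \<rho> where \<rho>: "\<rho> \<in> density_ops (a ^ 1)" using density_ops_nonempty[of "a ^ 1"] a by auto
    have "0 \<le> ereal (1 / real 1) * rel_entropy (\<N> 1 \<rho>) (\<M> 1 \<rho>)"
      using rel_entropy_nonneg[OF pow_density[OF \<rho>]] by simp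
    also have "\<dots> \<le> d_reg a b N M" by (rule chan_div_le_reg[OF _ \<rho>]) simp
    finally show ?thesis .
  qed
  show ?thesis
  proof (rule order_tendstoI)
    fix x assume "x < d_reg a b N M"
    then show "\<forall>\<^sub>F \<alpha> in at_right 1. x < sandwiched_d_reg \<alpha> a b N M"
      using ge by (auto elim: eventually_mono)
  next
    fix x assume x: "d_reg a b N M < x"
    show "\<forall>\<^sub>F \<alpha> in at_right 1. sandwiched_d_reg \<alpha> a b N M < x"
    proof (rule ccontr)
      assume neg: "\<not> ?thesis"
      \<comment> \<open>Three rates above d_reg: L is exceeded by the sandwiched divergence, R < L
        absorbs the polynomial loss in \<open>block_strategy\<close>, and R' < R leaves room for the
        rounding in \<open>repeat_block_strategy\<close>.\<close>
      obtain L where L: "d_reg a b N M < ereal L" "ereal L < x" using ereal_dense2[OF x] by blast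
      obtain R where R: "d_reg a b N M < ereal R" "ereal R < ereal L" using ereal_dense2[OF L(1)] by blast
      obtain R' where R': "d_reg a b N M < ereal R'" "ereal R' < ereal R" using ereal_dense2[OF R(1)] by blast
      have pos: "0 < R'" using le_less_trans[OF d0 R'(1)] by simp
      have "\<forall>\<^sub>F n in sequentially. \<exists>s \<beta>. attains n s \<beta> \<and> \<beta> \<le> 2 powr (- real n * R') \<and> 2 powr (- \<delta> * real n) \<le> s"
        if \<delta>: "0 < \<delta>" for \<delta>
      proof -
        define \<epsilon> where "\<epsilon> = \<delta> / (2 * R')"
        have \<epsilon>: "0 < \<epsilon>" "2 * \<epsilon> * R' = \<delta>" using \<delta> pos by (simp_all add: \<epsilon>_def)
        have "\<exists>\<alpha>>1. \<alpha> < 1 + \<epsilon> \<and> \<not> sandwiched_d_reg \<alpha> a b N M < x"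
          using neg \<epsilon>(1) unfolding eventually_at_right_field by (metis less_add_same_cancel1)
        then obtain \<alpha> where \<alpha>: "1 < \<alpha>" "\<alpha> < 1 + \<epsilon>" "x \<le> sandwiched_d_reg \<alpha> a b N M"
          by (auto simp: not_less)
        obtain n \<rho> where n: "1 \<le> n" and \<rho>: "\<rho> \<in> density_ops (a ^ n)"
          and D: "ereal (real n * L) < sandwiched \<alpha> (\<N> n \<rho>) (\<M> n \<rho>)"
          using less_reg[OF less_le_trans[OF L(2) \<alpha>(3)]] by blast
        let ?X = "\<N> n \<rho>" and ?Y = "\<M> n \<rho>"
        \<comment> \<open>A finite regularized relative entropy forces inclusion of the supports, so
          the large sandwiched divergence is not an infinite default but comes from a large
          trace.\<close>
        have "ereal (1 / real n) * rel_entropy ?X ?Y < ereal L"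
          using chan_div_le_reg[OF n \<rho>] L(1) by (rule le_less_trans)
        from ereal_scaled_less[OF n this] have supp: "supp ?X \<subseteq> supp ?Y"
          by (auto simp: rel_entropy_def split: if_splits)
        have L0: "0 < (\<alpha> - 1) * (real n * L)" using \<alpha>(1) n pos R R' by simp
        from D supp have "real n * L < 1 / (\<alpha> - 1) * log 2 (sandw \<alpha> ?X ?Y)" by (simp add: sandwiched_eq)
        then have lg: "(\<alpha> - 1) * (real n * L) < log 2 (sandw \<alpha> ?X ?Y)" using \<alpha>(1) by (simp add: field_simps)
        have "0 \<le> sandw \<alpha> ?X ?Y"
        proof -
          obtain F q where F: "diagd (b ^ n) ?Y F q"
            using psd_diagd[OF density_opsD(1)[OF pow_density(2)[OF \<rho>]]] by blast
          show ?thesis unfolding sandw_def Let_def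
            by (rule trpow_nonneg[OF sandwich_psd[OF density_opsD(1)[OF pow_density(1)[OF \<rho>]] F]])
        qed
        \<comment> \<open>A vanishing trace would have logarithm 0 by convention, contradicting the
          positive lower bound.\<close>
        then have "0 < sandw \<alpha> ?X ?Y" using lg L0 by (cases "sandw \<alpha> ?X ?Y = 0") (auto simp: log_def)
        then have Q: "2 powr ((\<alpha> - 1) * (real n * L)) < sandw \<alpha> ?X ?Y" using lg by (simp add: less_log_iff)
        have "\<alpha> - 1 \<le> \<epsilon>" "0 < R" "R < L" using \<alpha>(2) R R' pos by auto
        from block_strategy[OF \<alpha>(1) this n \<rho> Q] obtain m s \<beta> c where
          m: "1 \<le> m" "attains m s \<beta>" "real m * R \<le> c" "\<beta> \<le> 2 powr (- c)" "2 powr (- \<epsilon> * c) \<le> s"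
          by blast
        show ?thesis
          by (rule repeat_block_strategy[OF a m(2) pos _ m(3,1,4,5)]) (use R' \<epsilon> \<delta> in auto)
      qed
      from subexponential_contradiction[OF a esc R'(1) pos this] show False .
    qed
  qed
qed

end

theorem theorem21:
  fixes dA dB :: nat
    and N M :: "complex mat \<Rightarrow> complex mat"
  assumes "channel dA dB N" and "channel dA dB M"
  defines "IN \<equiv> tensor_map dA dA dA dB (\<lambda>X. X) N"
    and "IM \<equiv> tensor_map dA dA dA dB (\<lambda>X. X) M"
  shows "(((\<lambda>\<alpha>. sandwiched_d_reg \<alpha> dA dB N M) \<longlongrightarrow> d_reg dA dB N M) (at_right 1)
            \<longrightarrow> exp_strong_converse dA dB N M)
       \<and> (exp_strong_converse (dA * dA) (dA * dB) IN IM
            \<longrightarrow> ((\<lambda>\<alpha>. sandwiched_d_reg \<alpha> (dA * dA) (dA * dB) IN IM)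
                  \<longlongrightarrow> d_reg (dA * dA) (dA * dB) IN IM) (at_right 1))"
proof -
  have NM: "qchan dA dB N" "qchan dA dB M" using assms(1,2) by (simp_all add: channel_qchan)
  have "qchan (dA * dA) (dA * dB) IN" "qchan (dA * dA) (dA * dB) IM"
    unfolding IN_def IM_def by (rule qchan_tensor_map[OF qchan_id], rule NM)+
  then show ?thesis
    using exp_strong_converse_if_limit[OF NM] limit_if_exp_strong_converse by blast
qed

end
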